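(* Let $A$ be a ring, $I$ an ideal of $A$ and $M$ an $A$-module. Let $J\subseteq I$ be a reduction of $I$ with respect to $M$, with reduction number $\mathrm{rn}_{J}(I;M)=r$. Then $$\mathrm{rt}(I;M)\le\mathrm{rn}_{J}(I;M)+\mathrm{rt}(J;I^{r}M).$$
   Context: All rings are commutative with identity. Reductions: an ideal $J\subseteq I$ is a reduction of $I$ with respect to $M$ if $I^{n+1}M=JI^{n}M$ for some integer $n\ge0$; the least such $n$ is denoted $\mathrm{rn}_J(I;M)$. Relation type: a standard $A$-algebra is a commutative graded algebra $U=\bigoplus_{n\ge0}U_n$ with $U_0=A$, generated by $U_1$; a standard $U$-module is a graded $U$-module $F=\bigoplus_{n\ge0}F_n$ with $F_n=U_nF_0$ for all $n$. Let $\gamma:\mathbf{S}(U_1)\otimes_A F_0\to U\otimes_A F_0\to F$ be the canonical surjection, $\mathbf{S}$ denoting the symmetric algebra. For $n\ge2$ put $E(F)_n=\ker\gamma_n/U_1\ker\gamma_{n-1}$, and $\mathrm{rt}(F)=\min\{r\ge1\mid E(F)_n=0\text{ for all }n\ge r+1\}$ ($\infty$ if no such $r$ exists). For an ideal $I$ and a module $M$, $\mathcal{R}(I)=\bigoplus_{n\ge0}I^n$ is the Rees algebra, $\mathcal{R}(I;M)=\bigoplus_{n\ge0}I^nM$ is the Rees module (a standard $\mathcal{R}(I)$-module), and $\mathrm{rt}(I;M)=\mathrm{rt}(\mathcal{R}(I;M))$. Likewise $\mathrm{rt}(J;I^rM)=\mathrm{rt}(\mathcal{R}(J;I^rM))$.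 *)

theory Defs
  imports "HOL-Algebra.Algebra" "HOL-Library.Extended_Nat"
begin

section \<open>Modules\<close>

text \<open>Records of type \<^typ>\<open>('a, 'm) module\<close> also carry the ring fields \<open>mult\<close> and \<open>one\<close>.
  For a plain module these two fields mean nothing; they matter only for algebras.\<close>

definition span_submodule ::
    "('a, 'b) ring_scheme \<Rightarrow> ('a, 'm, 'c) module_scheme \<Rightarrow> 'm set \<Rightarrow> 'm set" where
  "span_submodule R M S = \<Inter> {H. submodule H R M \<and> S \<subseteq> H}"

text \<open>The quotient of a module by a submodule or, through the fields \<open>mult\<close> and \<open>one\<close>,
  of an algebra by an ideal (then it is \<^const>\<open>FactRing\<close> together with scalars).\<close>

definition quot_module :: "('a, 'm, 'c) module_scheme \<Rightarrow> 'm set \<Rightarrow> ('a, 'm set) module" where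
  "quot_module M N = \<lparr>
     carrier = a_rcosets\<^bsub>M\<^esub> N,
     monoid.mult = rcoset_mult M N,
     one = N +>\<^bsub>M\<^esub> \<one>\<^bsub>M\<^esub>,
     ring.zero = N,
     add = set_add M,
     smult = (\<lambda>a Z. \<Union>x\<in>Z. N +>\<^bsub>M\<^esub> (a \<odot>\<^bsub>M\<^esub> x))\<rparr>"

definition free_module :: "('a, 'b) ring_scheme \<Rightarrow> 'x set \<Rightarrow> ('a, 'x \<Rightarrow> 'a) module" where
  "free_module R Z = \<lparr>
     carrier = {f. (\<forall>x. f x \<in> carrier R) \<and> finite {x. f x \<noteq> \<zero>\<^bsub>R\<^esub>} \<and> {x. f x \<noteq> \<zero>\<^bsub>R\<^esub>} \<subseteq> Z},
     monoid.mult = undefined,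
     one = undefined,
     ring.zero = (\<lambda>_. \<zero>\<^bsub>R\<^esub>),
     add = (\<lambda>f g x. f x \<oplus>\<^bsub>R\<^esub> g x),
     smult = (\<lambda>a f x. a \<otimes>\<^bsub>R\<^esub> f x)\<rparr>"

definition free_gen :: "('a, 'b) ring_scheme \<Rightarrow> 'x \<Rightarrow> 'x \<Rightarrow> 'a" where
  "free_gen R x = (\<lambda>y. if y = x then \<one>\<^bsub>R\<^esub> else \<zero>\<^bsub>R\<^esub>)"


section \<open>Tensor products\<close>

definition tensor_relations ::
    "('a, 'b) ring_scheme \<Rightarrow> ('a, 'm, 'c) module_scheme \<Rightarrow> ('a, 'n, 'd) module_scheme
      \<Rightarrow> ('m \<times> 'n \<Rightarrow> 'a) set" where
  "tensor_relations R M N = (let L = free_module R (carrier M \<times> carrier N); e = free_gen R in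
     {e (x \<oplus>\<^bsub>M\<^esub> x', y) \<ominus>\<^bsub>L\<^esub> (e (x, y) \<oplus>\<^bsub>L\<^esub> e (x', y)) | x x' y.
        x \<in> carrier M \<and> x' \<in> carrier M \<and> y \<in> carrier N}
   \<union> {e (x, y \<oplus>\<^bsub>N\<^esub> y') \<ominus>\<^bsub>L\<^esub> (e (x, y) \<oplus>\<^bsub>L\<^esub> e (x, y')) | x y y'.
        x \<in> carrier M \<and> y \<in> carrier N \<and> y' \<in> carrier N}
   \<union> {e (a \<odot>\<^bsub>M\<^esub> x, y) \<ominus>\<^bsub>L\<^esub> (a \<odot>\<^bsub>L\<^esub> e (x, y)) | a x y.
        a \<in> carrier R \<and> x \<in> carrier M \<and> y \<in> carrier N}
   \<union> {e (x, a \<odot>\<^bsub>N\<^esub> y) \<ominus>\<^bsub>L\<^esub> (a \<odot>\<^bsub>L\<^esub> e (x, y)) | a x y.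
        a \<in> carrier R \<and> x \<in> carrier M \<and> y \<in> carrier N})"

definition tensor_kernel ::
    "('a, 'b) ring_scheme \<Rightarrow> ('a, 'm, 'c) module_scheme \<Rightarrow> ('a, 'n, 'd) module_scheme
      \<Rightarrow> ('m \<times> 'n \<Rightarrow> 'a) set" where
  "tensor_kernel R M N =
     span_submodule R (free_module R (carrier M \<times> carrier N)) (tensor_relations R M N)"

definition tensor ::
    "('a, 'b) ring_scheme \<Rightarrow> ('a, 'm, 'c) module_scheme \<Rightarrow> ('a, 'n, 'd) module_scheme
      \<Rightarrow> ('a, ('m \<times> 'n \<Rightarrow> 'a) set) module" where
  "tensor R M N = quot_module (free_module R (carrier M \<times> carrier N)) (tensor_kernel R M N)"

definition pure_tensor ::
    "('a, 'b) ring_scheme \<Rightarrow> ('a, 'm, 'c) module_scheme \<Rightarrow> ('a, 'n, 'd) module_scheme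
      \<Rightarrow> 'm \<Rightarrow> 'n \<Rightarrow> ('m \<times> 'n \<Rightarrow> 'a) set" where
  "pure_tensor R M N x y =
     tensor_kernel R M N +>\<^bsub>free_module R (carrier M \<times> carrier N)\<^esub> free_gen R (x, y)"

text \<open>The linear map out of a tensor product, with values in \<open>P\<close>, that sends \<open>x \<otimes> y\<close> to
  \<open>b x y\<close>. For bilinear \<open>b\<close> the linear extension of \<open>b\<close> to the free module is constant on
  the cosets of the relations, so that its image of a coset is a singleton.\<close>

definition tensor_lift ::
    "('a, 'b) ring_scheme \<Rightarrow> ('a, 'p, 'c) module_scheme \<Rightarrow> ('m \<Rightarrow> 'n \<Rightarrow> 'p)
      \<Rightarrow> ('m \<times> 'n \<Rightarrow> 'a) set \<Rightarrow> 'p" where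
  "tensor_lift R P b Z =
     the_elem ((\<lambda>g. \<Oplus>\<^bsub>P\<^esub>z\<in>{z. g z \<noteq> \<zero>\<^bsub>R\<^esub>}. g z \<odot>\<^bsub>P\<^esub> b (fst z) (snd z)) ` Z)"


section \<open>Symmetric algebras\<close>

text \<open>The polynomial algebra over \<open>R\<close> with one variable for each element of \<open>Z\<close>, built on the
  indexed polynomials of HOL-Algebra (functions from multisets, i.e. monomials, to coefficients),
  which come without multiplication.\<close>

definition poly_algebra ::
    "('a, 'b) ring_scheme \<Rightarrow> 'x set \<Rightarrow> ('a, 'x multiset \<Rightarrow> 'a) module" where
  "poly_algebra R Z = \<lparr>
     carrier = ring.indexed_pset R Z (carrier R),
     monoid.mult = (\<lambda>p q m. \<Oplus>\<^bsub>R\<^esub>k\<in>{k. k \<subseteq># m}. p k \<otimes>\<^bsub>R\<^esub> q (m - k)),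
     one = ring.indexed_const R \<one>\<^bsub>R\<^esub>,
     ring.zero = ring.indexed_const R \<zero>\<^bsub>R\<^esub>,
     add = ring.indexed_padd R,
     smult = (\<lambda>a p m. a \<otimes>\<^bsub>R\<^esub> p m)\<rparr>"

text \<open>The symmetric algebra of a module \<open>N\<close>: generated by variables \<open>X\<^sub>x\<close>, \<open>x \<in> N\<close>, subject to
  the relations which make \<open>x \<mapsto> X\<^sub>x\<close> linear.\<close>

definition sym_relations ::
    "('a, 'b) ring_scheme \<Rightarrow> ('a, 'n, 'c) module_scheme \<Rightarrow> ('n multiset \<Rightarrow> 'a) set" where
  "sym_relations R N = (let P = poly_algebra R (carrier N); V = ring.indexed_var R in
     {V (x \<oplus>\<^bsub>N\<^esub> y) \<ominus>\<^bsub>P\<^esub> (V x \<oplus>\<^bsub>P\<^esub> V y) | x y. x \<in> carrier N \<and> y \<in> carrier N}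
   \<union> {V (a \<odot>\<^bsub>N\<^esub> x) \<ominus>\<^bsub>P\<^esub> (a \<odot>\<^bsub>P\<^esub> V x) | a x. a \<in> carrier R \<and> x \<in> carrier N})"

definition sym_ideal ::
    "('a, 'b) ring_scheme \<Rightarrow> ('a, 'n, 'c) module_scheme \<Rightarrow> ('n multiset \<Rightarrow> 'a) set" where
  "sym_ideal R N = genideal (poly_algebra R (carrier N)) (sym_relations R N)"

definition sym_algebra ::
    "('a, 'b) ring_scheme \<Rightarrow> ('a, 'n, 'c) module_scheme
      \<Rightarrow> ('a, ('n multiset \<Rightarrow> 'a) set) module" where
  "sym_algebra R N = quot_module (poly_algebra R (carrier N)) (sym_ideal R N)"

definition sym_gen ::
    "('a, 'b) ring_scheme \<Rightarrow> ('a, 'n, 'c) module_scheme \<Rightarrow> 'n \<Rightarrow> ('n multiset \<Rightarrow> 'a) set" where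
  "sym_gen R N x = sym_ideal R N +>\<^bsub>poly_algebra R (carrier N)\<^esub> ring.indexed_var R x"

definition sym_part ::
    "('a, 'b) ring_scheme \<Rightarrow> ('a, 'n, 'c) module_scheme \<Rightarrow> nat
      \<Rightarrow> ('n multiset \<Rightarrow> 'a) set set" where
  "sym_part R N n = {sym_ideal R N +>\<^bsub>poly_algebra R (carrier N)\<^esub> p | p.
     p \<in> carrier (poly_algebra R (carrier N)) \<and> (\<forall>m. p m \<noteq> \<zero>\<^bsub>R\<^esub> \<longrightarrow> size m = n)}"


section \<open>Relation type of a standard module\<close>

text \<open>A standard algebra is given as a ring \<open>U\<close> with its homogeneous parts \<open>Ug n\<close> (so that
  the base ring is the subring \<open>Ug 0\<close> of \<open>U\<close>), and a standard \<open>U\<close>-module as a \<open>U\<close>-module \<open>F\<close>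
  with its homogeneous parts \<open>Fg n\<close>.\<close>

definition base_ring :: "('u, 'b) ring_scheme \<Rightarrow> (nat \<Rightarrow> 'u set) \<Rightarrow> ('u, 'b) ring_scheme" where
  "base_ring U Ug = U\<lparr>carrier := Ug 0\<rparr>"

text \<open>A part \<open>Z\<close> of the ring \<open>U\<close> as a module over a subring of \<open>U\<close>; used for \<open>U\<^sub>1\<close> and for
  \<open>U\<close> itself.\<close>

definition part_module :: "('u, 'b) ring_scheme \<Rightarrow> 'u set \<Rightarrow> ('u, 'u) module" where
  "part_module U Z = \<lparr>carrier = Z, monoid.mult = monoid.mult U, one = \<one>\<^bsub>U\<^esub>,
     ring.zero = \<zero>\<^bsub>U\<^esub>, add = add U, smult = monoid.mult U\<rparr>"

abbreviation part_sym ::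
    "('u, 'b) ring_scheme \<Rightarrow> (nat \<Rightarrow> 'u set) \<Rightarrow> ('u, ('u multiset \<Rightarrow> 'u) set) module" where
  "part_sym U Ug \<equiv> sym_algebra (base_ring U Ug) (part_module U (Ug 1))"

text \<open>The canonical algebra map \<open>\<^bold>S(U\<^sub>1) \<rightarrow> U\<close>: evaluate each variable \<open>X\<^sub>x\<close> at \<open>x\<close>.\<close>

definition sym_to_algebra ::
    "('u, 'b) ring_scheme \<Rightarrow> ('u multiset \<Rightarrow> 'u) set \<Rightarrow> 'u" where
  "sym_to_algebra U Z = the_elem
     ((\<lambda>p. \<Oplus>\<^bsub>U\<^esub>m\<in>{m. p m \<noteq> \<zero>\<^bsub>U\<^esub>}.
             p m \<otimes>\<^bsub>U\<^esub> (\<Otimes>\<^bsub>U\<^esub>x\<in>set_mset m. x [^]\<^bsub>U\<^esub> count m x)) ` Z)"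

definition sym_tensor ::
    "('u, 'b) ring_scheme \<Rightarrow> (nat \<Rightarrow> 'u set) \<Rightarrow> ('u, 'f, 'c) module_scheme \<Rightarrow> (nat \<Rightarrow> 'f set)
      \<Rightarrow> ('u, (('u multiset \<Rightarrow> 'u) set \<times> 'f \<Rightarrow> 'u) set) module" where
  "sym_tensor U Ug F Fg = tensor (base_ring U Ug) (part_sym U Ug) (F\<lparr>carrier := Fg 0\<rparr>)"

abbreviation sym_pure ::
    "('u, 'b) ring_scheme \<Rightarrow> (nat \<Rightarrow> 'u set) \<Rightarrow> ('u, 'f, 'c) module_scheme \<Rightarrow> (nat \<Rightarrow> 'f set)
      \<Rightarrow> ('u multiset \<Rightarrow> 'u) set \<Rightarrow> 'f \<Rightarrow> (('u multiset \<Rightarrow> 'u) set \<times> 'f \<Rightarrow> 'u) set" where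
  "sym_pure U Ug F Fg \<equiv> pure_tensor (base_ring U Ug) (part_sym U Ug) (F\<lparr>carrier := Fg 0\<rparr>)"

text \<open>The homogeneous part \<open>\<^bold>S\<^sub>n(U\<^sub>1) \<otimes> F\<^sub>0\<close> is a direct summand of \<open>\<^bold>S(U\<^sub>1) \<otimes> F\<^sub>0\<close> and is taken
  as a submodule of it.\<close>

definition sym_tensor_part ::
    "('u, 'b) ring_scheme \<Rightarrow> (nat \<Rightarrow> 'u set) \<Rightarrow> ('u, 'f, 'c) module_scheme \<Rightarrow> (nat \<Rightarrow> 'f set)
      \<Rightarrow> nat \<Rightarrow> (('u multiset \<Rightarrow> 'u) set \<times> 'f \<Rightarrow> 'u) set set" where
  "sym_tensor_part U Ug F Fg n =
     span_submodule (base_ring U Ug) (sym_tensor U Ug F Fg)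
       {sym_pure U Ug F Fg s f | s f.
          s \<in> sym_part (base_ring U Ug) (part_module U (Ug 1)) n \<and> f \<in> Fg 0}"

text \<open>\<open>\<gamma>\<close> is the composite of \<open>\<^bold>S(U\<^sub>1) \<otimes> F\<^sub>0 \<rightarrow> U \<otimes> F\<^sub>0\<close> and the multiplication
  \<open>U \<otimes> F\<^sub>0 \<rightarrow> F\<close>.\<close>

definition gamma ::
    "('u, 'b) ring_scheme \<Rightarrow> (nat \<Rightarrow> 'u set) \<Rightarrow> ('u, 'f, 'c) module_scheme \<Rightarrow> (nat \<Rightarrow> 'f set)
      \<Rightarrow> (('u multiset \<Rightarrow> 'u) set \<times> 'f \<Rightarrow> 'u) set \<Rightarrow> 'f" where
  "gamma U Ug F Fg =
     (let R = base_ring U Ug; U' = part_module U (carrier U); F0 = F\<lparr>carrier := Fg 0\<rparr> in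
        tensor_lift R F (\<lambda>u f. u \<odot>\<^bsub>F\<^esub> f)
        \<circ> tensor_lift R (tensor R U' F0) (\<lambda>s f. pure_tensor R U' F0 (sym_to_algebra U s) f))"

definition gamma_kernel ::
    "('u, 'b) ring_scheme \<Rightarrow> (nat \<Rightarrow> 'u set) \<Rightarrow> ('u, 'f, 'c) module_scheme \<Rightarrow> (nat \<Rightarrow> 'f set)
      \<Rightarrow> nat \<Rightarrow> (('u multiset \<Rightarrow> 'u) set \<times> 'f \<Rightarrow> 'u) set set" where
  "gamma_kernel U Ug F Fg n =
     {t \<in> sym_tensor_part U Ug F Fg n. gamma U Ug F Fg t = \<zero>\<^bsub>F\<^esub>}"

definition sym_act ::
    "('u, 'b) ring_scheme \<Rightarrow> (nat \<Rightarrow> 'u set) \<Rightarrow> ('u, 'f, 'c) module_scheme \<Rightarrow> (nat \<Rightarrow> 'f set)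
      \<Rightarrow> ('u multiset \<Rightarrow> 'u) set \<Rightarrow> (('u multiset \<Rightarrow> 'u) set \<times> 'f \<Rightarrow> 'u) set
      \<Rightarrow> (('u multiset \<Rightarrow> 'u) set \<times> 'f \<Rightarrow> 'u) set" where
  "sym_act U Ug F Fg s =
     tensor_lift (base_ring U Ug) (sym_tensor U Ug F Fg)
       (\<lambda>s' f. sym_pure U Ug F Fg (s \<otimes>\<^bsub>part_sym U Ug\<^esub> s') f)"

definition decomposable_kernel ::
    "('u, 'b) ring_scheme \<Rightarrow> (nat \<Rightarrow> 'u set) \<Rightarrow> ('u, 'f, 'c) module_scheme \<Rightarrow> (nat \<Rightarrow> 'f set)
      \<Rightarrow> nat \<Rightarrow> (('u multiset \<Rightarrow> 'u) set \<times> 'f \<Rightarrow> 'u) set set" where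
  "decomposable_kernel U Ug F Fg n =
     span_submodule (base_ring U Ug) (sym_tensor U Ug F Fg)
       {sym_act U Ug F Fg (sym_gen (base_ring U Ug) (part_module U (Ug 1)) x) t | x t.
          x \<in> Ug 1 \<and> t \<in> gamma_kernel U Ug F Fg (n - 1)}"

text \<open>The module of effective \<open>n\<close>-relations \<open>E(F)\<^sub>n\<close>, meant for \<open>n \<ge> 2\<close>.\<close>

definition effective_relations ::
    "('u, 'b) ring_scheme \<Rightarrow> (nat \<Rightarrow> 'u set) \<Rightarrow> ('u, 'f, 'c) module_scheme \<Rightarrow> (nat \<Rightarrow> 'f set)
      \<Rightarrow> nat \<Rightarrow> ('u, (('u multiset \<Rightarrow> 'u) set \<times> 'f \<Rightarrow> 'u) set set) module" where
  "effective_relations U Ug F Fg n =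
     quot_module ((sym_tensor U Ug F Fg)\<lparr>carrier := gamma_kernel U Ug F Fg n\<rparr>)
       (decomposable_kernel U Ug F Fg n)"

definition relation_type ::
    "('u, 'b) ring_scheme \<Rightarrow> (nat \<Rightarrow> 'u set) \<Rightarrow> ('u, 'f, 'c) module_scheme \<Rightarrow> (nat \<Rightarrow> 'f set)
      \<Rightarrow> enat" where
  "relation_type U Ug F Fg = Inf {enat r | r. r \<ge> 1 \<and>
     (\<forall>n\<ge>r + 1. carrier (effective_relations U Ug F Fg n)
                 = {\<zero>\<^bsub>effective_relations U Ug F Fg n\<^esub>})}"


section \<open>Rees algebras, Rees modules and reductions\<close>

abbreviation ideal_pow :: "('a, 'b) ring_scheme \<Rightarrow> 'a set \<Rightarrow> nat \<Rightarrow> 'a set" where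
  "ideal_pow A I n \<equiv> I [^]\<^bsub>ideals_set A\<^esub> n"

definition ideal_smult ::
    "('a, 'b) ring_scheme \<Rightarrow> ('a, 'm, 'c) module_scheme \<Rightarrow> 'a set \<Rightarrow> 'm set \<Rightarrow> 'm set" where
  "ideal_smult A M I N = span_submodule A M {a \<odot>\<^bsub>M\<^esub> x | a x. a \<in> I \<and> x \<in> N}"

definition pow_smult ::
    "('a, 'b) ring_scheme \<Rightarrow> ('a, 'm, 'c) module_scheme \<Rightarrow> 'a set \<Rightarrow> nat \<Rightarrow> 'm set" where
  "pow_smult A M I n = ideal_smult A M (ideal_pow A I n) (carrier M)"

text \<open>The Rees algebra as the subring of all \<open>\<Sum> a\<^sub>n t\<^sup>n\<close> with \<open>a\<^sub>n \<in> I\<^sup>n\<close> of the polynomial ring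
  \<open>A[t]\<close>.\<close>

definition rees_algebra :: "('a, 'b) ring_scheme \<Rightarrow> 'a set \<Rightarrow> ('a, nat \<Rightarrow> 'a) up_ring" where
  "rees_algebra A I = (UP A)\<lparr>carrier := {p \<in> up A. \<forall>n. p n \<in> ideal_pow A I n}\<rparr>"

definition rees_module ::
    "('a, 'b) ring_scheme \<Rightarrow> 'a set \<Rightarrow> ('a, 'm, 'c) module_scheme
      \<Rightarrow> (nat \<Rightarrow> 'a, nat \<Rightarrow> 'm) module" where
  "rees_module A I M = \<lparr>
     carrier = {f. (\<forall>n. f n \<in> pow_smult A M I n) \<and> finite {n. f n \<noteq> \<zero>\<^bsub>M\<^esub>}},
     monoid.mult = undefined,
     one = undefined,
     ring.zero = (\<lambda>_. \<zero>\<^bsub>M\<^esub>),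
     add = (\<lambda>f g n. f n \<oplus>\<^bsub>M\<^esub> g n),
     smult = (\<lambda>p f n. \<Oplus>\<^bsub>M\<^esub>i\<in>{..n}. p i \<odot>\<^bsub>M\<^esub> f (n - i))\<rparr>"

definition rees_algebra_part :: "('a, 'b) ring_scheme \<Rightarrow> 'a set \<Rightarrow> nat \<Rightarrow> (nat \<Rightarrow> 'a) set" where
  "rees_algebra_part A I n = {p \<in> carrier (rees_algebra A I). \<forall>i. i \<noteq> n \<longrightarrow> p i = \<zero>\<^bsub>A\<^esub>}"

definition rees_module_part ::
    "('a, 'b) ring_scheme \<Rightarrow> 'a set \<Rightarrow> ('a, 'm, 'c) module_scheme \<Rightarrow> nat \<Rightarrow> (nat \<Rightarrow> 'm) set" where
  "rees_module_part A I M n = {f \<in> carrier (rees_module A I M). \<forall>i. i \<noteq> n \<longrightarrow> f i = \<zero>\<^bsub>M\<^esub>}"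

text \<open>\<open>rt(I; M)\<close>\<close>

definition rt ::
    "('a, 'b) ring_scheme \<Rightarrow> 'a set \<Rightarrow> ('a, 'm, 'c) module_scheme \<Rightarrow> enat" where
  "rt A I M = relation_type (rees_algebra A I) (rees_algebra_part A I)
                            (rees_module A I M) (rees_module_part A I M)"

definition reduction_at ::
    "('a, 'b) ring_scheme \<Rightarrow> ('a, 'm, 'c) module_scheme \<Rightarrow> 'a set \<Rightarrow> 'a set \<Rightarrow> nat \<Rightarrow> bool" where
  "reduction_at A M J I n \<longleftrightarrow>
     pow_smult A M I (n + 1) = ideal_smult A M J (pow_smult A M I n)"

definition is_reduction ::
    "('a, 'b) ring_scheme \<Rightarrow> ('a, 'm, 'c) module_scheme \<Rightarrow> 'a set \<Rightarrow> 'a set \<Rightarrow> bool" where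
  "is_reduction A M J I \<longleftrightarrow> ideal J A \<and> J \<subseteq> I \<and> (\<exists>n. reduction_at A M J I n)"

definition reduction_number ::
    "('a, 'b) ring_scheme \<Rightarrow> ('a, 'm, 'c) module_scheme \<Rightarrow> 'a set \<Rightarrow> 'a set \<Rightarrow> nat" where
  "reduction_number A M J I = (LEAST n. reduction_at A M J I n)"

end

theory Submission
  imports Defs
begin

text \<open>Resolving \<open>\<^bold>S(U\<^sub>1) \<otimes> F\<^sub>0\<close> by its Koszul complex shows that \<open>E(F)\<^sub>n\<close> is the homology of
  \<open>\<Lambda>\<^sup>2 U\<^sub>1 \<otimes> F\<^sub>n\<^sub>-\<^sub>2 \<rightarrow> U\<^sub>1 \<otimes> F\<^sub>n\<^sub>-\<^sub>1 \<rightarrow> F\<^sub>n\<close>. In particular \<open>E(F)\<^sub>n = 0\<close> iff, for every bilinear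
  \<open>\<Phi>\<close> on \<open>U\<^sub>1 \<times> F\<^sub>n\<^sub>-\<^sub>1\<close> with \<open>\<Phi>(x, y g) = \<Phi>(y, x g)\<close>, every relation \<open>\<Sum> x\<^sub>i f\<^sub>i = 0\<close> implies
  \<open>\<Sum> \<Phi>(x\<^sub>i, f\<^sub>i) = 0\<close>. For \<open>F = \<R>(I; M)\<close> and \<open>n \<ge> r + 2\<close> we have \<open>F\<^sub>n\<^sub>-\<^sub>1 = J F\<^sub>n\<^sub>-\<^sub>2\<close>, and the identity
  \<open>\<Phi>(x, y g) = \<Phi>(y, x g)\<close> with \<open>y \<in> J\<close> moves every relation to one with all \<open>x\<^sub>i\<close> in \<open>J\<close>. Since
  \<open>J\<^sup>k I\<^sup>r M = I\<^sup>k\<^sup>+\<^sup>r M\<close>, the latter is a relation of \<open>\<R>(J; I\<^sup>r M)\<close> in degree \<open>n - r\<close>.\<close>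

section \<open>Modules\<close>

text \<open>Both directions of the criterion are proved directly on the tensor product. To deduce
  that the effective relations vanish, one universal form is tested: with values in
  \<open>T / D (n + 2)\<close>, it sends \<open>x\<close> and \<open>\<gamma> t\<close> to the class
  of \<open>x t\<close>, and it is well defined because \<open>U\<^sub>1\<close> times the kernel in
  degree \<open>n + 1\<close> lies in \<open>D (n + 2)\<close>. Conversely, a given
  \<open>\<Phi>\<close> becomes a linear map on the whole tensor product by splitting one variable
  off each monomial of degree \<open>n + 2\<close>. A hypothesis in HOL cannot range over targets of
  all types. So the first direction assumes the condition for that one quotient, while the second is
  a theorem for targets of any type; the quotient built from \<open>\<R>(I; M)\<close> can then be
  the target of a form on \<open>\<R>(J; I\<^sup>r M)\<close>. In degree \<open>n + 2\<close> the
  exchange writes elements of \<open>F\<^sub>n\<^sub>+\<^sub>1\<close> as sums of \<open>y g\<close>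
  with \<open>g\<close> in \<open>F\<^sub>n\<close>, whence \<open>n \<ge> r\<close>. That suffices:
  a relation type \<open>s\<close> is at least 1 by definition, so all degrees above
  \<open>r + s\<close> are at least \<open>r + 2\<close>.\<close>

definition linear_map ::
    "('a, 'b) ring_scheme \<Rightarrow> ('a, 'm, 'c) module_scheme \<Rightarrow> ('a, 'n, 'd) module_scheme
      \<Rightarrow> ('m \<Rightarrow> 'n) \<Rightarrow> bool" where
  "linear_map R M N h \<longleftrightarrow> h \<in> carrier M \<rightarrow> carrier N
     \<and> (\<forall>x\<in>carrier M. \<forall>y\<in>carrier M. h (x \<oplus>\<^bsub>M\<^esub> y) = h x \<oplus>\<^bsub>N\<^esub> h y)
     \<and> (\<forall>a\<in>carrier R. \<forall>x\<in>carrier M. h (a \<odot>\<^bsub>M\<^esub> x) = a \<odot>\<^bsub>N\<^esub> h x)"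

lemma linear_mapI:
  assumes "\<And>x. x \<in> carrier M \<Longrightarrow> h x \<in> carrier N"
    and "\<And>x y. x \<in> carrier M \<Longrightarrow> y \<in> carrier M \<Longrightarrow> h (x \<oplus>\<^bsub>M\<^esub> y) = h x \<oplus>\<^bsub>N\<^esub> h y"
    and "\<And>a x. a \<in> carrier R \<Longrightarrow> x \<in> carrier M \<Longrightarrow> h (a \<odot>\<^bsub>M\<^esub> x) = a \<odot>\<^bsub>N\<^esub> h x"
  shows "linear_map R M N h"
  using assms by (simp add: linear_map_def)

lemma linear_map_closed: "linear_map R M N h \<Longrightarrow> x \<in> carrier M \<Longrightarrow> h x \<in> carrier N"
  by (auto simp: linear_map_def)

lemma linear_map_add:
  "linear_map R M N h \<Longrightarrow> x \<in> carrier M \<Longrightarrow> y \<in> carrier M \<Longrightarrow> h (x \<oplus>\<^bsub>M\<^esub> y) = h x \<oplus>\<^bsub>N\<^esub> h y"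
  by (auto simp: linear_map_def)

lemma linear_map_smult:
  "linear_map R M N h \<Longrightarrow> a \<in> carrier R \<Longrightarrow> x \<in> carrier M \<Longrightarrow> h (a \<odot>\<^bsub>M\<^esub> x) = a \<odot>\<^bsub>N\<^esub> h x"
  by (auto simp: linear_map_def)

lemma linear_map_compose:
  assumes "linear_map R M N h" and "linear_map R N P k"
  shows "linear_map R M P (\<lambda>x. k (h x))"
  using assms by (auto simp: linear_map_def Pi_iff)

lemma linear_map_zero:
  assumes "module R M" and "module R N" and "linear_map R M N h"
  shows "h \<zero>\<^bsub>M\<^esub> = \<zero>\<^bsub>N\<^esub>"
proof -
  interpret M: module R M by fact
  interpret N: module R N by fact
  have "h (\<zero>\<^bsub>R\<^esub> \<odot>\<^bsub>M\<^esub> \<zero>\<^bsub>M\<^esub>) = \<zero>\<^bsub>R\<^esub> \<odot>\<^bsub>N\<^esub> h \<zero>\<^bsub>M\<^esub>"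
    by (rule linear_map_smult[OF assms(3)]) auto
  then show ?thesis using linear_map_closed[OF assms(3) M.M.zero_closed] by simp
qed

lemma (in module) neg_eq_smult: "x \<in> carrier M \<Longrightarrow> \<ominus>\<^bsub>M\<^esub> x = (\<ominus> \<one>) \<odot>\<^bsub>M\<^esub> x"
  by (simp add: smult_l_minus)

lemma linear_map_minus:
  assumes "module R M" and "module R N" and "linear_map R M N h"
    and "x \<in> carrier M" and "y \<in> carrier M"
  shows "h (x \<ominus>\<^bsub>M\<^esub> y) = h x \<ominus>\<^bsub>N\<^esub> h y"
proof -
  interpret M: module R M by fact
  interpret N: module R N by fact
  have "h (\<ominus>\<^bsub>M\<^esub> y) = \<ominus>\<^bsub>N\<^esub> h y"
    using assms(5) linear_map_closed[OF assms(3) assms(5)]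
    by (simp add: M.neg_eq_smult N.neg_eq_smult linear_map_smult[OF assms(3)])
  then show ?thesis
    using assms by (simp add: a_minus_def linear_map_add[OF assms(3)])
qed

lemma submodule_if_linear_vanish:
  assumes "module R M" and "module R N" and "linear_map R M N h"
  shows "submodule {x \<in> carrier M. h x = \<zero>\<^bsub>N\<^esub>} R M"
proof -
  interpret M: module R M by fact
  interpret N: module R N by fact
  show ?thesis
    using linear_map_zero[OF assms]
    by (intro M.submoduleI)
       (auto simp: linear_map_add[OF assms(3)] linear_map_smult[OF assms(3)] M.neg_eq_smult)
qed

lemma linear_map_fun_cong:
  assumes "module R M" and "linear_map R M N h" and "\<And>x. x \<in> carrier M \<Longrightarrow> h x = k x"
  shows "linear_map R M N k"
proof -
  interpret module R M by fact
  show ?thesis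
    using linear_map_closed[OF assms(2)] linear_map_add[OF assms(2)] linear_map_smult[OF assms(2)]
    by (intro linear_mapI) (simp_all add: assms(3)[symmetric])
qed

lemma linear_map_pointwise_zero: "module R N \<Longrightarrow> linear_map R M N (\<lambda>_. \<zero>\<^bsub>N\<^esub>)"
  by (rule linear_mapI) (auto simp: module_def abelian_group.axioms abelian_monoid.zero_closed
      abelian_monoid.l_zero module.smult_r_null)

lemma linear_map_pointwise_add:
  assumes "module R N" "linear_map R M N h" "linear_map R M N k"
  shows "linear_map R M N (\<lambda>x. h x \<oplus>\<^bsub>N\<^esub> k x)"
proof -
  interpret N: module R N by fact
  show ?thesis
    using linear_map_closed[OF assms(2)] linear_map_closed[OF assms(3)]
    by (intro linear_mapI)
       (simp_all add: linear_map_add[OF assms(2)] linear_map_add[OF assms(3)] linear_map_smult[OF assms(2)]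
          linear_map_smult[OF assms(3)] N.M.a_ac N.smult_r_distr)
qed

lemma linear_map_pointwise_smult:
  assumes "module R N" "linear_map R M N h" "a \<in> carrier R"
  shows "linear_map R M N (\<lambda>x. a \<odot>\<^bsub>N\<^esub> h x)"
proof -
  interpret N: module R N by fact
  show ?thesis
    using linear_map_closed[OF assms(2)] assms(3)
    by (intro linear_mapI)
       (simp_all add: linear_map_add[OF assms(2)] linear_map_smult[OF assms(2)] N.smult_r_distr
          N.R.m_comm flip: N.smult_assoc1)
qed

text \<open>The multiplicative fields do not enter the module axioms. This carries the module
  structure of the free module on the monomials over to \<open>poly_algebra\<close>, which has a
  multiplication of its own.\<close>

lemma module_cong:
  assumes "carrier M = carrier N" "add M = add N" "ring.zero M = ring.zero N" "smult M = smult N"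
  shows "module R M \<longleftrightarrow> module R N"
  using assms by (simp add: module_def module_axioms_def abelian_group_def abelian_monoid_def
      abelian_group_axioms_def comm_monoid_def comm_monoid_axioms_def monoid_def comm_group_def
      group_def group_axioms_def Units_def)

lemma linear_map_cong:
  assumes "carrier M = carrier M'" "add M = add M'" "smult M = smult M'"
  shows "linear_map R M N h \<longleftrightarrow> linear_map R M' N h"
  using assms by (simp add: linear_map_def)

lemma submodule_add_closed:
  "submodule H R M \<Longrightarrow> x \<in> H \<Longrightarrow> y \<in> H \<Longrightarrow> x \<oplus>\<^bsub>M\<^esub> y \<in> H"
  using subgroup.m_closed[OF submodule.axioms(1)] by fastforce

lemma submodule_zero_closed: "submodule H R M \<Longrightarrow> \<zero>\<^bsub>M\<^esub> \<in> H"
  using subgroup.one_closed[OF submodule.axioms(1)] by fastforce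

lemma submodule_subset: "submodule H R M \<Longrightarrow> H \<subseteq> carrier M"
  using subgroup.subset[OF submodule.axioms(1)] by fastforce

lemma submodule_smult_closed:
  "submodule H R M \<Longrightarrow> a \<in> carrier R \<Longrightarrow> x \<in> H \<Longrightarrow> a \<odot>\<^bsub>M\<^esub> x \<in> H"
  by (rule submodule.smult_closed)

text \<open>Closure under negatives comes for free, as \<open>-x\<close> is the multiple of
  \<open>x\<close> by \<open>-1\<close>.\<close>

lemma (in module) submoduleI':
  assumes "H \<subseteq> carrier M" and "\<zero>\<^bsub>M\<^esub> \<in> H"
    and "\<And>x y. x \<in> H \<Longrightarrow> y \<in> H \<Longrightarrow> x \<oplus>\<^bsub>M\<^esub> y \<in> H"
    and "\<And>a x. a \<in> carrier R \<Longrightarrow> x \<in> H \<Longrightarrow> a \<odot>\<^bsub>M\<^esub> x \<in> H"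
  shows "submodule H R M"
  using assms by (intro submoduleI) (auto simp: neg_eq_smult subset_iff)

lemma submodule_vimage:
  assumes "module R A" "module R B" "linear_map R A B h" "submodule H R B"
  shows "submodule {x \<in> carrier A. h x \<in> H} R A"
proof -
  interpret A: module R A by fact
  show ?thesis
    by (rule A.submoduleI')
       (auto simp: linear_map_zero[OF assms(1-3)] linear_map_add[OF assms(3)] linear_map_smult[OF assms(3)]
          intro: submodule_zero_closed[OF assms(4)] submodule_add_closed[OF assms(4)]
            submodule_smult_closed[OF assms(4)])
qed

section \<open>Spans of subsets of a module\<close>

lemma span_submodule_base: "x \<in> S \<Longrightarrow> x \<in> span_submodule R M S"
  by (auto simp: span_submodule_def)

lemma span_submodule_minimal: "submodule H R M \<Longrightarrow> S \<subseteq> H \<Longrightarrow> span_submodule R M S \<subseteq> H"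
  by (auto simp: span_submodule_def)

lemma (in module) submodule_span_submodule:
  assumes "S \<subseteq> carrier M"
  shows "submodule (span_submodule R M S) R M"
  by (rule submoduleI')
     (use assms carrier_is_submodule in \<open>auto simp: span_submodule_def
        intro: submodule_add_closed submodule_zero_closed submodule_smult_closed\<close>)

text \<open>The elements of \<open>M\<close> satisfying \<open>P\<close> form a submodule containing
  \<open>S\<close>, hence containing the span. The cases for sums and multiples know membership in
  \<open>carrier M\<close> alone, so \<open>P\<close> must itself carry any finer
  membership.\<close>

lemma (in module) span_submodule_induct [consumes 2, case_names base zero add smult]:
  assumes x: "x \<in> span_submodule R M S" and S: "S \<subseteq> carrier M"
    and base: "\<And>x. x \<in> S \<Longrightarrow> P x" and zero: "P \<zero>\<^bsub>M\<^esub>"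
    and add: "\<And>x y. x \<in> carrier M \<Longrightarrow> y \<in> carrier M \<Longrightarrow> P x \<Longrightarrow> P y \<Longrightarrow> P (x \<oplus>\<^bsub>M\<^esub> y)"
    and smult: "\<And>a x. a \<in> carrier R \<Longrightarrow> x \<in> carrier M \<Longrightarrow> P x \<Longrightarrow> P (a \<odot>\<^bsub>M\<^esub> x)"
  shows "P x"
proof -
  have "submodule {x \<in> carrier M. P x} R M"
    by (rule submoduleI') (auto intro: zero add smult)
  from span_submodule_minimal[OF this, of S] S base x show ?thesis by auto
qed

section \<open>Quotients\<close>

lemma submodule_abelian_subgroup:
  assumes "module R M" and "submodule N R M"
  shows "abelian_subgroup N M"
proof -
  interpret module R M by fact
  show ?thesis
    using assms(2) by (intro abelian_subgroupI3 additive_subgroupI)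
      (auto simp: submodule_def intro: abelian_group_axioms)
qed

locale quotient = module R M for R (structure) and M (structure) + fixes N
  assumes sub: "submodule N R M"
begin

lemma abelian_subgroup: "abelian_subgroup N M"
  by (rule submodule_abelian_subgroup[OF module_axioms sub])

lemma N_subset: "N \<subseteq> carrier M" by (rule submodule_subset[OF sub])

abbreviation Q where "Q \<equiv> quot_module M N"

lemma carrier_quot: "carrier Q = {N +>\<^bsub>M\<^esub> x | x. x \<in> carrier M}"
  by (auto simp: quot_module_def A_RCOSETS_def')

lemma coset_closed: "x \<in> carrier M \<Longrightarrow> N +>\<^bsub>M\<^esub> x \<in> carrier Q"
  by (auto simp: carrier_quot)

lemma quot_carrierE:
  assumes "Z \<in> carrier Q" obtains x where "x \<in> carrier M" "Z = N +>\<^bsub>M\<^esub> x"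
  using assms by (auto simp: carrier_quot)

lemma zero_quot: "\<zero>\<^bsub>Q\<^esub> = N" by (simp add: quot_module_def)

lemma coset_add:
  "x \<in> carrier M \<Longrightarrow> y \<in> carrier M \<Longrightarrow> (N +>\<^bsub>M\<^esub> x) \<oplus>\<^bsub>Q\<^esub> (N +>\<^bsub>M\<^esub> y) = N +>\<^bsub>M\<^esub> (x \<oplus>\<^bsub>M\<^esub> y)"
  by (simp add: quot_module_def abelian_subgroup.a_rcos_sum[OF abelian_subgroup])

lemma coset_mem_iff: "y \<in> N +>\<^bsub>M\<^esub> x \<longleftrightarrow> (\<exists>n\<in>N. y = n \<oplus>\<^bsub>M\<^esub> x)"
  by (auto simp: a_r_coset_def')

lemma coset_absorb: 
  assumes "n \<in> N" "x \<in> carrier M" shows "N +>\<^bsub>M\<^esub> (n \<oplus>\<^bsub>M\<^esub> x) = N +>\<^bsub>M\<^esub> x"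
  by (rule sym, rule M.a_repr_independence)
     (use assms sub in \<open>auto simp: coset_mem_iff submodule_def\<close>)

text \<open>The scalar action on a quotient is a union over the coset. All members of the union
  coincide because \<open>N\<close> is closed under scalars, and the coset is nonempty.\<close>

lemma coset_smult:
  assumes "a \<in> carrier R" "x \<in> carrier M"
  shows "a \<odot>\<^bsub>Q\<^esub> (N +>\<^bsub>M\<^esub> x) = N +>\<^bsub>M\<^esub> (a \<odot>\<^bsub>M\<^esub> x)"
proof -
  have eq: "N +>\<^bsub>M\<^esub> (a \<odot>\<^bsub>M\<^esub> y) = N +>\<^bsub>M\<^esub> (a \<odot>\<^bsub>M\<^esub> x)" if "y \<in> N +>\<^bsub>M\<^esub> x" for y
  proof -
    from that obtain n where n: "n \<in> N" "y = n \<oplus>\<^bsub>M\<^esub> x" by (auto simp: coset_mem_iff)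
    then have "a \<odot>\<^bsub>M\<^esub> y = a \<odot>\<^bsub>M\<^esub> n \<oplus>\<^bsub>M\<^esub> a \<odot>\<^bsub>M\<^esub> x"
      using assms N_subset by (auto simp: smult_r_distr)
    then show ?thesis
      using coset_absorb[OF submodule_smult_closed[OF sub assms(1) n(1)]] assms by simp
  qed
  have "x \<in> N +>\<^bsub>M\<^esub> x"
    using assms submodule_zero_closed[OF sub] by (auto simp: coset_mem_iff intro!: bexI[of _ "\<zero>\<^bsub>M\<^esub>"])
  then have ne: "N +>\<^bsub>M\<^esub> x \<noteq> {}" by blast
  have un: "(\<Union>y\<in>N +>\<^bsub>M\<^esub> x. N +>\<^bsub>M\<^esub> (a \<odot>\<^bsub>M\<^esub> y)) = (\<Union>y\<in>N +>\<^bsub>M\<^esub> x. N +>\<^bsub>M\<^esub> (a \<odot>\<^bsub>M\<^esub> x))"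
    by (rule SUP_cong[OF refl eq])
  have "a \<odot>\<^bsub>Q\<^esub> (N +>\<^bsub>M\<^esub> x) = (\<Union>y\<in>N +>\<^bsub>M\<^esub> x. N +>\<^bsub>M\<^esub> (a \<odot>\<^bsub>M\<^esub> y))"
    by (simp only: quot_module_def module.simps)
  then show ?thesis unfolding un using ne by (simp only: UN_constant if_False)
qed

lemma coset_zero: "N +>\<^bsub>M\<^esub> \<zero>\<^bsub>M\<^esub> = N"
  by (rule M.a_coset_add_zero[OF N_subset])

lemma coset_eq_zero_iff:
  assumes "x \<in> carrier M" shows "N +>\<^bsub>M\<^esub> x = N \<longleftrightarrow> x \<in> N"
proof
  show "x \<in> N" if "N +>\<^bsub>M\<^esub> x = N"
    using that assms submodule_zero_closed[OF sub] by (metis M.l_zero coset_mem_iff)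
  show "N +>\<^bsub>M\<^esub> x = N" if "x \<in> N"
    using coset_absorb[OF that M.zero_closed] that N_subset assms coset_zero by (auto)
qed

lemma module_quot: "module R Q"
proof (rule moduleI)
  show "cring R" by (rule is_cring)
  show "abelian_group Q"
  proof (rule abelian_groupI)
    show "\<exists>y\<in>carrier Q. y \<oplus>\<^bsub>Q\<^esub> x = \<zero>\<^bsub>Q\<^esub>" if "x \<in> carrier Q" for x
    proof -
      from that obtain z where z: "z \<in> carrier M" "x = N +>\<^bsub>M\<^esub> z" by (rule quot_carrierE)
      then have "(N +>\<^bsub>M\<^esub> (\<ominus>\<^bsub>M\<^esub> z)) \<oplus>\<^bsub>Q\<^esub> x = \<zero>\<^bsub>Q\<^esub>"
        by (simp add: coset_add zero_quot coset_zero M.l_neg)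
      with z M.a_inv_closed[OF z(1)] show ?thesis unfolding carrier_quot by blast
    qed
    show "\<zero>\<^bsub>Q\<^esub> \<in> carrier Q" using coset_zero by (force simp: carrier_quot zero_quot)
    show "\<zero>\<^bsub>Q\<^esub> \<oplus>\<^bsub>Q\<^esub> x = x" if "x \<in> carrier Q" for x
      using that coset_add[OF M.zero_closed] by (auto elim!: quot_carrierE simp: zero_quot coset_zero)
  qed (elim quot_carrierE; simp add: coset_add coset_closed M.a_ac)+
  fix a b x y
  show "a \<odot>\<^bsub>Q\<^esub> x \<in> carrier Q" if "a \<in> carrier R" "x \<in> carrier Q"
    using that(2,1) by (elim quot_carrierE) (simp add: coset_smult coset_closed)
  show "(a \<oplus> b) \<odot>\<^bsub>Q\<^esub> x = a \<odot>\<^bsub>Q\<^esub> x \<oplus>\<^bsub>Q\<^esub> b \<odot>\<^bsub>Q\<^esub> x"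
    if "a \<in> carrier R" "b \<in> carrier R" "x \<in> carrier Q"
    using that(3,1,2) by (elim quot_carrierE) (simp add: coset_smult coset_add smult_l_distr)
  show "a \<odot>\<^bsub>Q\<^esub> (x \<oplus>\<^bsub>Q\<^esub> y) = a \<odot>\<^bsub>Q\<^esub> x \<oplus>\<^bsub>Q\<^esub> a \<odot>\<^bsub>Q\<^esub> y"
    if "a \<in> carrier R" "x \<in> carrier Q" "y \<in> carrier Q"
    using that(2,3,1) by (elim quot_carrierE) (simp add: coset_smult coset_add smult_r_distr)
  show "(a \<otimes> b) \<odot>\<^bsub>Q\<^esub> x = a \<odot>\<^bsub>Q\<^esub> (b \<odot>\<^bsub>Q\<^esub> x)"
    if "a \<in> carrier R" "b \<in> carrier R" "x \<in> carrier Q"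
    using that(3,1,2) by (elim quot_carrierE) (simp add: coset_smult smult_assoc1)
  show "\<one> \<odot>\<^bsub>Q\<^esub> x = x" if "x \<in> carrier Q"
    using that by (elim quot_carrierE) (simp add: coset_smult)
qed

lemma linear_map_coset: "linear_map R M Q (\<lambda>x. N +>\<^bsub>M\<^esub> x)"
  by (rule linear_mapI) (auto simp: coset_add coset_smult carrier_quot)

text \<open>A linear map vanishing on \<open>N\<close> is constant on each coset, so the image of a
  coset is a singleton and \<open>the_elem\<close> reads off its value.\<close>

lemma lift_coset:
  assumes "module R P" "linear_map R M P h" "\<And>n. n \<in> N \<Longrightarrow> h n = \<zero>\<^bsub>P\<^esub>" "x \<in> carrier M"
  shows "the_elem (h ` (N +>\<^bsub>M\<^esub> x)) = h x"
proof -
  interpret P: module R P by fact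
  have "h ` (N +>\<^bsub>M\<^esub> x) = {h x}"
  proof -
    have "h y = h x" if "y \<in> N +>\<^bsub>M\<^esub> x" for y
      using that assms N_subset linear_map_closed[OF assms(2,4)]
      by (auto simp: coset_mem_iff linear_map_add[OF assms(2)] subset_iff)
    moreover have "x \<in> N +>\<^bsub>M\<^esub> x"
      using assms submodule_zero_closed[OF sub] by (auto simp: coset_mem_iff intro!: bexI[of _ "\<zero>\<^bsub>M\<^esub>"])
    ultimately show ?thesis by blast
  qed
  then show ?thesis by simp
qed

lemma linear_map_lift:
  assumes "module R P" "linear_map R M P h" "\<And>n. n \<in> N \<Longrightarrow> h n = \<zero>\<^bsub>P\<^esub>"
  shows "linear_map R Q P (\<lambda>Z. the_elem (h ` Z))"
proof (rule linear_mapI)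
  note closed = linear_map_closed[OF assms(2)]
  fix a x y
  show "the_elem (h ` x) \<in> carrier P" if "x \<in> carrier Q"
    using that by (elim quot_carrierE) (simp add: lift_coset[OF assms] closed)
  show "the_elem (h ` (x \<oplus>\<^bsub>Q\<^esub> y)) = the_elem (h ` x) \<oplus>\<^bsub>P\<^esub> the_elem (h ` y)"
    if "x \<in> carrier Q" "y \<in> carrier Q"
    using that
    by (elim quot_carrierE) (simp add: lift_coset[OF assms] closed coset_add linear_map_add[OF assms(2)])
  show "the_elem (h ` (a \<odot>\<^bsub>Q\<^esub> x)) = a \<odot>\<^bsub>P\<^esub> the_elem (h ` x)"
    if "a \<in> carrier R" "x \<in> carrier Q"
    using that(2,1)
    by (elim quot_carrierE) (simp add: lift_coset[OF assms] closed coset_smult linear_map_smult[OF assms(2)])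
qed

end

section \<open>Free modules\<close>

text \<open>Summation over the support, exactly as in \<open>tensor_lift\<close> and
  \<open>sym_to_algebra\<close>, so that both become \<open>the_elem\<close> of the image of a coset
  under \<open>free_ext\<close>.\<close>

definition free_ext ::
    "('a, 'b) ring_scheme \<Rightarrow> ('a, 'p, 'c) module_scheme \<Rightarrow> ('x \<Rightarrow> 'p) \<Rightarrow> ('x \<Rightarrow> 'a) \<Rightarrow> 'p" where
  "free_ext R P b g = (\<Oplus>\<^bsub>P\<^esub>z\<in>{z. g z \<noteq> \<zero>\<^bsub>R\<^esub>}. g z \<odot>\<^bsub>P\<^esub> b z)"

lemma carrier_free_module:
  "carrier (free_module R Z) =
     {f. (\<forall>x. f x \<in> carrier R) \<and> finite {x. f x \<noteq> \<zero>\<^bsub>R\<^esub>} \<and> {x. f x \<noteq> \<zero>\<^bsub>R\<^esub>} \<subseteq> Z}"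
  by (simp add: free_module_def)

lemma free_module_simps:
  "\<zero>\<^bsub>free_module R Z\<^esub> = (\<lambda>_. \<zero>\<^bsub>R\<^esub>)"
  "f \<oplus>\<^bsub>free_module R Z\<^esub> g = (\<lambda>x. f x \<oplus>\<^bsub>R\<^esub> g x)"
  "a \<odot>\<^bsub>free_module R Z\<^esub> f = (\<lambda>x. a \<otimes>\<^bsub>R\<^esub> f x)"
  by (simp_all add: free_module_def)

lemma free_module_mono: "A \<subseteq> B \<Longrightarrow> carrier (free_module R A) \<subseteq> carrier (free_module R B)"
  by (auto simp: carrier_free_module)

context cring
begin

lemma free_gen_closed: "z \<in> Z \<Longrightarrow> free_gen R z \<in> carrier (free_module R Z)"
  by (auto simp: carrier_free_module free_gen_def intro: finite_subset[of _ "{z}"])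

lemma free_module_add_closed:
  assumes "f \<in> carrier (free_module R Z)" "g \<in> carrier (free_module R Z)"
  shows "(\<lambda>x. f x \<oplus> g x) \<in> carrier (free_module R Z)"
proof -
  have "{x. f x \<oplus> g x \<noteq> \<zero>} \<subseteq> {x. f x \<noteq> \<zero>} \<union> {x. g x \<noteq> \<zero>}" by auto
  moreover have "finite ({x. f x \<noteq> \<zero>} \<union> {x. g x \<noteq> \<zero>})" "{x. f x \<noteq> \<zero>} \<union> {x. g x \<noteq> \<zero>} \<subseteq> Z"
    using assms by (simp_all add: carrier_free_module)
  ultimately have "finite {x. f x \<oplus> g x \<noteq> \<zero>}" "{x. f x \<oplus> g x \<noteq> \<zero>} \<subseteq> Z"
    by (blast intro: finite_subset, blast)
  then show ?thesis using assms by (simp add: carrier_free_module)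
qed

lemma free_module_smult_closed:
  assumes "f \<in> carrier (free_module R Z)" "a \<in> carrier R"
  shows "(\<lambda>x. a \<otimes> f x) \<in> carrier (free_module R Z)"
proof -
  have "{x. a \<otimes> f x \<noteq> \<zero>} \<subseteq> {x. f x \<noteq> \<zero>}" using assms by auto
  moreover have "finite {x. f x \<noteq> \<zero>}" "{x. f x \<noteq> \<zero>} \<subseteq> Z"
    using assms by (simp_all add: carrier_free_module)
  ultimately have "finite {x. a \<otimes> f x \<noteq> \<zero>}" "{x. a \<otimes> f x \<noteq> \<zero>} \<subseteq> Z"
    by (blast intro: finite_subset, blast)
  then show ?thesis using assms by (simp add: carrier_free_module)
qed

lemma free_module_zero_closed: "(\<lambda>_. \<zero>) \<in> carrier (free_module R Z)"
  by (simp add: carrier_free_module)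

lemma free_module_coeff_closed: "f \<in> carrier (free_module R Z) \<Longrightarrow> f x \<in> carrier R"
  by (simp add: carrier_free_module)

lemma module_free_module: "module R (free_module R Z)"
proof (rule moduleI)
  show "cring R" by (rule is_cring)
  show "abelian_group (free_module R Z)"
  proof (rule abelian_groupI)
    show "\<exists>g\<in>carrier (free_module R Z). g \<oplus>\<^bsub>free_module R Z\<^esub> f = \<zero>\<^bsub>free_module R Z\<^esub>"
      if "f \<in> carrier (free_module R Z)" for f
    proof (rule bexI)
      show "(\<lambda>x. (\<ominus> \<one>) \<otimes> f x) \<in> carrier (free_module R Z)"
        by (rule free_module_smult_closed) (use that in auto)
      show "(\<lambda>x. (\<ominus> \<one>) \<otimes> f x) \<oplus>\<^bsub>free_module R Z\<^esub> f = \<zero>\<^bsub>free_module R Z\<^esub>"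
        using free_module_coeff_closed[OF that] by (simp add: free_module_simps l_minus l_neg)
    qed
  qed (simp_all add: free_module_simps free_module_zero_closed free_module_add_closed
      free_module_coeff_closed a_ac)
qed (simp_all add: free_module_simps free_module_smult_closed free_module_coeff_closed l_distr r_distr m_assoc)

text \<open>Induction over a finite set \<open>S\<close> that contains the support. The coefficient
  at a new element of \<open>S\<close> may vanish, so the exact support does not have to be
  tracked.\<close>

lemma free_module_induct [consumes 1, case_names zero add gen]:
  assumes g: "g \<in> carrier (free_module R Z)" and zero: "P \<zero>\<^bsub>free_module R Z\<^esub>"
    and add: "\<And>f g. f \<in> carrier (free_module R Z) \<Longrightarrow> g \<in> carrier (free_module R Z)
      \<Longrightarrow> P f \<Longrightarrow> P g \<Longrightarrow> P (f \<oplus>\<^bsub>free_module R Z\<^esub> g)"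
    and gen: "\<And>a z. a \<in> carrier R \<Longrightarrow> z \<in> Z \<Longrightarrow> P (a \<odot>\<^bsub>free_module R Z\<^esub> free_gen R z)"
  shows "P g"
proof -
  have "P g" if "finite S" "{x. g x \<noteq> \<zero>} \<subseteq> S" "S \<subseteq> Z" "\<forall>x. g x \<in> carrier R" for g S
    using that
  proof (induction S arbitrary: g rule: finite_induct)
    case empty
    then have "g = \<zero>\<^bsub>free_module R Z\<^esub>" by (auto simp: free_module_simps)
    with zero show ?case by simp
  next
    case (insert z S)
    \<comment> \<open>\<open>?g\<close> deletes the coefficient at \<open>z\<close>, which brings
      the support into \<open>S\<close>.\<close>
    let ?g = "\<lambda>x. if x = z then \<zero> else g x"
    have "finite {x. g x \<noteq> \<zero>}" using insert.prems(1) insert.hyps(1) by (meson finite_insert finite_subset)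
    then have "finite {x. ?g x \<noteq> \<zero>}" by (rule rev_finite_subset) auto
    then have g: "?g \<in> carrier (free_module R Z)"
      using insert.prems by (auto simp: carrier_free_module)
    have "P ?g" by (rule insert.IH) (use insert.prems in \<open>auto split: if_splits\<close>)
    moreover have "P (g z \<odot>\<^bsub>free_module R Z\<^esub> free_gen R z)"
      by (rule gen) (use insert.prems in auto)
    moreover have "g z \<odot>\<^bsub>free_module R Z\<^esub> free_gen R z \<in> carrier (free_module R Z)"
      unfolding free_module_simps
      by (rule free_module_smult_closed) (use insert.prems in \<open>auto intro: free_gen_closed\<close>)
    moreover have "g = ?g \<oplus>\<^bsub>free_module R Z\<^esub> (g z \<odot>\<^bsub>free_module R Z\<^esub> free_gen R z)"
      using insert.prems by (auto simp: free_module_simps free_gen_def fun_eq_iff)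
    ultimately show ?case using add g by metis
  qed
  from this[of "{x. g x \<noteq> \<zero>}" g] g show ?thesis by (simp add: carrier_free_module)
qed

lemma free_module_linear_eqI:
  assumes "module R P" and "linear_map R (free_module R Z) P h" and "linear_map R (free_module R Z) P k"
    and "\<And>z. z \<in> Z \<Longrightarrow> h (free_gen R z) = k (free_gen R z)"
    and "g \<in> carrier (free_module R Z)"
  shows "h g = k g"
  using assms(5)
proof (induction rule: free_module_induct)
  case zero
  then show ?case using assms(1-3) module_free_module linear_map_zero by metis
next
  case (add f g)
  then show ?case by (simp add: linear_map_add[OF assms(2)] linear_map_add[OF assms(3)])
next
  case (gen a z)
  then show ?case
    by (simp add: linear_map_smult[OF assms(2)] linear_map_smult[OF assms(3)] free_gen_closed assms(4))
qed

end

text \<open>Indices with coefficient zero may be added to the sum. Sums and multiples can have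
  smaller supports than their ingredients, so linearity is checked on a common larger index
  set.\<close>

lemma free_ext_eq_finsum:
  assumes "module R P" and "g \<in> carrier (free_module R Z)" and "b \<in> Z \<rightarrow> carrier P"
    and "finite S" "{z. g z \<noteq> \<zero>\<^bsub>R\<^esub>} \<subseteq> S" "S \<subseteq> Z"
  shows "free_ext R P b g = (\<Oplus>\<^bsub>P\<^esub>z\<in>S. g z \<odot>\<^bsub>P\<^esub> b z)"
proof -
  interpret module R P by fact
  have bS: "b z \<in> carrier P" if "z \<in> S" for z using assms(3,6) that by blast
  have gS: "g z \<in> carrier R" for z using assms(2) by (simp add: carrier_free_module)
  show ?thesis unfolding free_ext_def
    by (rule M.add.finprod_mono_neutral_cong_left) (use assms(4,5) bS gS in auto)
qed

lemma linear_map_free_ext: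
  assumes "module R P" and b: "b \<in> Z \<rightarrow> carrier P"
  shows "linear_map R (free_module R Z) P (free_ext R P b)"
proof -
  interpret module R P by fact
  let ?F = "carrier (free_module R Z)"
  have cl: "f x \<in> carrier R" if "f \<in> ?F" for f x
    using that by (simp add: carrier_free_module)
  have fin: "finite {x. f x \<noteq> \<zero>\<^bsub>R\<^esub>}" "{x. f x \<noteq> \<zero>\<^bsub>R\<^esub>} \<subseteq> Z" if "f \<in> ?F" for f
    using that by (simp_all add: carrier_free_module)
  show ?thesis
  proof (rule linear_mapI)
    show "free_ext R P b f \<in> carrier P" if "f \<in> ?F" for f
    proof -
      have "b z \<in> carrier P" if "z \<in> {x. f x \<noteq> \<zero>\<^bsub>R\<^esub>}" for z
        using b fin(2)[OF \<open>f \<in> ?F\<close>] that by blast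
      then show ?thesis unfolding free_ext_def using cl[OF that] by (intro M.finsum_closed) auto
    qed
    show "free_ext R P b (f \<oplus>\<^bsub>free_module R Z\<^esub> g) = free_ext R P b f \<oplus>\<^bsub>P\<^esub> free_ext R P b g"
      if fg: "f \<in> ?F" "g \<in> ?F" for f g
    proof -
      let ?S = "{x. f x \<noteq> \<zero>\<^bsub>R\<^esub>} \<union> {x. g x \<noteq> \<zero>\<^bsub>R\<^esub>}"
      have S: "finite ?S" "?S \<subseteq> Z" using fin fg by auto
      have bS: "b z \<in> carrier P" if "z \<in> ?S" for z using b S that by blast
      have sub: "{x. f x \<oplus>\<^bsub>R\<^esub> g x \<noteq> \<zero>\<^bsub>R\<^esub>} \<subseteq> ?S" using cl fg by auto
      have "free_ext R P b (\<lambda>x. f x \<oplus>\<^bsub>R\<^esub> g x) = (\<Oplus>\<^bsub>P\<^esub>z\<in>?S. (f z \<oplus>\<^bsub>R\<^esub> g z) \<odot>\<^bsub>P\<^esub> b z)"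
        by (rule free_ext_eq_finsum[OF assms(1) free_module_add_closed[OF fg] b S(1) sub S(2)])
      also have "\<dots> = (\<Oplus>\<^bsub>P\<^esub>z\<in>?S. f z \<odot>\<^bsub>P\<^esub> b z \<oplus>\<^bsub>P\<^esub> g z \<odot>\<^bsub>P\<^esub> b z)"
        by (rule M.finsum_cong') (use bS cl fg in \<open>auto simp: smult_l_distr\<close>)
      also have "\<dots> = (\<Oplus>\<^bsub>P\<^esub>z\<in>?S. f z \<odot>\<^bsub>P\<^esub> b z) \<oplus>\<^bsub>P\<^esub> (\<Oplus>\<^bsub>P\<^esub>z\<in>?S. g z \<odot>\<^bsub>P\<^esub> b z)"
        by (rule M.finsum_addf) (use bS cl fg in auto)
      also have "(\<Oplus>\<^bsub>P\<^esub>z\<in>?S. f z \<odot>\<^bsub>P\<^esub> b z) = free_ext R P b f"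
        by (rule free_ext_eq_finsum[OF assms(1) fg(1) b S(1) _ S(2), symmetric]) auto
      also have "(\<Oplus>\<^bsub>P\<^esub>z\<in>?S. g z \<odot>\<^bsub>P\<^esub> b z) = free_ext R P b g"
        by (rule free_ext_eq_finsum[OF assms(1) fg(2) b S(1) _ S(2), symmetric]) auto
      finally show ?thesis by (simp add: free_module_simps)
    qed
    show "free_ext R P b (a \<odot>\<^bsub>free_module R Z\<^esub> f) = a \<odot>\<^bsub>P\<^esub> free_ext R P b f"
      if a: "a \<in> carrier R" and f: "f \<in> ?F" for a f
    proof -
      let ?S = "{x. f x \<noteq> \<zero>\<^bsub>R\<^esub>}"
      have bS: "b z \<in> carrier P" if "z \<in> ?S" for z using b fin(2)[OF f] that by blast
      have sub: "{x. a \<otimes>\<^bsub>R\<^esub> f x \<noteq> \<zero>\<^bsub>R\<^esub>} \<subseteq> ?S" using a by auto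
      have "free_ext R P b (\<lambda>x. a \<otimes>\<^bsub>R\<^esub> f x) = (\<Oplus>\<^bsub>P\<^esub>z\<in>?S. (a \<otimes>\<^bsub>R\<^esub> f z) \<odot>\<^bsub>P\<^esub> b z)"
        by (rule free_ext_eq_finsum[OF assms(1) free_module_smult_closed[OF f a] b fin(1)[OF f] sub fin(2)[OF f]])
      also have "\<dots> = (\<Oplus>\<^bsub>P\<^esub>z\<in>?S. a \<odot>\<^bsub>P\<^esub> (f z \<odot>\<^bsub>P\<^esub> b z))"
        by (rule M.finsum_cong') (use bS cl[OF f] a in \<open>auto simp: smult_assoc1\<close>)
      also have "\<dots> = a \<odot>\<^bsub>P\<^esub> free_ext R P b f"
        unfolding free_ext_def
        by (rule finsum_smult_ldistr[symmetric]) (use fin(1)[OF f] bS cl[OF f] a in auto)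
      finally show ?thesis by (simp add: free_module_simps)
    qed
  qed
qed

lemma free_ext_free_gen:
  assumes "module R P" and b: "b \<in> Z \<rightarrow> carrier P" and z: "z \<in> Z"
  shows "free_ext R P b (free_gen R z) = b z"
proof -
  interpret module R P by fact
  have bz: "b z \<in> carrier P" using b z by blast
  have "free_ext R P b (free_gen R z) = (\<Oplus>\<^bsub>P\<^esub>w\<in>{z}. free_gen R z w \<odot>\<^bsub>P\<^esub> b w)"
    by (rule free_ext_eq_finsum[OF assms(1) free_gen_closed[OF z] b]) (use z in \<open>auto simp: free_gen_def\<close>)
  also have "\<dots> = free_gen R z z \<odot>\<^bsub>P\<^esub> b z" using bz by (simp add: free_gen_def)
  also have "\<dots> = b z" using bz by (simp add: free_gen_def)
  finally show ?thesis .
qed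

section \<open>Tensor products\<close>

definition bilinear_map ::
    "('a, 'b) ring_scheme \<Rightarrow> ('a, 'm, 'c) module_scheme \<Rightarrow> ('a, 'n, 'd) module_scheme
      \<Rightarrow> ('a, 'p, 'e) module_scheme \<Rightarrow> ('m \<Rightarrow> 'n \<Rightarrow> 'p) \<Rightarrow> bool" where
  "bilinear_map R M N P b \<longleftrightarrow> (\<forall>y\<in>carrier N. linear_map R M P (\<lambda>x. b x y))
     \<and> (\<forall>x\<in>carrier M. linear_map R N P (b x))"

lemma bilinear_mapI:
  assumes "\<And>y. y \<in> carrier N \<Longrightarrow> linear_map R M P (\<lambda>x. b x y)"
    and "\<And>x. x \<in> carrier M \<Longrightarrow> linear_map R N P (b x)"
  shows "bilinear_map R M N P b"
  using assms by (simp add: bilinear_map_def)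

lemma bilinear_map_left: "bilinear_map R M N P b \<Longrightarrow> y \<in> carrier N \<Longrightarrow> linear_map R M P (\<lambda>x. b x y)"
  by (simp add: bilinear_map_def)

lemma bilinear_map_right: "bilinear_map R M N P b \<Longrightarrow> x \<in> carrier M \<Longrightarrow> linear_map R N P (b x)"
  by (simp add: bilinear_map_def)

lemma bilinear_map_compose_linear:
  assumes "bilinear_map R M N P b" "linear_map R P P' h"
  shows "bilinear_map R M N P' (\<lambda>x y. h (b x y))"
  using bilinear_map_left[OF assms(1)] bilinear_map_right[OF assms(1)]
  by (intro bilinear_mapI) (auto intro: linear_map_compose[OF _ assms(2)])

lemma bilinear_map_compose_left:
  assumes "bilinear_map R M N P b" "linear_map R M' M h"
  shows "bilinear_map R M' N P (\<lambda>x y. b (h x) y)"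
proof (rule bilinear_mapI)
  show "linear_map R M' P (\<lambda>x. b (h x) y)" if "y \<in> carrier N" for y
    by (rule linear_map_compose[OF assms(2) bilinear_map_left[OF assms(1) that]])
  show "linear_map R N P (b (h x))" if "x \<in> carrier M'" for x
    by (rule bilinear_map_right[OF assms(1)]) (rule linear_map_closed[OF assms(2) that])
qed

locale tensor_product = M: module R M + N: module R N
  for R :: "('a, 'b) ring_scheme" (structure) and M :: "('a, 'm, 'c) module_scheme"
    and N :: "('a, 'n, 'd) module_scheme"
begin

abbreviation L where "L \<equiv> free_module R (carrier M \<times> carrier N)"
abbreviation K where "K \<equiv> tensor_kernel R M N"
abbreviation T where "T \<equiv> tensor R M N"
abbreviation pure where "pure \<equiv> pure_tensor R M N"

sublocale L: module R L by (rule M.module_free_module)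

lemma tensor_relations_subset: "tensor_relations R M N \<subseteq> carrier L"
  unfolding tensor_relations_def Let_def
  by (intro Un_least subsetI; elim CollectE exE conjE; hypsubst;
      intro L.M.minus_closed L.M.add.m_closed L.smult_closed M.free_gen_closed; simp)

lemma submodule_tensor_kernel: "submodule K R L"
  unfolding tensor_kernel_def by (rule L.submodule_span_submodule[OF tensor_relations_subset])

sublocale quotient R L K by (intro quotient.intro quotient_axioms.intro L.module_axioms submodule_tensor_kernel)

lemma module_tensor: "module R T"
  using module_quot by (simp add: tensor_def)

lemma pure_eq: "pure x y = K +>\<^bsub>L\<^esub> free_gen R (x, y)"
  by (simp add: pure_tensor_def)

lemma gen_closed: "x \<in> carrier M \<Longrightarrow> y \<in> carrier N \<Longrightarrow> free_gen R (x, y) \<in> carrier L"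
  by (simp add: M.free_gen_closed)

lemma pure_closed: "x \<in> carrier M \<Longrightarrow> y \<in> carrier N \<Longrightarrow> pure x y \<in> carrier T"
  by (simp add: tensor_def pure_eq coset_closed gen_closed)

lemma tensor_carrierE:
  assumes "t \<in> carrier T" obtains g where "g \<in> carrier L" "t = K +>\<^bsub>L\<^esub> g"
  using assms unfolding tensor_def by (rule quot_carrierE)

text \<open>Each family of tensor relations has the form \<open>u - v\<close>, and so yields one law
  of bilinearity for pure tensors.\<close>

lemma coset_eqI:
  assumes "u \<ominus>\<^bsub>L\<^esub> v \<in> tensor_relations R M N" "u \<in> carrier L" "v \<in> carrier L"
  shows "K +>\<^bsub>L\<^esub> u = K +>\<^bsub>L\<^esub> v"
proof -
  have "u \<ominus>\<^bsub>L\<^esub> v \<in> K" using assms(1) by (simp add: tensor_kernel_def span_submodule_base)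
  from coset_absorb[OF this assms(3)] show ?thesis
    using assms(2,3) by (simp add: a_minus_def L.M.a_assoc L.M.l_neg)
qed

lemma linear_map_coset_tensor: "linear_map R L T (\<lambda>x. K +>\<^bsub>L\<^esub> x)"
  using linear_map_coset by (simp add: tensor_def)

lemma bilinear_map_pure: "bilinear_map R M N T pure"
proof -
  note closed = gen_closed L.smult_closed L.M.add.m_closed
  note ls = linear_map_add[OF linear_map_coset_tensor, symmetric]
    linear_map_smult[OF linear_map_coset_tensor, symmetric]
  show ?thesis
  proof (intro bilinear_mapI linear_mapI)
    fix y x x' assume "y \<in> carrier N" "x \<in> carrier M" "x' \<in> carrier M"
    then show "pure (x \<oplus>\<^bsub>M\<^esub> x') y = pure x y \<oplus>\<^bsub>T\<^esub> pure x' y"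
      by (simp add: pure_eq ls closed) (rule coset_eqI, unfold tensor_relations_def Let_def, blast, simp_all add: closed)
  next
    fix y x a assume "y \<in> carrier N" "x \<in> carrier M" "a \<in> carrier R"
    then show "pure (a \<odot>\<^bsub>M\<^esub> x) y = a \<odot>\<^bsub>T\<^esub> pure x y"
      by (simp add: pure_eq ls closed) (rule coset_eqI, unfold tensor_relations_def Let_def, blast, simp_all add: closed)
  next
    fix y x y' assume "y \<in> carrier N" "x \<in> carrier M" "y' \<in> carrier N"
    then show "pure x (y \<oplus>\<^bsub>N\<^esub> y') = pure x y \<oplus>\<^bsub>T\<^esub> pure x y'"
      by (simp add: pure_eq ls closed) (rule coset_eqI, unfold tensor_relations_def Let_def, blast, simp_all add: closed)
  next
    fix y x a assume "y \<in> carrier N" "x \<in> carrier M" "a \<in> carrier R"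
    then show "pure x (a \<odot>\<^bsub>N\<^esub> y) = a \<odot>\<^bsub>T\<^esub> pure x y"
      by (simp add: pure_eq ls closed) (rule coset_eqI, unfold tensor_relations_def Let_def, blast, simp_all add: closed)
  qed (simp_all add: pure_closed)
qed

text \<open>Scalar multiples have no case of their own because a scalar can be absorbed into the
  first factor of a pure tensor.\<close>

lemma tensor_induct [consumes 1, case_names zero add pure]:
  assumes t: "t \<in> carrier T" and zero: "P \<zero>\<^bsub>T\<^esub>"
    and add: "\<And>s t. s \<in> carrier T \<Longrightarrow> t \<in> carrier T \<Longrightarrow> P s \<Longrightarrow> P t \<Longrightarrow> P (s \<oplus>\<^bsub>T\<^esub> t)"
    and pure: "\<And>x y. x \<in> carrier M \<Longrightarrow> y \<in> carrier N \<Longrightarrow> P (pure x y)"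
  shows "P t"
proof -
  note lin = linear_map_coset_tensor
  from t obtain g where g: "g \<in> carrier L" "t = K +>\<^bsub>L\<^esub> g" by (rule tensor_carrierE)
  from g(1) have "P (K +>\<^bsub>L\<^esub> g)"
  proof (induction rule: M.free_module_induct)
    case zero
    then show ?case using assms(2) linear_map_zero[OF L.module_axioms module_tensor lin] by simp
  next
    case (add f g)
    then show ?case
      using linear_map_add[OF lin] linear_map_closed[OF lin] assms(3) by metis
  next
    case (gen a z)
    then obtain x y where z: "z = (x, y)" "x \<in> carrier M" "y \<in> carrier N" by auto
    have "K +>\<^bsub>L\<^esub> (a \<odot>\<^bsub>L\<^esub> free_gen R z) = a \<odot>\<^bsub>T\<^esub> pure x y"
      using z gen by (simp add: linear_map_smult[OF lin] pure_eq gen_closed)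
    also have "\<dots> = pure (a \<odot>\<^bsub>M\<^esub> x) y"
      using linear_map_smult[OF bilinear_map_left[OF bilinear_map_pure z(3)]] gen z by simp
    finally show ?case using pure gen z by simp
  qed
  with g show ?thesis by simp
qed

lemma tensor_linear_eqI:
  assumes "module R P" and "linear_map R T P h" and "linear_map R T P k"
    and "\<And>x y. x \<in> carrier M \<Longrightarrow> y \<in> carrier N \<Longrightarrow> h (pure x y) = k (pure x y)"
    and "t \<in> carrier T"
  shows "h t = k t"
  using assms(5)
proof (induction rule: tensor_induct)
  case zero
  then show ?case using assms(1-3) module_tensor linear_map_zero by metis
next
  case (add f g)
  then show ?case by (simp add: linear_map_add[OF assms(2)] linear_map_add[OF assms(3)])
qed (rule assms(4))

section \<open>The universal property of the tensor product\<close>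

context
  fixes P :: "('a, 'p, 'e) module_scheme" and b
  assumes P: "module R P" and b: "bilinear_map R M N P b"
begin

private abbreviation "h \<equiv> free_ext R P (\<lambda>z. b (fst z) (snd z))"

private lemma bc: "x \<in> carrier M \<Longrightarrow> y \<in> carrier N \<Longrightarrow> b x y \<in> carrier P"
  by (rule linear_map_closed[OF bilinear_map_left[OF b]])

private lemma b_closed: "(\<lambda>z. b (fst z) (snd z)) \<in> carrier M \<times> carrier N \<rightarrow> carrier P"
  using bc by auto

private lemma h: "linear_map R L P h"
  by (rule linear_map_free_ext[OF P b_closed])

private lemma h_gen: "x \<in> carrier M \<Longrightarrow> y \<in> carrier N \<Longrightarrow> h (free_gen R (x, y)) = b x y"
  by (subst free_ext_free_gen[OF P b_closed]) auto

text \<open>The zeros of \<open>h\<close> form a submodule of the free module, so it is enough to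
  test the four families of relations. These vanish by the four laws of bilinearity of
  \<open>b\<close>.\<close>

private lemma h_kernel:
  assumes "g \<in> K" shows "h g = \<zero>\<^bsub>P\<^esub>"
proof -
  interpret P: module R P by (rule P)
  note closed = gen_closed L.smult_closed L.M.add.m_closed
  have self: "x \<ominus>\<^bsub>P\<^esub> x = \<zero>\<^bsub>P\<^esub>" if "x \<in> carrier P" for x
    using that by (simp add: a_minus_def P.M.r_neg)
  have "tensor_relations R M N \<subseteq> {g \<in> carrier L. h g = \<zero>\<^bsub>P\<^esub>}"
  proof
    fix g assume g: "g \<in> tensor_relations R M N"
    then have "h g = \<zero>\<^bsub>P\<^esub>"
      unfolding tensor_relations_def Let_def
      by (elim UnE CollectE exE conjE; simp add: linear_map_minus[OF L.module_axioms P h] closed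
          linear_map_add[OF h] linear_map_smult[OF h] h_gen
          linear_map_add[OF bilinear_map_left[OF b]] linear_map_add[OF bilinear_map_right[OF b]]
          linear_map_smult[OF bilinear_map_left[OF b]] linear_map_smult[OF bilinear_map_right[OF b]]
          bc self)
    then show "g \<in> {g \<in> carrier L. h g = \<zero>\<^bsub>P\<^esub>}" using g tensor_relations_subset by blast
  qed
  from span_submodule_minimal[OF submodule_if_linear_vanish[OF L.module_axioms P h] this]
  show ?thesis using assms by (auto simp: tensor_kernel_def)
qed

private lemma tensor_lift_eq: "tensor_lift R P b = (\<lambda>Z. the_elem (h ` Z))"
  by (simp add: tensor_lift_def[abs_def] free_ext_def[abs_def])

lemma linear_map_tensor_lift: "linear_map R T P (tensor_lift R P b)"
  unfolding tensor_lift_eq tensor_def by (rule linear_map_lift[OF P h h_kernel])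

lemma tensor_lift_pure: "x \<in> carrier M \<Longrightarrow> y \<in> carrier N \<Longrightarrow> tensor_lift R P b (pure x y) = b x y"
  using lift_coset[OF P h h_kernel gen_closed] by (simp add: tensor_lift_eq pure_eq h_gen)

end

end

section \<open>Polynomial algebras\<close>

text \<open>Reduces commutativity and associativity of convolution to monomials, where they are laws
  of multiset sum.\<close>

lemma (in cring) free_module_bilinear_eqI:
  assumes P: "module R P" and b: "bilinear_map R (free_module R A) (free_module R B) P b"
    and c: "bilinear_map R (free_module R A) (free_module R B) P c"
    and gen: "\<And>x y. x \<in> A \<Longrightarrow> y \<in> B \<Longrightarrow> b (free_gen R x) (free_gen R y) = c (free_gen R x) (free_gen R y)"
    and p: "p \<in> carrier (free_module R A)" and q: "q \<in> carrier (free_module R B)"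
  shows "b p q = c p q"
proof (rule free_module_linear_eqI[OF P bilinear_map_left[OF b q] bilinear_map_left[OF c q] _ p])
  fix x assume "x \<in> A"
  then have x: "free_gen R x \<in> carrier (free_module R A)" by (rule free_gen_closed)
  show "b (free_gen R x) q = c (free_gen R x) q"
    by (rule free_module_linear_eqI[OF P bilinear_map_right[OF b x] bilinear_map_right[OF c x] _ q])
       (rule gen[OF \<open>x \<in> A\<close>])
qed

text \<open>A \<open>finsum\<close> over an infinite set is zero by convention, so convolution is
  meaningful only because these sets are finite. A submultiset of \<open>add_mset x m\<close> either
  omits \<open>x\<close> and lies in \<open>m\<close>, or arises from a submultiset of
  \<open>m\<close> by adding \<open>x\<close>.\<close>

lemma finite_submultisets: "finite {k. k \<subseteq># m}"
proof (induction m)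
  case (add x m)
  have "{k. k \<subseteq># add_mset x m} \<subseteq> {k. k \<subseteq># m} \<union> add_mset x ` {k. k \<subseteq># m}"
  proof
    fix k assume k: "k \<in> {k. k \<subseteq># add_mset x m}"
    show "k \<in> {k. k \<subseteq># m} \<union> add_mset x ` {k. k \<subseteq># m}"
    proof (cases "x \<in># k")
      case True
      then obtain k' where "k = add_mset x k'" by (meson mset_add)
      with k show ?thesis by auto
    next
      case False
      have "count k y \<le> count m y" for y
        using k False mset_subset_eq_count[of k "add_mset x m" y] by (cases "y = x") (auto simp: not_in_iff)
      then show ?thesis by (simp add: subseteq_mset_def)
    qed
  qed
  with add show ?case by (simp add: finite_subset)
qed simp

abbreviation monomials :: "'x set \<Rightarrow> 'x multiset set" where
  "monomials Z \<equiv> {m. set_mset m \<subseteq> Z}"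

text \<open>Additively \<open>poly_algebra\<close> is the free module on the monomials. Linear
  arguments are made in \<open>F\<close>, to which \<open>P\<close> adds the multiplication.\<close>

locale polynomials = cring R for R (structure) + fixes Z :: "'x set"
begin

abbreviation F where "F \<equiv> free_module R (monomials Z)"
abbreviation P where "P \<equiv> poly_algebra R Z"

sublocale F: module R F by (rule module_free_module)

lemma indexed_var_eq: "ring.indexed_var R x = free_gen R {#x#}"
  by (auto simp: indexed_var_def indexed_pmult_def indexed_const_def free_gen_def fun_eq_iff
      dest: multi_member_split)

text \<open>Indexed polynomials are generated by constants, sums and multiplication by a variable.
  The free module is exhausted by these operations because a term is reached from a constant by
  multiplying with its variables one at a time.\<close>

lemma indexed_pset_eq: "indexed_pset Z (carrier R) = carrier F"
proof
  show "indexed_pset Z (carrier R) \<subseteq> carrier F"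
  proof
    fix p assume "p \<in> indexed_pset Z (carrier R)"
    then show "p \<in> carrier F"
    proof induction
      case (indexed_const k)
      then show ?case
        by (auto simp: carrier_free_module indexed_const_def intro: finite_subset[of _ "{{#}}"])
    next
      case (indexed_padd p q)
      then show ?case unfolding indexed_padd_def by (intro free_module_add_closed)
    next
      case (indexed_pmult p i)
      have "{m. indexed_pmult p i m \<noteq> \<zero>} \<subseteq> add_mset i ` {m. p m \<noteq> \<zero>}"
        by (auto simp: indexed_pmult_def image_iff intro!: exI[of _ "_ - {#i#}"] split: if_splits)
      moreover have p: "finite {m. p m \<noteq> \<zero>}" "{m. p m \<noteq> \<zero>} \<subseteq> monomials Z" "\<And>m. p m \<in> carrier R"
        using indexed_pmult by (simp_all add: carrier_free_module)
      moreover have "add_mset i ` {m. p m \<noteq> \<zero>} \<subseteq> monomials Z"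
        using p(2) indexed_pmult.hyps(2) by (force simp: subset_iff)
      ultimately have "finite {m. indexed_pmult p i m \<noteq> \<zero>}" "{m. indexed_pmult p i m \<noteq> \<zero>} \<subseteq> monomials Z"
        by (blast intro: finite_subset, blast)
      moreover have "indexed_pmult p i m \<in> carrier R" for m
        using p(3) by (simp add: indexed_pmult_def)
      ultimately show ?case by (simp add: carrier_free_module)
    qed
  qed
  show "carrier F \<subseteq> indexed_pset Z (carrier R)"
  proof
    fix p assume "p \<in> carrier F"
    then show "p \<in> indexed_pset Z (carrier R)"
    proof (induction rule: free_module_induct)
      case zero
      have "indexed_const \<zero> \<in> indexed_pset Z (carrier R)" by (rule indexed_pset.indexed_const) simp
      then show ?case by (simp add: free_module_simps indexed_zero_def)
    next
      case (add f g)
      then show ?case using indexed_pset.indexed_padd by (simp add: free_module_simps indexed_padd_def)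
    next
      case (gen a m)
      from gen(2) show ?case
      proof (induction m)
        case empty
        have "a \<odot>\<^bsub>F\<^esub> free_gen R {#} = indexed_const a"
          using gen(1) by (auto simp: free_module_simps free_gen_def indexed_const_def)
        then show ?case using gen(1) by (simp add: indexed_pset.indexed_const)
      next
        case (add x m)
        have "a \<odot>\<^bsub>F\<^esub> free_gen R (add_mset x m) = indexed_pmult (a \<odot>\<^bsub>F\<^esub> free_gen R m) x"
          using gen(1) by (auto simp: free_module_simps free_gen_def indexed_pmult_def fun_eq_iff
              dest: multi_member_split)
        then show ?case using add by (auto intro: indexed_pset.indexed_pmult)
      qed
    qed
  qed
qed

lemma poly_algebra_simps:
  "carrier P = carrier F" "add P = add F" "\<zero>\<^bsub>P\<^esub> = \<zero>\<^bsub>F\<^esub>" "smult P = smult F"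
  "\<one>\<^bsub>P\<^esub> = free_gen R {#}"
  by (simp_all add: poly_algebra_def indexed_pset_eq free_module_def indexed_padd_def[abs_def]
      indexed_zero_def indexed_const_def free_gen_def)

lemma module_poly_algebra: "module R P"
  using module_cong[of P F] F.module_axioms poly_algebra_simps by metis

lemma linear_map_poly_algebra: "linear_map R P Q h \<longleftrightarrow> linear_map R F Q h"
  by (rule linear_map_cong) (simp_all add: poly_algebra_simps)

abbreviation conv (infixl \<open>\<star>\<close> 70) where "p \<star> q \<equiv> p \<otimes>\<^bsub>P\<^esub> q"

lemma conv_eq: "p \<star> q = (\<lambda>m. \<Oplus>k\<in>{k. k \<subseteq># m}. p k \<otimes> q (m - k))"
  by (simp add: poly_algebra_def)

lemma F_coeff: "p \<in> carrier F \<Longrightarrow> p m \<in> carrier R"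
  by (rule free_module_coeff_closed)

lemma conv_closed:
  assumes p: "p \<in> carrier F" and q: "q \<in> carrier F"
  shows "p \<star> q \<in> carrier F"
proof -
  \<comment> \<open>All sums of a monomial of \<open>p\<close> and a monomial of \<open>q\<close>: a
    nonzero coefficient of the product at \<open>m\<close> requires a nonzero term at some splitting
    \<open>k + (m - k)\<close>.\<close>
  let ?S = "(\<lambda>(a, b). a + b) ` ({m. p m \<noteq> \<zero>} \<times> {m. q m \<noteq> \<zero>})"
  have "{m. (p \<star> q) m \<noteq> \<zero>} \<subseteq> ?S"
  proof
    fix m assume m: "m \<in> {m. (p \<star> q) m \<noteq> \<zero>}"
    have "\<exists>k. k \<subseteq># m \<and> p k \<otimes> q (m - k) \<noteq> \<zero>"
    proof (rule ccontr)
      assume "\<not> ?thesis"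
      then have "(p \<star> q) m = \<zero>" unfolding conv_eq by (intro add.finprod_one_eqI) auto
      with m show False by simp
    qed
    then obtain k where k: "k \<subseteq># m" "p k \<otimes> q (m - k) \<noteq> \<zero>" by blast
    then have "p k \<noteq> \<zero>" "q (m - k) \<noteq> \<zero>" using F_coeff[OF p] F_coeff[OF q] by auto
    moreover have "m = k + (m - k)" using k(1) by simp
    ultimately show "m \<in> ?S" by (intro image_eqI[of _ _ "(k, m - k)"]) auto
  qed
  moreover have "finite ?S" using p q by (auto simp: carrier_free_module)
  moreover have "?S \<subseteq> monomials Z" using p q by (auto simp: carrier_free_module) blast+
  ultimately have "finite {m. (p \<star> q) m \<noteq> \<zero>}" "{m. (p \<star> q) m \<noteq> \<zero>} \<subseteq> monomials Z"
    by (blast intro: finite_subset, blast)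
  moreover have "(p \<star> q) m \<in> carrier R" for m
    unfolding conv_eq using F_coeff[OF p] F_coeff[OF q] by (intro finsum_closed) auto
  ultimately show ?thesis by (simp add: carrier_free_module)
qed

lemma bilinear_map_conv: "bilinear_map R F F F (\<star>)"
proof (intro bilinear_mapI linear_mapI)
  fix p q r a
  assume p: "p \<in> carrier F" and q: "q \<in> carrier F"
  note c = F_coeff[OF p] F_coeff[OF q]
  show "p \<star> q \<in> carrier F" by (rule conv_closed[OF p q])
  show "p \<star> q \<in> carrier F" by (rule conv_closed[OF p q])
  show "(p \<oplus>\<^bsub>F\<^esub> q) \<star> r = p \<star> r \<oplus>\<^bsub>F\<^esub> q \<star> r" if r: "r \<in> carrier F"
  proof
    fix m
    have "((p \<oplus>\<^bsub>F\<^esub> q) \<star> r) m = (\<Oplus>k\<in>{k. k \<subseteq># m}. p k \<otimes> r (m - k) \<oplus> q k \<otimes> r (m - k))"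
      unfolding conv_eq using c F_coeff[OF r] by (intro finsum_cong') (auto simp: free_module_simps l_distr)
    also have "\<dots> = (p \<star> r \<oplus>\<^bsub>F\<^esub> q \<star> r) m"
      unfolding conv_eq free_module_simps using c F_coeff[OF r] by (intro finsum_addf) auto
    finally show "((p \<oplus>\<^bsub>F\<^esub> q) \<star> r) m = (p \<star> r \<oplus>\<^bsub>F\<^esub> q \<star> r) m" .
  qed
  show "r \<star> (p \<oplus>\<^bsub>F\<^esub> q) = r \<star> p \<oplus>\<^bsub>F\<^esub> r \<star> q" if r: "r \<in> carrier F"
  proof
    fix m
    have "(r \<star> (p \<oplus>\<^bsub>F\<^esub> q)) m = (\<Oplus>k\<in>{k. k \<subseteq># m}. r k \<otimes> p (m - k) \<oplus> r k \<otimes> q (m - k))"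
      unfolding conv_eq using c F_coeff[OF r] by (intro finsum_cong') (auto simp: free_module_simps r_distr)
    also have "\<dots> = (r \<star> p \<oplus>\<^bsub>F\<^esub> r \<star> q) m"
      unfolding conv_eq free_module_simps using c F_coeff[OF r] by (intro finsum_addf) auto
    finally show "(r \<star> (p \<oplus>\<^bsub>F\<^esub> q)) m = (r \<star> p \<oplus>\<^bsub>F\<^esub> r \<star> q) m" .
  qed
next
  fix p q a
  assume p: "p \<in> carrier F" and a: "a \<in> carrier R" and q: "q \<in> carrier F"
  note c = F_coeff[OF p] F_coeff[OF q]
  show "(a \<odot>\<^bsub>F\<^esub> q) \<star> p = a \<odot>\<^bsub>F\<^esub> (q \<star> p)"
  proof
    fix m
    have "((a \<odot>\<^bsub>F\<^esub> q) \<star> p) m = (\<Oplus>k\<in>{k. k \<subseteq># m}. a \<otimes> (q k \<otimes> p (m - k)))"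
      unfolding conv_eq using c a by (intro finsum_cong') (auto simp: free_module_simps m_assoc)
    also have "\<dots> = (a \<odot>\<^bsub>F\<^esub> (q \<star> p)) m"
      unfolding conv_eq free_module_simps using c a finite_submultisets by (intro finsum_rdistr[symmetric]) auto
    finally show "((a \<odot>\<^bsub>F\<^esub> q) \<star> p) m = (a \<odot>\<^bsub>F\<^esub> (q \<star> p)) m" .
  qed
  show "p \<star> (a \<odot>\<^bsub>F\<^esub> q) = a \<odot>\<^bsub>F\<^esub> (p \<star> q)"
  proof
    fix m
    have "(p \<star> (a \<odot>\<^bsub>F\<^esub> q)) m = (\<Oplus>k\<in>{k. k \<subseteq># m}. a \<otimes> (p k \<otimes> q (m - k)))"
      unfolding conv_eq using c a by (intro finsum_cong') (auto simp: free_module_simps m_lcomm)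
    also have "\<dots> = (a \<odot>\<^bsub>F\<^esub> (p \<star> q)) m"
      unfolding conv_eq free_module_simps using c a finite_submultisets by (intro finsum_rdistr[symmetric]) auto
    finally show "(p \<star> (a \<odot>\<^bsub>F\<^esub> q)) m = (a \<odot>\<^bsub>F\<^esub> (p \<star> q)) m" .
  qed
qed

text \<open>The term \<open>k = a\<close> is the only one that can survive. It is present exactly
  when \<open>a \<subseteq># m\<close>, and then it compares \<open>m - a\<close> with
  \<open>b\<close>.\<close>

lemma conv_free_gen: "free_gen R a \<star> free_gen R b = free_gen R (a + b)"
proof
  fix m
  show "(free_gen R a \<star> free_gen R b) m = free_gen R (a + b) m"
  proof (cases "a \<subseteq># m")
    case True
    have "(free_gen R a \<star> free_gen R b) m
        = (\<Oplus>k\<in>{k. k \<subseteq># m}. if a = k then free_gen R b (m - k) else \<zero>)"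
      unfolding conv_eq by (intro finsum_cong') (auto simp: free_gen_def)
    also have "\<dots> = free_gen R b (m - a)"
      using True finite_submultisets by (intro add.finprod_singleton) (auto simp: free_gen_def)
    also have "\<dots> = free_gen R (a + b) m" using True by (auto simp: free_gen_def)
    finally show ?thesis .
  next
    case False
    have "(free_gen R a \<star> free_gen R b) m = \<zero>"
      unfolding conv_eq by (intro add.finprod_one_eqI) (use False in \<open>auto simp: free_gen_def\<close>)
    with False show ?thesis by (auto simp: free_gen_def)
  qed
qed

lemma conv_comm:
  assumes "p \<in> carrier F" "q \<in> carrier F" shows "p \<star> q = q \<star> p"
proof (rule free_module_bilinear_eqI[OF F.module_axioms bilinear_map_conv _ _ assms])
  show "bilinear_map R F F F (\<lambda>p q. q \<star> p)"
    using bilinear_map_conv by (simp add: bilinear_map_def)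
qed (simp add: conv_free_gen add.commute)

text \<open>Linearity in \<open>r\<close> replaces \<open>r\<close> by a monomial, and then
  bilinearity replaces \<open>p\<close> and \<open>q\<close>.\<close>

lemma conv_assoc:
  assumes p: "p \<in> carrier F" and q: "q \<in> carrier F" and r: "r \<in> carrier F"
  shows "(p \<star> q) \<star> r = p \<star> (q \<star> r)"
proof -
  note left = bilinear_map_left[OF bilinear_map_conv] and right = bilinear_map_right[OF bilinear_map_conv]
  show ?thesis
  proof (rule free_module_linear_eqI[OF F.module_axioms right[OF conv_closed[OF p q]] _ _ r])
    show "linear_map R F F (\<lambda>r. p \<star> (q \<star> r))"
      by (rule linear_map_compose[OF right[OF q] right[OF p]])
    fix c assume "c \<in> monomials Z"
    then have c: "free_gen R c \<in> carrier F" by (rule free_gen_closed)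
    show "(p \<star> q) \<star> free_gen R c = p \<star> (q \<star> free_gen R c)"
    proof (rule free_module_bilinear_eqI[OF F.module_axioms _ _ _ p q])
      show "bilinear_map R F F F (\<lambda>p q. (p \<star> q) \<star> free_gen R c)"
        by (rule bilinear_map_compose_linear[OF bilinear_map_conv left[OF c]])
      show "bilinear_map R F F F (\<lambda>p q. p \<star> (q \<star> free_gen R c))"
        by (intro bilinear_mapI left right conv_closed c linear_map_compose[OF left[OF c] right])
    qed (simp add: conv_free_gen add.assoc)
  qed
qed

lemma conv_one:
  assumes "p \<in> carrier F" shows "free_gen R {#} \<star> p = p"
proof (rule free_module_linear_eqI[OF F.module_axioms bilinear_map_right[OF bilinear_map_conv] _ _ assms])
  show "linear_map R F F (\<lambda>p. p)" by (simp add: linear_map_def)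
qed (simp_all add: conv_free_gen free_gen_closed)

lemma cring_poly_algebra: "cring P"
proof (rule cringI)
  interpret P: module R P by (rule module_poly_algebra)
  show "abelian_group P" by (rule P.abelian_group_axioms)
  show "comm_monoid P"
    by (rule comm_monoidI)
       (simp_all add: poly_algebra_simps conv_closed conv_assoc conv_one free_gen_closed, rule conv_comm)
  show "(p \<oplus>\<^bsub>P\<^esub> q) \<star> r = p \<star> r \<oplus>\<^bsub>P\<^esub> q \<star> r"
    if "p \<in> carrier P" "q \<in> carrier P" "r \<in> carrier P" for p q r
    using that linear_map_add[OF bilinear_map_left[OF bilinear_map_conv]] by (simp add: poly_algebra_simps)
qed

end

section \<open>Symmetric algebras\<close>

locale symmetric_algebra = N: module R N
  for R :: "('a, 'b) ring_scheme" (structure) and N :: "('a, 'n, 'c) module_scheme"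
begin

sublocale polynomials R "carrier N" by unfold_locales

sublocale P: cring P by (rule cring_poly_algebra)

abbreviation I where "I \<equiv> sym_ideal R N"
abbreviation S where "S \<equiv> sym_algebra R N"
abbreviation e where "e \<equiv> free_gen R"
abbreviation V where "V x \<equiv> free_gen R {#x#}"

lemma X_closed: "x \<in> carrier N \<Longrightarrow> V x \<in> carrier F"
  by (simp add: N.free_gen_closed)

sublocale PM: module R P by (rule module_poly_algebra)

lemma sym_relations_subset: "sym_relations R N \<subseteq> carrier P"
proof -
  show ?thesis
    unfolding sym_relations_def Let_def indexed_var_eq
    by (intro Un_least subsetI; elim CollectE exE conjE; hypsubst;
        intro P.minus_closed P.add.m_closed PM.smult_closed; simp add: poly_algebra_simps(1) X_closed)
qed

lemma ideal_I: "ideal I P"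
  unfolding sym_ideal_def by (rule P.genideal_ideal[OF sym_relations_subset])

text \<open>Scalars act through constant polynomials, \<open>a p = (a 1) p\<close>, so closure under
  multiplication by ring elements gives closure under scalars.\<close>

lemma submodule_I: "submodule I R P"
proof -
  interpret ideal I P by (rule ideal_I)
  show ?thesis
  proof (rule PM.submoduleI')
    fix a p assume a: "a \<in> carrier R" and p: "p \<in> I"
    then have pF: "p \<in> carrier F" using Icarr poly_algebra_simps by auto
    have one: "\<one>\<^bsub>P\<^esub> \<in> carrier F" using P.one_closed poly_algebra_simps by simp
    have "(a \<odot>\<^bsub>F\<^esub> \<one>\<^bsub>P\<^esub>) \<otimes>\<^bsub>P\<^esub> p = a \<odot>\<^bsub>F\<^esub> (\<one>\<^bsub>P\<^esub> \<otimes>\<^bsub>P\<^esub> p)"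
      by (rule linear_map_smult[OF bilinear_map_left[OF bilinear_map_conv pF] a one])
    also have "\<one>\<^bsub>P\<^esub> \<otimes>\<^bsub>P\<^esub> p = p" using pF by (simp add: poly_algebra_simps(1))
    finally show "a \<odot>\<^bsub>P\<^esub> p \<in> I"
      using I_l_closed[OF p, of "a \<odot>\<^bsub>F\<^esub> \<one>\<^bsub>P\<^esub>"] a one by (simp add: poly_algebra_simps(1,4))
  qed (use a_subset in auto)
qed

sublocale S: quotient R P I
  by (intro quotient.intro quotient_axioms.intro PM.module_axioms submodule_I)

abbreviation cls where "cls p \<equiv> I +>\<^bsub>P\<^esub> p"

lemma module_S: "module R S"
  using S.module_quot by (simp add: sym_algebra_def)

lemma linear_map_cls: "linear_map R F S cls"
  using S.linear_map_coset by (simp add: sym_algebra_def linear_map_poly_algebra)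

lemma cls_closed: "p \<in> carrier F \<Longrightarrow> cls p \<in> carrier S"
  by (rule linear_map_closed[OF linear_map_cls])

lemma S_carrierE:
  assumes "s \<in> carrier S" obtains p where "p \<in> carrier F" "s = cls p"
  using assms unfolding sym_algebra_def by (rule S.quot_carrierE) (simp add: poly_algebra_simps)

lemma cls_mult: "p \<in> carrier F \<Longrightarrow> q \<in> carrier F \<Longrightarrow> cls p \<otimes>\<^bsub>S\<^esub> cls q = cls (p \<otimes>\<^bsub>P\<^esub> q)"
  using ideal.rcoset_mult_add[OF ideal_I]
  by (simp add: sym_algebra_def quot_module_def poly_algebra_simps(1))

lemma sym_gen_eq: "sym_gen R N x = cls (V x)"
  by (simp add: sym_gen_def indexed_var_eq)

lemma bilinear_map_S_mult: "bilinear_map R S S S (\<lambda>s t. s \<otimes>\<^bsub>S\<^esub> t)"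
proof (intro bilinear_mapI linear_mapI)
  note a = linear_map_add[OF linear_map_cls, symmetric]
  note c = cls_mult conv_closed F.M.add.m_closed F.smult_closed cls_closed
  note l = bilinear_map_left[OF bilinear_map_conv] and r = bilinear_map_right[OF bilinear_map_conv]
  fix s t assume "s \<in> carrier S" and "t \<in> carrier S"
  then obtain p q where s: "p \<in> carrier F" "s = cls p" and t: "q \<in> carrier F" "t = cls q"
    by (elim S_carrierE) blast
  show "s \<otimes>\<^bsub>S\<^esub> t \<in> carrier S" using s t by (simp add: c)
  show "s \<otimes>\<^bsub>S\<^esub> t \<in> carrier S" using s t by (simp add: c)
  fix u assume "u \<in> carrier S"
  then obtain v where u: "v \<in> carrier F" "u = cls v" by (elim S_carrierE)
  show "(s \<oplus>\<^bsub>S\<^esub> t) \<otimes>\<^bsub>S\<^esub> u = s \<otimes>\<^bsub>S\<^esub> u \<oplus>\<^bsub>S\<^esub> t \<otimes>\<^bsub>S\<^esub> u"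
    using s t u by (simp add: a c linear_map_add[OF l])
  show "u \<otimes>\<^bsub>S\<^esub> (s \<oplus>\<^bsub>S\<^esub> t) = u \<otimes>\<^bsub>S\<^esub> s \<oplus>\<^bsub>S\<^esub> u \<otimes>\<^bsub>S\<^esub> t"
    using s t u by (simp add: a c linear_map_add[OF r])
next
  note m = linear_map_smult[OF linear_map_cls, symmetric]
  note c = cls_mult conv_closed F.M.add.m_closed F.smult_closed cls_closed
  note l = bilinear_map_left[OF bilinear_map_conv] and r = bilinear_map_right[OF bilinear_map_conv]
  fix s t a assume "s \<in> carrier S" and "t \<in> carrier S" and a: "a \<in> carrier R"
  then obtain p q where s: "p \<in> carrier F" "s = cls p" and t: "q \<in> carrier F" "t = cls q"
    by (elim S_carrierE) blast
  show "(a \<odot>\<^bsub>S\<^esub> t) \<otimes>\<^bsub>S\<^esub> s = a \<odot>\<^bsub>S\<^esub> (t \<otimes>\<^bsub>S\<^esub> s)"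
    using s t a by (simp add: m c linear_map_smult[OF l])
  show "s \<otimes>\<^bsub>S\<^esub> (a \<odot>\<^bsub>S\<^esub> t) = a \<odot>\<^bsub>S\<^esub> (s \<otimes>\<^bsub>S\<^esub> t)"
    using s t a by (simp add: m c linear_map_smult[OF r])
qed

lemma S_mult_comm: "s \<in> carrier S \<Longrightarrow> t \<in> carrier S \<Longrightarrow> s \<otimes>\<^bsub>S\<^esub> t = t \<otimes>\<^bsub>S\<^esub> s"
  by (elim S_carrierE) (simp add: cls_mult conv_comm)

lemma S_mult_assoc:
  "s \<in> carrier S \<Longrightarrow> t \<in> carrier S \<Longrightarrow> u \<in> carrier S \<Longrightarrow> (s \<otimes>\<^bsub>S\<^esub> t) \<otimes>\<^bsub>S\<^esub> u = s \<otimes>\<^bsub>S\<^esub> (t \<otimes>\<^bsub>S\<^esub> u)"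
  by (elim S_carrierE) (simp add: cls_mult conv_closed conv_assoc)

lemma linear_map_sym_gen: "linear_map R N S (sym_gen R N)"
proof -
  note a = linear_map_add[OF linear_map_cls, symmetric] and m = linear_map_smult[OF linear_map_cls, symmetric]
  have *: "cls u = cls v" if "u \<ominus>\<^bsub>P\<^esub> v \<in> sym_relations R N" "u \<in> carrier P" "v \<in> carrier P" for u v
  proof -
    have "u \<ominus>\<^bsub>P\<^esub> v \<in> I" using that(1) P.genideal_self[OF sym_relations_subset] by (auto simp: sym_ideal_def)
    from S.coset_absorb[OF this that(3)] show ?thesis
      using that(2,3) by (simp add: a_minus_def P.a_assoc P.l_neg)
  qed
  show ?thesis unfolding sym_gen_eq[abs_def]
  proof (rule linear_mapI)
    fix x y a assume x: "x \<in> carrier N"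
    then show "cls (V x) \<in> carrier S" by (simp add: cls_closed X_closed)
    show "cls (V (x \<oplus>\<^bsub>N\<^esub> y)) = cls (V x) \<oplus>\<^bsub>S\<^esub> cls (V y)" if y: "y \<in> carrier N"
    proof -
      have "V (x \<oplus>\<^bsub>N\<^esub> y) \<ominus>\<^bsub>P\<^esub> (V x \<oplus>\<^bsub>P\<^esub> V y) \<in> sym_relations R N"
        unfolding sym_relations_def Let_def indexed_var_eq using x y by blast
      from *[OF this] show ?thesis
        using x y by (simp add: a X_closed poly_algebra_simps(1,2))
    qed
    show "cls (V (a \<odot>\<^bsub>N\<^esub> x)) = a \<odot>\<^bsub>S\<^esub> cls (V x)" if a: "a \<in> carrier R"
    proof -
      have "V (a \<odot>\<^bsub>N\<^esub> x) \<ominus>\<^bsub>P\<^esub> (a \<odot>\<^bsub>P\<^esub> V x) \<in> sym_relations R N"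
        unfolding sym_relations_def Let_def indexed_var_eq using x a by blast
      from *[OF this] show ?thesis
        using x a by (simp add: m X_closed poly_algebra_simps(1,4))
    qed
  qed
qed

section \<open>Linear maps out of the symmetric algebra\<close>

context
  fixes Q :: "('a, 'q, 'd) module_scheme" and h
  assumes Q: "module R Q" and h: "linear_map R F Q h"
    and lin: "\<And>m. set_mset m \<subseteq> carrier N \<Longrightarrow> linear_map R N Q (\<lambda>x. h (e (add_mset x m)))"
begin

text \<open>\<open>h\<close> is not assumed multiplicative, so its kernel need not be an ideal.
  Linearity in one variable of each monomial, the others being fixed, makes \<open>h\<close> vanish
  on all monomial multiples of the relations instead. The criterion thus covers both the evaluation
  of polynomials and the extension of a Koszul form, which is merely linear.\<close>

lemma linear_vanish_sym_ideal:
  assumes "p \<in> I" shows "h p = \<zero>\<^bsub>Q\<^esub>"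
proof -
  interpret Q: module R Q by (rule Q)
  note l = bilinear_map_left[OF bilinear_map_conv] and r = bilinear_map_right[OF bilinear_map_conv]
  \<comment> \<open>The largest ideal inside the kernel of \<open>h\<close>. It contains
    \<open>I\<close> as soon as it contains the relations, and \<open>q = \<one>\<close> then gives
    the claim.\<close>
  let ?K = "{p \<in> carrier P. \<forall>q\<in>carrier P. h (q \<otimes>\<^bsub>P\<^esub> p) = \<zero>\<^bsub>Q\<^esub>}"
  have hP: "linear_map R P Q h" using h by (simp add: linear_map_poly_algebra)
  have hq: "linear_map R P Q (\<lambda>p. h (q \<otimes>\<^bsub>P\<^esub> p))" if "q \<in> carrier P" for q
    using linear_map_compose[OF r h] that by (simp add: linear_map_poly_algebra poly_algebra_simps(1))
  have "subgroup ?K (add_monoid P)"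
  proof -
    have "submodule ?K R P"
      by (rule PM.submoduleI')
         (auto simp: linear_map_zero[OF PM.module_axioms Q hP] linear_map_add[OF hq] linear_map_smult[OF hq])
    then show ?thesis by (rule submodule.axioms(1))
  qed
  moreover have "x \<otimes>\<^bsub>P\<^esub> p \<in> ?K" "p \<otimes>\<^bsub>P\<^esub> x \<in> ?K" if p: "p \<in> ?K" and x: "x \<in> carrier P" for p x
  proof -
    have pP: "p \<in> carrier P" using p by blast
    have "h (q \<otimes>\<^bsub>P\<^esub> (x \<otimes>\<^bsub>P\<^esub> p)) = \<zero>\<^bsub>Q\<^esub>" if q: "q \<in> carrier P" for q
    proof -
      have "h ((q \<otimes>\<^bsub>P\<^esub> x) \<otimes>\<^bsub>P\<^esub> p) = \<zero>\<^bsub>Q\<^esub>" using p P.m_closed[OF q x] by blast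
      then show ?thesis by (simp only: P.m_assoc[OF q x pP])
    qed
    then show "x \<otimes>\<^bsub>P\<^esub> p \<in> ?K" using P.m_closed[OF x pP] by blast
    then show "p \<otimes>\<^bsub>P\<^esub> x \<in> ?K" by (simp only: P.m_comm[OF pP x])
  qed
  ultimately have "ideal ?K P" by (intro idealI P.ring_axioms)
  moreover have "sym_relations R N \<subseteq> ?K"
  proof
    fix p assume p: "p \<in> sym_relations R N"
    have "h (q \<otimes>\<^bsub>P\<^esub> p) = \<zero>\<^bsub>Q\<^esub>" if q: "q \<in> carrier F" for q
    proof -
      have pF: "p \<in> carrier F" using p sym_relations_subset by (auto simp: poly_algebra_simps)
      have "linear_map R F Q (\<lambda>_. \<zero>\<^bsub>Q\<^esub>)" by (rule linear_mapI) simp_all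
      moreover have "h (e m \<otimes>\<^bsub>P\<^esub> p) = \<zero>\<^bsub>Q\<^esub>" if m: "m \<in> monomials (carrier N)" for m
      proof -
        have em: "e m \<in> carrier P" using m by (simp add: poly_algebra_simps(1) N.free_gen_closed)
        have eX: "h (e m \<otimes>\<^bsub>P\<^esub> V x) = h (e (add_mset x m))" for x by (simp add: conv_free_gen)
        have m': "set_mset m \<subseteq> carrier N" using m by simp
        note lm = linear_map_minus[OF PM.module_axioms Q hq[OF em]] linear_map_add[OF hq[OF em]]
          linear_map_smult[OF hq[OF em]]
        have XP: "V x \<in> carrier P" if "x \<in> carrier N" for x
          using that by (simp add: X_closed poly_algebra_simps(1))
        have self: "z \<ominus>\<^bsub>Q\<^esub> z = \<zero>\<^bsub>Q\<^esub>" if "z \<in> carrier Q" for z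
          using that by (simp add: a_minus_def Q.M.r_neg)
        note cl = linear_map_closed[OF lin[OF m']]
        show ?thesis using p unfolding sym_relations_def Let_def indexed_var_eq
          by (elim UnE CollectE exE conjE; simp add: lm eX XP PM.smult_closed P.add.m_closed
            linear_map_add[OF lin[OF m']] linear_map_smult[OF lin[OF m']] self cl)
      qed
      ultimately show ?thesis
        using N.free_module_linear_eqI[OF Q linear_map_compose[OF l[OF pF] h] _ _ q] by blast
    qed
    then show "p \<in> ?K" using p sym_relations_subset by (auto simp: poly_algebra_simps(1))
  qed
  ultimately have "I \<subseteq> ?K" unfolding sym_ideal_def by (rule P.genideal_minimal)
  with assms have "p \<in> carrier P" "h (\<one>\<^bsub>P\<^esub> \<otimes>\<^bsub>P\<^esub> p) = \<zero>\<^bsub>Q\<^esub>" by auto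
  then show ?thesis by simp
qed

lemma linear_map_sym_lift: "linear_map R S Q (\<lambda>s. the_elem (h ` s))"
  unfolding sym_algebra_def
  by (rule S.linear_map_lift[OF Q _ linear_vanish_sym_ideal]) (use h in \<open>simp add: linear_map_poly_algebra\<close>)

lemma sym_lift_cls: "p \<in> carrier F \<Longrightarrow> the_elem (h ` cls p) = h p"
  by (rule S.lift_coset[OF Q _ linear_vanish_sym_ideal])
     (use h in \<open>simp_all add: linear_map_poly_algebra poly_algebra_simps(1)\<close>)

end

text \<open>Presents a homogeneous part as the image of the free module on the monomials of degree
  \<open>n\<close>, to which \<open>free_module_induct\<close> applies.\<close>

lemma sym_part_eq:
  "sym_part R N n = cls ` carrier (free_module R {m. set_mset m \<subseteq> carrier N \<and> size m = n})"
proof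
  show "sym_part R N n \<subseteq> cls ` carrier (free_module R {m. set_mset m \<subseteq> carrier N \<and> size m = n})"
    unfolding sym_part_def poly_algebra_simps(1) carrier_free_module by blast
  show "cls ` carrier (free_module R {m. set_mset m \<subseteq> carrier N \<and> size m = n}) \<subseteq> sym_part R N n"
    unfolding sym_part_def poly_algebra_simps(1) carrier_free_module by blast
qed

end

section \<open>Standard modules\<close>

lemma module_restrict_scalars:
  assumes "module U F" and "subcring A U"
  shows "module (U\<lparr>carrier := A\<rparr>) F"
proof -
  interpret module U F by fact
  note A = subcringE(1)[OF assms(2)]
  have "cring (U\<lparr>carrier := A\<rparr>)" using subcring_iff[OF A] assms(2) by simp
  then show ?thesis
    by (rule moduleI)
       (use A in \<open>auto simp: M.abelian_group_axioms smult_l_distr smult_r_distr smult_assoc1 subset_iff\<close>)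
qed

lemma (in cring) module_part_module_carrier: "module R (part_module R (carrier R))"
proof (rule moduleI)
  show "abelian_group (part_module R (carrier R))"
    by (rule abelian_groupI) (auto simp: part_module_def a_ac intro: l_neg exI[of _ "\<ominus> _"])
qed (auto simp: part_module_def l_distr r_distr m_assoc is_cring)

text \<open>Submodules and spans are taken over the base ring \<open>Ug 0\<close>, while all of
  \<open>U\<close> acts on \<open>F\<close>. The last three assumptions together say that
  \<open>Fg (Suc n)\<close> is the product of \<open>Ug 1\<close> and \<open>Fg n\<close>, the
  degree-by-degree form of generation by \<open>F\<^sub>0\<close>.\<close>

locale standard_module =
  fixes U :: "('u, 'b) ring_scheme" (structure) and Ug :: "nat \<Rightarrow> 'u set"
    and F :: "('u, 'f, 'c) module_scheme" and Fg :: "nat \<Rightarrow> 'f set"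
  assumes module_F: "module U F"
    and subcring: "subcring (Ug 0) U"
    and submodule_U1: "submodule (Ug 1) (base_ring U Ug) (part_module U (carrier U))"
    and submodule_Fg: "submodule (Fg n) (base_ring U Ug) F"
    and smult_Fg: "x \<in> Ug 1 \<Longrightarrow> f \<in> Fg n \<Longrightarrow> x \<odot>\<^bsub>F\<^esub> f \<in> Fg (Suc n)"
    and Fg_Suc: "Fg (Suc n) \<subseteq> span_submodule (base_ring U Ug) F {x \<odot>\<^bsub>F\<^esub> f | x f. x \<in> Ug 1 \<and> f \<in> Fg n}"
begin

declare One_nat_def [simp del] \<comment> \<open>otherwise \<open>Ug 1\<close> is rewritten inside the abbreviations below\<close>

abbreviation R where "R \<equiv> base_ring U Ug"
abbreviation U' where "U' \<equiv> part_module U (carrier U)"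
abbreviation U1 where "U1 \<equiv> part_module U (Ug 1)"
abbreviation F0 where "F0 \<equiv> F\<lparr>carrier := Fg 0\<rparr>"
abbreviation S where "S \<equiv> part_sym U Ug"
abbreviation T where "T \<equiv> sym_tensor U Ug F Fg"
abbreviation pure where "pure \<equiv> sym_pure U Ug F Fg"
abbreviation gen where "gen \<equiv> sym_gen R U1"

sublocale UF: module U F by (rule module_F)

sublocale FR: module R F
  unfolding base_ring_def by (rule module_restrict_scalars[OF module_F subcring])

sublocale U': module R U'
  unfolding base_ring_def by (rule module_restrict_scalars[OF UF.module_part_module_carrier subcring])

sublocale U1: module R U1
  using submodule.submodule_is_module[OF submodule_U1 U'.module_axioms] by (simp add: part_module_def)

sublocale F0: module R F0
  by (rule submodule.submodule_is_module[OF submodule_Fg FR.module_axioms])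

sublocale sym: symmetric_algebra R U1
  by (intro symmetric_algebra.intro U1.module_axioms)

sublocale ten: tensor_product R S F0
  by (intro tensor_product.intro sym.module_S F0.module_axioms)

sublocale ten': tensor_product R U' F0
  by (intro tensor_product.intro U'.module_axioms F0.module_axioms)

lemma R_simps: "carrier R = Ug 0" "\<zero>\<^bsub>R\<^esub> = \<zero>\<^bsub>U\<^esub>" "\<one>\<^bsub>R\<^esub> = \<one>\<^bsub>U\<^esub>" "monoid.mult R = monoid.mult U" "add R = add U"
  by (simp_all add: base_ring_def)

lemma part_module_simps:
  "carrier (part_module U Z) = Z" "\<zero>\<^bsub>part_module U Z\<^esub> = \<zero>\<^bsub>U\<^esub>" "monoid.mult (part_module U Z) = monoid.mult U"
  "add (part_module U Z) = add U" "smult (part_module U Z) = monoid.mult U"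
  by (simp_all add: part_module_def)

lemma U1_subset: "Ug 1 \<subseteq> carrier U"
  using submodule_subset[OF submodule_U1] by (simp add: part_module_simps)

lemma U1_carrier: "x \<in> Ug 1 \<Longrightarrow> x \<in> carrier U" using U1_subset by blast

lemma U0_carrier: "a \<in> Ug 0 \<Longrightarrow> a \<in> carrier U"
  using subringE(1)[OF subcring.axioms(1)[OF subcring]] by blast

lemma Fg_carrier: "f \<in> Fg n \<Longrightarrow> f \<in> carrier F"
  using submodule_subset[OF submodule_Fg] by blast

lemma T_eq: "T = tensor R S F0" by (simp add: sym_tensor_def)

sublocale T: module R T unfolding T_eq by (rule ten.module_tensor)

text \<open>The value of a monomial at its own entries, in the shape in which
  \<open>sym_to_algebra\<close> writes it.\<close>

definition mono :: "'u multiset \<Rightarrow> 'u" where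
  "mono m = (\<Otimes>x\<in>set_mset m. x [^] count m x)"

lemma mono_closed: "set_mset m \<subseteq> carrier U \<Longrightarrow> mono m \<in> carrier U"
  unfolding mono_def by (intro UF.R.finprod_closed) auto

lemma mono_empty: "mono {#} = \<one>" by (simp add: mono_def)

lemma mono_add_mset:
  assumes "x \<in> carrier U" "set_mset m \<subseteq> carrier U"
  shows "mono (add_mset x m) = x \<otimes> mono m"
proof -
  \<comment> \<open>\<open>x\<close> may or may not occur in \<open>m\<close>. Taking all products
    over \<open>?A\<close> treats both cases alike, since an entry outside \<open>m\<close>
    contributes a factor with exponent 0.\<close>
  let ?A = "insert x (set_mset m)"
  have A: "?A \<subseteq> carrier U" "finite ?A" using assms by auto
  have "mono (add_mset x m) = (\<Otimes>y\<in>?A. (if x = y then y else \<one>) \<otimes> y [^] count m y)"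
    unfolding mono_def using A by (intro UF.R.finprod_cong') (auto simp: UF.R.m_comm)
  also have "\<dots> = (\<Otimes>y\<in>?A. if x = y then y else \<one>) \<otimes> (\<Otimes>y\<in>?A. y [^] count m y)"
    using A by (intro UF.R.finprod_multf) auto
  also have "(\<Otimes>y\<in>?A. if x = y then y else \<one>) = x"
    using A by (intro UF.R.finprod_singleton) auto
  also have "(\<Otimes>y\<in>?A. y [^] count m y) = mono m"
    unfolding mono_def
    by (rule UF.R.finprod_mono_neutral_cong_left[symmetric]) (use A in \<open>auto simp: not_in_iff\<close>)
  finally show ?thesis .
qed

lemma mono_smult_Fg:
  assumes "set_mset m \<subseteq> Ug 1" "f \<in> Fg n" shows "mono m \<odot>\<^bsub>F\<^esub> f \<in> Fg (n + size m)"
  using assms(1)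
proof (induction m)
  case empty
  then show ?case using assms(2) Fg_carrier by (simp add: mono_empty)
next
  case (add x m)
  then have x: "x \<in> Ug 1" "x \<in> carrier U" "set_mset m \<subseteq> carrier U" using U1_subset by auto
  have "mono (add_mset x m) \<odot>\<^bsub>F\<^esub> f = x \<odot>\<^bsub>F\<^esub> (mono m \<odot>\<^bsub>F\<^esub> f)"
    using x Fg_carrier[OF assms(2)] by (simp add: mono_add_mset UF.smult_assoc1 mono_closed)
  also have "\<dots> \<in> Fg (Suc (n + size m))" using add x by (intro smult_Fg) auto
  finally show ?case by simp
qed

section \<open>Evaluation of the symmetric algebra in \<open>U\<close>\<close>

abbreviation ev where "ev \<equiv> free_ext R U' mono"
abbreviation eval where "eval \<equiv> sym_to_algebra U"

lemma mono_in: "mono \<in> monomials (carrier U1) \<rightarrow> carrier U'"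
  using U1_subset by (auto simp: part_module_simps intro!: mono_closed)

lemma linear_map_ev: "linear_map R sym.F U' ev"
  by (rule linear_map_free_ext[OF U'.module_axioms mono_in])

lemma mono_gen_closed: "set_mset m \<subseteq> Ug 1 \<Longrightarrow> free_gen R m \<in> carrier sym.F"
  by (rule FR.free_gen_closed) (simp add: part_module_simps)

lemma ev_gen: "set_mset m \<subseteq> Ug 1 \<Longrightarrow> ev (free_gen R m) = mono m"
  by (rule free_ext_free_gen[OF U'.module_axioms mono_in]) (simp add: part_module_simps)

text \<open>\<open>sym_to_algebra\<close> sums in the ring \<open>U\<close>, \<open>free_ext\<close>
  in the module \<open>U'\<close>. The sums agree because the two records have the same carrier,
  zero and addition.\<close>

lemma eval_eq: "eval = (\<lambda>s. the_elem (ev ` s))"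
proof -
  have "finsum U f A = finsum U' f A" for f :: "'u multiset \<Rightarrow> 'u" and A
    by (simp add: finsum_def finprod_def part_module_simps)
  then show ?thesis
    by (simp add: fun_eq_iff sym_to_algebra_def free_ext_def[abs_def] mono_def R_simps part_module_simps)
qed

text \<open>The hypothesis of the lifting criterion for the symmetric algebra; it holds because
  appending \<open>x\<close> to a monomial multiplies its value by \<open>x\<close>.\<close>

lemma linear_map_ev_var:
  assumes "set_mset m \<subseteq> carrier U1"
  shows "linear_map R U1 U' (\<lambda>x. ev (free_gen R (add_mset x m)))"
  using assms U1_subset
  by (intro linear_mapI)
     (auto simp: ev_gen part_module_simps mono_add_mset mono_closed UF.R.l_distr UF.R.m_assoc
        R_simps U0_carrier subset_iff U1.M.add.m_closed[unfolded part_module_simps, simplified]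
        U1.smult_closed[unfolded part_module_simps R_simps])

lemma linear_map_eval: "linear_map R S U' eval"
  unfolding eval_eq by (rule sym.linear_map_sym_lift[OF U'.module_axioms linear_map_ev linear_map_ev_var])

lemma eval_cls: "p \<in> carrier sym.F \<Longrightarrow> eval (sym.cls p) = ev p"
  unfolding eval_eq by (rule sym.sym_lift_cls[OF U'.module_axioms linear_map_ev linear_map_ev_var])

lemma eval_closed: "s \<in> carrier S \<Longrightarrow> eval s \<in> carrier U"
  using linear_map_closed[OF linear_map_eval] by (simp add: part_module_simps)

lemma bilinear_map_smult: "bilinear_map R U' F0 F (\<lambda>u f. u \<odot>\<^bsub>F\<^esub> f)"
proof (intro bilinear_mapI linear_mapI)
  fix f a x y
  assume f: "f \<in> carrier F0"
  then have f: "f \<in> carrier F" using Fg_carrier by simp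
  assume x: "x \<in> carrier U'"
  show "x \<odot>\<^bsub>F\<^esub> f \<in> carrier F" using f x by (simp add: part_module_simps)
  show "x \<odot>\<^bsub>F\<^esub> f \<in> carrier F" using f x by (simp add: part_module_simps)
  show "(x \<oplus>\<^bsub>U'\<^esub> y) \<odot>\<^bsub>F\<^esub> f = x \<odot>\<^bsub>F\<^esub> f \<oplus>\<^bsub>F\<^esub> y \<odot>\<^bsub>F\<^esub> f" if "y \<in> carrier U'"
    using f x that by (simp add: part_module_simps UF.smult_l_distr)
  show "x \<odot>\<^bsub>F\<^esub> (f \<oplus>\<^bsub>F0\<^esub> g) = x \<odot>\<^bsub>F\<^esub> f \<oplus>\<^bsub>F\<^esub> x \<odot>\<^bsub>F\<^esub> g" if "g \<in> carrier F0" for g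
    using f x that Fg_carrier by (simp add: part_module_simps UF.smult_r_distr)
next
  fix f a x
  assume "f \<in> carrier F0" and x: "x \<in> carrier U'" and "a \<in> carrier R"
  then have f: "f \<in> carrier F" and a: "a \<in> carrier U" and x: "x \<in> carrier U"
    using Fg_carrier U0_carrier by (simp_all add: R_simps part_module_simps)
  show "(a \<odot>\<^bsub>U'\<^esub> x) \<odot>\<^bsub>F\<^esub> f = a \<odot>\<^bsub>F\<^esub> (x \<odot>\<^bsub>F\<^esub> f)"
    using f x a by (simp add: part_module_simps UF.smult_assoc1)
  show "x \<odot>\<^bsub>F\<^esub> (a \<odot>\<^bsub>F0\<^esub> f) = a \<odot>\<^bsub>F\<^esub> (x \<odot>\<^bsub>F\<^esub> f)"
    using f x a by (simp add: UF.smult_assoc1[symmetric] UF.R.m_comm)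
qed

section \<open>The map \<open>\<gamma>\<close> and the action of \<open>U\<^sub>1\<close> on the
  tensor product\<close>

abbreviation \<gamma> where "\<gamma> \<equiv> gamma U Ug F Fg"

lemma bilinear_map_eval_pure: "bilinear_map R S F0 ten'.T (\<lambda>s f. ten'.pure (eval s) f)"
  by (rule bilinear_map_compose_left[OF ten'.bilinear_map_pure linear_map_eval])

lemma linear_map_gamma: "linear_map R T F \<gamma>"
  unfolding gamma_def Let_def T_eq comp_def
  by (rule linear_map_compose[OF
        ten.linear_map_tensor_lift[OF ten'.module_tensor bilinear_map_eval_pure]
        ten'.linear_map_tensor_lift[OF FR.module_axioms bilinear_map_smult]])

lemma gamma_pure:
  assumes "s \<in> carrier S" "f \<in> Fg 0" shows "\<gamma> (pure s f) = eval s \<odot>\<^bsub>F\<^esub> f"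
  using assms eval_closed
  by (simp add: gamma_def Let_def part_module_simps
      ten.tensor_lift_pure[OF ten'.module_tensor bilinear_map_eval_pure]
      ten'.tensor_lift_pure[OF FR.module_axioms bilinear_map_smult])

lemma gen_closed: "x \<in> Ug 1 \<Longrightarrow> gen x \<in> carrier S"
  using linear_map_closed[OF sym.linear_map_sym_gen] by (simp add: part_module_simps)

text \<open>Both sides are linear in \<open>s\<close>, so it is enough to check monomials, where the
  claim is \<open>mono_add_mset\<close>.\<close>

lemma eval_gen_mult:
  assumes x: "x \<in> Ug 1" and s: "s \<in> carrier S"
  shows "eval (gen x \<otimes>\<^bsub>S\<^esub> s) = x \<otimes> eval s"
proof -
  from s obtain p where p: "p \<in> carrier sym.F" "s = sym.cls p" by (rule sym.S_carrierE)
  have xF: "free_gen R {#x#} \<in> carrier sym.F" using x by (simp add: mono_gen_closed)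
  have "ev (free_gen R {#x#} \<otimes>\<^bsub>sym.P\<^esub> p) = x \<otimes> ev p"
  proof (rule FR.free_module_linear_eqI[OF U'.module_axioms _ _ _ p(1)])
    show "linear_map R sym.F U' (\<lambda>p. ev (free_gen R {#x#} \<otimes>\<^bsub>sym.P\<^esub> p))"
      by (rule linear_map_compose[OF bilinear_map_right[OF sym.bilinear_map_conv xF] linear_map_ev])
    have "linear_map R U' U' (\<lambda>u. x \<otimes> u)"
      using U1_carrier[OF x] by (intro linear_mapI)
        (auto simp: part_module_simps R_simps UF.R.r_distr UF.R.m_lcomm U0_carrier)
    then show "linear_map R sym.F U' (\<lambda>p. x \<otimes> ev p)"
      by (rule linear_map_compose[OF linear_map_ev])
    show "ev (free_gen R {#x#} \<otimes>\<^bsub>sym.P\<^esub> free_gen R m) = x \<otimes> ev (free_gen R m)"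
      if "m \<in> monomials (carrier U1)" for m
      using that x U1_subset unfolding sym.conv_free_gen
      by (auto simp: ev_gen part_module_simps intro!: mono_add_mset)
  qed
  then show ?thesis using p xF by (simp add: sym.sym_gen_eq sym.cls_mult sym.conv_closed eval_cls)
qed

abbreviation act where "act x \<equiv> sym_act U Ug F Fg (gen x)"

lemma bilinear_map_gen_mult_pure:
  assumes "x \<in> Ug 1" shows "bilinear_map R S F0 T (\<lambda>s f. pure (gen x \<otimes>\<^bsub>S\<^esub> s) f)"
  unfolding T_eq
  by (rule bilinear_map_compose_left[OF ten.bilinear_map_pure
        bilinear_map_right[OF sym.bilinear_map_S_mult gen_closed[OF assms]]])

lemma linear_map_act: "x \<in> Ug 1 \<Longrightarrow> linear_map R T T (act x)"
  using ten.linear_map_tensor_lift[OF T.module_axioms bilinear_map_gen_mult_pure]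
  by (simp add: sym_act_def T_eq)

lemma act_pure:
  "x \<in> Ug 1 \<Longrightarrow> s \<in> carrier S \<Longrightarrow> f \<in> Fg 0 \<Longrightarrow> act x (pure s f) = pure (gen x \<otimes>\<^bsub>S\<^esub> s) f"
  using ten.tensor_lift_pure[OF T.module_axioms bilinear_map_gen_mult_pure]
  by (simp add: sym_act_def)

lemma act_closed: "x \<in> Ug 1 \<Longrightarrow> t \<in> carrier T \<Longrightarrow> act x t \<in> carrier T"
  by (rule linear_map_closed[OF linear_map_act])

lemma T_induct [consumes 1, case_names zero add pure]:
  assumes "t \<in> carrier T" and "P \<zero>\<^bsub>T\<^esub>"
    and "\<And>s t. s \<in> carrier T \<Longrightarrow> t \<in> carrier T \<Longrightarrow> P s \<Longrightarrow> P t \<Longrightarrow> P (s \<oplus>\<^bsub>T\<^esub> t)"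
    and "\<And>s f. s \<in> carrier S \<Longrightarrow> f \<in> Fg 0 \<Longrightarrow> P (pure s f)"
  shows "P t"
  using assms unfolding T_eq by (induction rule: ten.tensor_induct) auto

lemma gen_mult_closed: "x \<in> Ug 1 \<Longrightarrow> s \<in> carrier S \<Longrightarrow> gen x \<otimes>\<^bsub>S\<^esub> s \<in> carrier S"
  by (rule linear_map_closed[OF bilinear_map_right[OF sym.bilinear_map_S_mult gen_closed]])

lemma gamma_act:
  assumes x: "x \<in> Ug 1" and t: "t \<in> carrier T" shows "\<gamma> (act x t) = x \<odot>\<^bsub>F\<^esub> \<gamma> t"
proof -
  have "linear_map R F F (\<lambda>f. x \<odot>\<^bsub>F\<^esub> f)"
    using U1_carrier[OF x] U0_carrier
    by (intro linear_mapI)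
       (auto simp: UF.smult_r_distr R_simps UF.smult_assoc1[symmetric] UF.R.m_comm)
  from ten.tensor_linear_eqI[OF FR.module_axioms
      linear_map_compose[OF linear_map_act[OF x] linear_map_gamma, unfolded T_eq]
      linear_map_compose[OF linear_map_gamma this, unfolded T_eq] _ t[unfolded T_eq]]
  show ?thesis
    using x U1_carrier[OF x] eval_closed Fg_carrier
    by (simp add: act_pure gamma_pure gen_mult_closed eval_gen_mult UF.smult_assoc1)
qed

text \<open>\<open>act x\<close> is a lift in \<open>t\<close>, so how it depends on
  \<open>x\<close> is hidden. Linearity in \<open>x\<close> is recovered by induction on
  \<open>t\<close> from that of \<open>gen\<close> and of the product in the symmetric
  algebra.\<close>

lemma linear_map_act_left:
  assumes t: "t \<in> carrier T" shows "linear_map R U1 T (\<lambda>x. act x t)"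
  using t
proof (induction rule: T_induct)
  case zero
  have *: "act x \<zero>\<^bsub>T\<^esub> = \<zero>\<^bsub>T\<^esub>" if "x \<in> carrier U1" for x
    using linear_map_zero[OF T.module_axioms T.module_axioms linear_map_act] that by (simp add: part_module_simps)
  show ?case by (rule linear_mapI) (auto simp: *)
next
  case (add s t)
  have *: "act x (s \<oplus>\<^bsub>T\<^esub> t) = act x s \<oplus>\<^bsub>T\<^esub> act x t" if "x \<in> carrier U1" for x
    using linear_map_add[OF linear_map_act add(1,2)] that by (simp add: part_module_simps)
  show ?case
    using add(1,2) by (intro linear_mapI)
      (simp_all add: * linear_map_closed[OF add(3)] linear_map_closed[OF add(4)]
        linear_map_add[OF add(3)] linear_map_add[OF add(4)]
        linear_map_smult[OF add(3)] linear_map_smult[OF add(4)] T.M.a_ac T.smult_r_distr)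
next
  case (pure s f)
  have f: "f \<in> carrier F0" using pure by simp
  have "linear_map R U1 T (\<lambda>x. pure (gen x \<otimes>\<^bsub>S\<^esub> s) f)"
    unfolding T_eq
    by (rule linear_map_compose[OF
        linear_map_compose[OF sym.linear_map_sym_gen bilinear_map_left[OF sym.bilinear_map_S_mult pure(1)]]
        bilinear_map_left[OF ten.bilinear_map_pure f]])
  moreover have "act x (pure s f) = pure (gen x \<otimes>\<^bsub>S\<^esub> s) f" if "x \<in> carrier U1" for x
    using that pure by (simp add: act_pure part_module_simps)
  ultimately show ?case using linear_map_fun_cong[OF U1.module_axioms, of T] by simp
qed

text \<open>Inherited from commutativity of the symmetric algebra. The symmetry of the universal
  Koszul form will come from here.\<close>

lemma act_commute:
  assumes x: "x \<in> Ug 1" and y: "y \<in> Ug 1" and t: "t \<in> carrier T"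
  shows "act x (act y t) = act y (act x t)"
proof -
  have *: "gen x \<otimes>\<^bsub>S\<^esub> (gen y \<otimes>\<^bsub>S\<^esub> s) = gen y \<otimes>\<^bsub>S\<^esub> (gen x \<otimes>\<^bsub>S\<^esub> s)" if "s \<in> carrier S" for s
    using sym.S_mult_assoc[OF gen_closed[OF x] gen_closed[OF y] that]
      sym.S_mult_assoc[OF gen_closed[OF y] gen_closed[OF x] that]
      sym.S_mult_comm[OF gen_closed[OF x] gen_closed[OF y]] by metis
  note lin = linear_map_compose[OF linear_map_act linear_map_act, unfolded T_eq]
  from ten.tensor_linear_eqI[OF T.module_axioms[unfolded T_eq] lin[OF y x] lin[OF x y] _ t[unfolded T_eq]]
  show ?thesis
    using x y by (simp add: act_pure gen_mult_closed *)
qed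

section \<open>Homogeneous parts of the tensor product\<close>

abbreviation Tg where "Tg \<equiv> sym_tensor_part U Ug F Fg"
abbreviation Sg where "Sg \<equiv> sym_part R U1"

lemma homogeneous_subset: "carrier (free_module R {m. set_mset m \<subseteq> carrier U1 \<and> size m = n}) \<subseteq> carrier sym.F"
  by (rule free_module_mono) auto

lemma Sg_subset: "Sg n \<subseteq> carrier S"
  unfolding sym.sym_part_eq using homogeneous_subset sym.cls_closed by blast

lemma Tg_gens: "{pure s f | s f. s \<in> Sg n \<and> f \<in> Fg 0} \<subseteq> carrier T"
  using Sg_subset ten.pure_closed unfolding T_eq by auto

lemma submodule_Tg: "submodule (Tg n) R T"
  unfolding sym_tensor_part_def by (rule T.submodule_span_submodule[OF Tg_gens])

lemma Tg_carrier: "t \<in> Tg n \<Longrightarrow> t \<in> carrier T"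
  using submodule_subset[OF submodule_Tg] by blast

lemma Tg_pure: "s \<in> Sg n \<Longrightarrow> f \<in> Fg 0 \<Longrightarrow> pure s f \<in> Tg n"
  unfolding sym_tensor_part_def by (rule span_submodule_base) blast

text \<open>The class of a monomial suffices as first factor since coefficients move to the second one.\<close>

lemma Tg_subset:
  assumes H: "submodule H R T"
    and mono: "\<And>m f. set_mset m \<subseteq> Ug 1 \<Longrightarrow> size m = n \<Longrightarrow> f \<in> Fg 0 \<Longrightarrow> pure (sym.cls (free_gen R m)) f \<in> H"
  shows "Tg n \<subseteq> H"
  unfolding sym_tensor_part_def
proof (rule span_submodule_minimal[OF H], rule subsetI)
  fix t assume "t \<in> {pure s f | s f. s \<in> Sg n \<and> f \<in> Fg 0}"
  then obtain p f where p: "p \<in> carrier (free_module R {m. set_mset m \<subseteq> carrier U1 \<and> size m = n})"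
    and f: "f \<in> Fg 0" and t: "t = pure (sym.cls p) f"
    unfolding sym.sym_part_eq by blast
  have lin: "linear_map R sym.F T (\<lambda>p. pure (sym.cls p) f)"
    unfolding T_eq
    by (rule linear_map_compose[OF sym.linear_map_cls bilinear_map_left[OF ten.bilinear_map_pure]])
       (use f in simp)
  have sub: "p \<in> carrier sym.F" if "p \<in> carrier (free_module R {m. set_mset m \<subseteq> carrier U1 \<and> size m = n})" for p
    using that homogeneous_subset by blast
  from p have "pure (sym.cls p) f \<in> H"
  proof (induction rule: FR.free_module_induct)
    case zero
    have "pure (sym.cls \<zero>\<^bsub>sym.F\<^esub>) f = \<zero>\<^bsub>T\<^esub>"
      by (rule linear_map_zero[OF sym.F.module_axioms T.module_axioms lin])
    then show ?case using submodule_zero_closed[OF H] by (simp add: free_module_simps)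
  next
    case (add p q)
    have "pure (sym.cls (p \<oplus>\<^bsub>sym.F\<^esub> q)) f = pure (sym.cls p) f \<oplus>\<^bsub>T\<^esub> pure (sym.cls q) f"
      by (rule linear_map_add[OF lin]) (use add sub in auto)
    then show ?case using submodule_add_closed[OF H add(3,4)] by (simp add: free_module_simps)
  next
    case (gen a m)
    then have m: "set_mset m \<subseteq> Ug 1" "size m = n" by (auto simp: part_module_simps)
    have "pure (sym.cls (a \<odot>\<^bsub>sym.F\<^esub> free_gen R m)) f = a \<odot>\<^bsub>T\<^esub> pure (sym.cls (free_gen R m)) f"
      by (rule linear_map_smult[OF lin gen(1)]) (rule mono_gen_closed[OF m(1)])
    then show ?case using submodule_smult_closed[OF H gen(1) mono[OF m f]] by (simp add: free_module_simps)
  qed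
  with t show "t \<in> H" by simp
qed

lemma cls_mono_closed: "set_mset m \<subseteq> Ug 1 \<Longrightarrow> sym.cls (free_gen R m) \<in> carrier S"
  by (rule sym.cls_closed[OF mono_gen_closed])

lemma cls_mono_Sg: "set_mset m \<subseteq> Ug 1 \<Longrightarrow> sym.cls (free_gen R m) \<in> Sg (size m)"
  unfolding sym.sym_part_eq by (rule imageI) (simp add: FR.free_gen_closed part_module_simps)

lemma act_pure_mono:
  assumes "x \<in> Ug 1" "set_mset m \<subseteq> Ug 1" "f \<in> Fg 0"
  shows "act x (pure (sym.cls (free_gen R m)) f) = pure (sym.cls (free_gen R (add_mset x m))) f"
proof -
  have "gen x \<otimes>\<^bsub>S\<^esub> sym.cls (free_gen R m) = sym.cls (free_gen R (add_mset x m))"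
    using assms by (simp add: sym.sym_gen_eq sym.cls_mult sym.conv_free_gen mono_gen_closed)
  with act_pure[OF assms(1) cls_mono_closed[OF assms(2)] assms(3)] show ?thesis by metis
qed

lemma gamma_pure_mono:
  assumes "set_mset m \<subseteq> Ug 1" "f \<in> Fg 0"
  shows "\<gamma> (pure (sym.cls (free_gen R m)) f) = mono m \<odot>\<^bsub>F\<^esub> f"
  using assms by (simp add: gamma_pure cls_mono_closed eval_cls mono_gen_closed ev_gen)

lemma act_Tg: 
  assumes x: "x \<in> Ug 1" and t: "t \<in> Tg n" shows "act x t \<in> Tg (Suc n)"
proof -
  have "Tg n \<subseteq> {t \<in> carrier T. act x t \<in> Tg (Suc n)}"
  proof (rule Tg_subset[OF submodule_vimage[OF T.module_axioms T.module_axioms linear_map_act[OF x] submodule_Tg]])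
    fix m f assume m: "set_mset m \<subseteq> Ug 1" "size m = n" and f: "f \<in> Fg 0"
    have "pure (sym.cls (free_gen R m)) f \<in> Tg n" using Tg_pure[OF cls_mono_Sg f] m by blast
    moreover have "act x (pure (sym.cls (free_gen R m)) f) \<in> Tg (size (add_mset x m))"
      unfolding act_pure_mono[OF x m(1) f] by (intro Tg_pure cls_mono_Sg f) (use x m in auto)
    ultimately show "pure (sym.cls (free_gen R m)) f \<in> {t \<in> carrier T. act x t \<in> Tg (Suc n)}"
      using m Tg_carrier by simp
  qed
  with t show ?thesis by blast
qed

lemma gamma_Tg: 
  assumes t: "t \<in> Tg n" shows "\<gamma> t \<in> Fg n"
proof -
  have "Tg n \<subseteq> {t \<in> carrier T. \<gamma> t \<in> Fg n}"
  proof (rule Tg_subset[OF submodule_vimage[OF T.module_axioms FR.module_axioms linear_map_gamma submodule_Fg]])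
    fix m f assume m: "set_mset m \<subseteq> Ug 1" "size m = n" and f: "f \<in> Fg 0"
    have "pure (sym.cls (free_gen R m)) f \<in> Tg n" using Tg_pure[OF cls_mono_Sg f] m by blast
    then show "pure (sym.cls (free_gen R m)) f \<in> {t \<in> carrier T. \<gamma> t \<in> Fg n}"
      using mono_smult_Fg[OF m(1) f] m f Tg_carrier by (simp add: gamma_pure_mono)
  qed
  with t show ?thesis by blast
qed

text \<open>In degree 0 pure tensors with first factor 1 suffice. Higher degrees follow from
  \<open>F\<^sub>n\<^sub>+\<^sub>1 = U\<^sub>1 F\<^sub>n\<close>, since \<open>\<gamma>\<close>
  turns \<open>act x\<close> into multiplication by \<open>x\<close>. The universal Koszul form is
  defined through these preimages.\<close>

lemma gamma_Tg_surj:
  assumes "f \<in> Fg n" shows "\<exists>t\<in>Tg n. \<gamma> t = f"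
  using assms
proof (induction n arbitrary: f)
  case 0
  then show ?case
    using Tg_pure[OF cls_mono_Sg[of "{#}"] 0] gamma_pure_mono[of "{#}" f] Fg_carrier[OF 0]
    by (auto simp: mono_empty)
next
  case (Suc n)
  have "{x \<odot>\<^bsub>F\<^esub> f | x f. x \<in> Ug 1 \<and> f \<in> Fg n} \<subseteq> carrier F"
    using U1_carrier Fg_carrier by auto
  from subsetD[OF Fg_Suc Suc.prems] this show ?case
  proof (induction rule: FR.span_submodule_induct)
    case (base f)
    then obtain x g where x: "x \<in> Ug 1" "g \<in> Fg n" "f = x \<odot>\<^bsub>F\<^esub> g" by blast
    with Suc.IH obtain t where "t \<in> Tg n" "\<gamma> t = g" by blast
    with x show ?case using gamma_act Tg_carrier act_Tg by metis
  next
    case zero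
    then show ?case
      using linear_map_zero[OF T.module_axioms FR.module_axioms linear_map_gamma]
        submodule_zero_closed[OF submodule_Tg] by blast
  next
    case (add f g)
    then show ?case using linear_map_add[OF linear_map_gamma] Tg_carrier submodule_add_closed[OF submodule_Tg] by metis
  next
    case (smult a f)
    then show ?case using linear_map_smult[OF linear_map_gamma] Tg_carrier submodule_smult_closed[OF submodule_Tg] by metis
  qed
qed

end

section \<open>Effective relations and Koszul relations\<close>

text \<open>The image of \<open>U\<^sub>1 \<otimes> Y\<close> in \<open>F \<oplus> Q\<close> under \<open>x \<otimes> f \<mapsto> (x f, \<Phi> x f)\<close>. Exactness of
  \<open>\<Lambda>\<^sup>2 U\<^sub>1 \<otimes> F\<^sub>n \<rightarrow> U\<^sub>1 \<otimes> F\<^sub>n\<^sub>+\<^sub>1 \<rightarrow> F\<^sub>n\<^sub>+\<^sub>2\<close> says that for every \<open>\<Phi>\<close> vanishing on the Koszul relations this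
  is the graph of a function.\<close>

inductive_set koszul_graph ::
    "('u, 'f, 'c) module_scheme \<Rightarrow> ('u, 'q, 'd) module_scheme \<Rightarrow> 'u set \<Rightarrow> 'f set
      \<Rightarrow> ('u \<Rightarrow> 'f \<Rightarrow> 'q) \<Rightarrow> ('f \<times> 'q) set"
  for F Q A B \<Phi> where
  zero: "(\<zero>\<^bsub>F\<^esub>, \<zero>\<^bsub>Q\<^esub>) \<in> koszul_graph F Q A B \<Phi>"
| gen: "x \<in> A \<Longrightarrow> f \<in> B \<Longrightarrow> (x \<odot>\<^bsub>F\<^esub> f, \<Phi> x f) \<in> koszul_graph F Q A B \<Phi>"
| add: "(v, q) \<in> koszul_graph F Q A B \<Phi> \<Longrightarrow> (w, r) \<in> koszul_graph F Q A B \<Phi>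
    \<Longrightarrow> (v \<oplus>\<^bsub>F\<^esub> w, q \<oplus>\<^bsub>Q\<^esub> r) \<in> koszul_graph F Q A B \<Phi>"

context standard_module
begin

text \<open>A linear map on \<open>U\<^sub>1 \<otimes> F\<^sub>n\<^sub>+\<^sub>1\<close> that kills
  the Koszul relations, written as a bilinear map. The index is the degree of \<open>g\<close>, so a
  form of index \<open>n\<close> tests relations of degree \<open>n + 2\<close>.\<close>

definition koszul_form :: "nat \<Rightarrow> ('u, 'q, 'd) module_scheme \<Rightarrow> ('u \<Rightarrow> 'f \<Rightarrow> 'q) \<Rightarrow> bool" where
  "koszul_form n Q \<Phi> \<longleftrightarrow> bilinear_map R U1 (F\<lparr>carrier := Fg (Suc n)\<rparr>) Q \<Phi>
     \<and> (\<forall>x\<in>Ug 1. \<forall>y\<in>Ug 1. \<forall>g\<in>Fg n. \<Phi> x (y \<odot>\<^bsub>F\<^esub> g) = \<Phi> y (x \<odot>\<^bsub>F\<^esub> g))"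

abbreviation K where "K \<equiv> gamma_kernel U Ug F Fg"
abbreviation D where "D \<equiv> decomposable_kernel U Ug F Fg"

lemma submodule_D: "submodule (D n) R T"
  unfolding decomposable_kernel_def
  by (rule T.submodule_span_submodule) (auto simp: gamma_kernel_def intro!: act_closed dest: Tg_carrier)

lemma act_in_D: "x \<in> Ug 1 \<Longrightarrow> t \<in> K n \<Longrightarrow> act x t \<in> D (Suc n)"
  unfolding decomposable_kernel_def by (rule span_submodule_base) auto

text \<open>The quotient is formed in the record with carrier \<open>K n\<close>, but its cosets are
  the same sets as the cosets in \<open>T\<close>. So the quotient of \<open>T\<close> by
  \<open>D n\<close> decides when the coset of an element of \<open>K n\<close> is trivial.\<close>

lemma effective_relations_trivial_iff:
  "carrier (effective_relations U Ug F Fg n) = {\<zero>\<^bsub>effective_relations U Ug F Fg n\<^esub>} \<longleftrightarrow> K n \<subseteq> D n"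
proof -
  interpret q: quotient R T "D n"
    by (intro quotient.intro quotient_axioms.intro T.module_axioms submodule_D)
  have K: "K n \<subseteq> carrier T" by (auto simp: gamma_kernel_def dest: Tg_carrier)
  have zero: "\<zero>\<^bsub>T\<^esub> \<in> K n"
    using linear_map_zero[OF T.module_axioms FR.module_axioms linear_map_gamma]
      submodule_zero_closed[OF submodule_Tg] by (simp add: gamma_kernel_def)
  have 1: "carrier (effective_relations U Ug F Fg n) = (\<lambda>t. D n +>\<^bsub>T\<^esub> t) ` K n"
    by (auto simp: effective_relations_def quot_module_def A_RCOSETS_def' a_r_coset_def')
  have 2: "\<zero>\<^bsub>effective_relations U Ug F Fg n\<^esub> = D n"
    by (simp add: effective_relations_def quot_module_def)
  have "(\<lambda>t. D n +>\<^bsub>T\<^esub> t) ` K n = {D n} \<longleftrightarrow> (\<forall>t\<in>K n. D n +>\<^bsub>T\<^esub> t = D n)"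
    using zero by blast
  also have "\<dots> \<longleftrightarrow> K n \<subseteq> D n" using q.coset_eq_zero_iff K by blast
  finally show ?thesis unfolding 1 2 .
qed

text \<open>The graph is closed under sums by construction; a scalar is absorbed into the second
  factor, \<open>a (x f) = x (a f)\<close>. The carrier claims belong to the induction because
  distributivity requires them.\<close>

lemma koszul_graph_smult:
  assumes Q: "module R Q" and \<Phi>: "koszul_form n Q \<Phi>" and a: "a \<in> carrier R"
    and vq: "(v, q) \<in> koszul_graph F Q (Ug 1) (Fg (Suc n)) \<Phi>"
  shows "v \<in> carrier F \<and> q \<in> carrier Q \<and>
    (a \<odot>\<^bsub>F\<^esub> v, a \<odot>\<^bsub>Q\<^esub> q) \<in> koszul_graph F Q (Ug 1) (Fg (Suc n)) \<Phi>"
  using vq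
proof induction
  case zero
  interpret Q: module R Q by (rule Q)
  show ?case using a koszul_graph.zero by simp
next
  case (gen x f)
  have b: "bilinear_map R U1 (F\<lparr>carrier := Fg (Suc n)\<rparr>) Q \<Phi>" using \<Phi> by (simp add: koszul_form_def)
  note r = bilinear_map_right[OF b, of x]
  have af: "a \<odot>\<^bsub>F\<^esub> f \<in> Fg (Suc n)" by (rule submodule_smult_closed[OF submodule_Fg a gen(2)])
  have "a \<odot>\<^bsub>F\<^esub> (x \<odot>\<^bsub>F\<^esub> f) = x \<odot>\<^bsub>F\<^esub> (a \<odot>\<^bsub>F\<^esub> f)"
    using a gen U1_carrier Fg_carrier U0_carrier
    by (simp add: R_simps UF.R.m_comm flip: UF.smult_assoc1)
  moreover have "a \<odot>\<^bsub>Q\<^esub> \<Phi> x f = \<Phi> x (a \<odot>\<^bsub>F\<^esub> f)"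
    using linear_map_smult[OF r a, of f] gen by (simp add: part_module_simps)
  moreover have "\<Phi> x f \<in> carrier Q" using linear_map_closed[OF r, of f] gen by (simp add: part_module_simps)
  moreover have "x \<odot>\<^bsub>F\<^esub> f \<in> carrier F" using gen U1_carrier Fg_carrier by simp
  ultimately show ?case using koszul_graph.gen[of x "Ug 1" "a \<odot>\<^bsub>F\<^esub> f" "Fg (Suc n)" F \<Phi> Q] gen(1) af by metis
next
  case (add v q w r)
  interpret Q: module R Q by (rule Q)
  show ?case using add a by (auto simp: FR.smult_r_distr Q.smult_r_distr intro: koszul_graph.add)
qed

text \<open>Every \<open>t\<close> of degree \<open>n + 2\<close> puts the pair of
  \<open>\<gamma> t\<close> and its class modulo \<open>D (n + 2)\<close> into the graph of the
  universal form. If \<open>\<gamma> t\<close> is zero, exactness makes the class zero, which says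
  that \<open>t\<close> is decomposable.\<close>

theorem effective_relations_trivialI:
  fixes n :: nat
  defines "E \<equiv> quot_module T (D (Suc (Suc n)))"
  assumes exact: "\<And>\<Phi> q. koszul_form n E \<Phi> \<Longrightarrow> (\<zero>\<^bsub>F\<^esub>, q) \<in> koszul_graph F E (Ug 1) (Fg (Suc n)) \<Phi> \<Longrightarrow> q = \<zero>\<^bsub>E\<^esub>"
  shows "K (Suc (Suc n)) \<subseteq> D (Suc (Suc n))"
proof -
  let ?D = "D (Suc (Suc n))"
  interpret q: quotient R T ?D
    by (intro quotient.intro quotient_axioms.intro T.module_axioms submodule_D)
  interpret E: module R E unfolding E_def by (rule q.module_quot)
  have lin: "linear_map R T E (\<lambda>t. ?D +>\<^bsub>T\<^esub> t)" unfolding E_def by (rule q.linear_map_coset)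
  have linact: "linear_map R T E (\<lambda>t. ?D +>\<^bsub>T\<^esub> act x t)" if "x \<in> Ug 1" for x
    by (rule linear_map_compose[OF linear_map_act[OF that] lin])
  \<comment> \<open>Lift \<open>f\<close> along \<open>\<gamma>\<close> and let \<open>x\<close> act
    on the lift. Independence of the chosen lift is the next claim.\<close>
  define \<Phi> where "\<Phi> x f = ?D +>\<^bsub>T\<^esub> act x (SOME t. t \<in> Tg (Suc n) \<and> \<gamma> t = f)" for x f
  have \<Phi>_gamma: "\<Phi> x (\<gamma> t) = ?D +>\<^bsub>T\<^esub> act x t" if x: "x \<in> Ug 1" and t: "t \<in> Tg (Suc n)" for x t
  proof -
    define t' where "t' = (SOME t'. t' \<in> Tg (Suc n) \<and> \<gamma> t' = \<gamma> t)"
    have t': "t' \<in> Tg (Suc n)" "\<gamma> t' = \<gamma> t"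
      unfolding t'_def using someI[of "\<lambda>t'. t' \<in> Tg (Suc n) \<and> \<gamma> t' = \<gamma> t" t] t by auto
    note c = Tg_carrier[OF t] Tg_carrier[OF t'(1)]
    \<comment> \<open>Two lifts differ by an element of \<open>K (n + 1)\<close>, which
      \<open>act x\<close> carries into \<open>?D\<close>.\<close>
    have "t' \<ominus>\<^bsub>T\<^esub> t \<in> Tg (Suc n)"
      using T.submoduleE(3,5)[OF submodule_Tg] t t'(1) by (simp add: a_minus_def)
    moreover have "\<gamma> (t' \<ominus>\<^bsub>T\<^esub> t) = \<zero>\<^bsub>F\<^esub>"
      using linear_map_minus[OF T.module_axioms FR.module_axioms linear_map_gamma c(2,1)] t'
        linear_map_closed[OF linear_map_gamma c(1)] by (simp add: a_minus_def UF.M.r_neg)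
    ultimately have "t' \<ominus>\<^bsub>T\<^esub> t \<in> K (Suc n)" by (simp add: gamma_kernel_def)
    then have "act x (t' \<ominus>\<^bsub>T\<^esub> t) \<in> ?D" by (rule act_in_D[OF x])
    moreover have "act x t' = act x (t' \<ominus>\<^bsub>T\<^esub> t) \<oplus>\<^bsub>T\<^esub> act x t"
      using linear_map_add[OF linear_map_act[OF x], of "t' \<ominus>\<^bsub>T\<^esub> t" t] c
      by (simp add: a_minus_def T.M.a_assoc T.M.l_neg)
    ultimately show ?thesis
      unfolding \<Phi>_def t'_def[symmetric] using q.coset_absorb act_closed[OF x c(1)] by simp
  qed
  have form: "koszul_form n E \<Phi>"
    unfolding koszul_form_def
  proof (intro conjI ballI)
    show "bilinear_map R U1 (F\<lparr>carrier := Fg (Suc n)\<rparr>) E \<Phi>"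
    proof (rule bilinear_mapI)
      fix f assume "f \<in> carrier (F\<lparr>carrier := Fg (Suc n)\<rparr>)"
      then obtain t where t: "t \<in> Tg (Suc n)" "\<gamma> t = f" using gamma_Tg_surj by auto
      show "linear_map R U1 E (\<lambda>x. \<Phi> x f)"
      proof (rule linear_map_fun_cong[OF U1.module_axioms])
        show "linear_map R U1 E (\<lambda>x. ?D +>\<^bsub>T\<^esub> act x t)"
          by (rule linear_map_compose[OF linear_map_act_left[OF Tg_carrier[OF t(1)]] lin])
        show "?D +>\<^bsub>T\<^esub> act x t = \<Phi> x f" if "x \<in> carrier U1" for x
          using \<Phi>_gamma[OF _ t(1), of x] that t(2) by (simp add: part_module_simps)
      qed
    next
      fix x assume "x \<in> carrier U1"
      then have x: "x \<in> Ug 1" by (simp add: part_module_simps)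
      show "linear_map R (F\<lparr>carrier := Fg (Suc n)\<rparr>) E (\<Phi> x)"
      proof (rule linear_mapI)
        fix f assume "f \<in> carrier (F\<lparr>carrier := Fg (Suc n)\<rparr>)"
        then obtain t where t: "t \<in> Tg (Suc n)" "\<gamma> t = f" using gamma_Tg_surj by auto
        note tc = Tg_carrier[OF t(1)]
        show "\<Phi> x f \<in> carrier E"
          using \<Phi>_gamma[OF x t(1)] t(2) linear_map_closed[OF linact[OF x] tc] by simp
        show "\<Phi> x (f \<oplus>\<^bsub>F\<lparr>carrier := Fg (Suc n)\<rparr>\<^esub> g) = \<Phi> x f \<oplus>\<^bsub>E\<^esub> \<Phi> x g"
          if "g \<in> carrier (F\<lparr>carrier := Fg (Suc n)\<rparr>)" for g
        proof -
          from that obtain s where s: "s \<in> Tg (Suc n)" "\<gamma> s = g" using gamma_Tg_surj by auto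
          have "\<Phi> x (\<gamma> (t \<oplus>\<^bsub>T\<^esub> s)) = (?D +>\<^bsub>T\<^esub> act x t) \<oplus>\<^bsub>E\<^esub> (?D +>\<^bsub>T\<^esub> act x s)"
            using \<Phi>_gamma[OF x submodule_add_closed[OF submodule_Tg t(1) s(1)]]
              linear_map_add[OF linact[OF x] tc Tg_carrier[OF s(1)]] by simp
          then show ?thesis
            using \<Phi>_gamma[OF x t(1)] \<Phi>_gamma[OF x s(1)] t(2) s(2)
              linear_map_add[OF linear_map_gamma tc Tg_carrier[OF s(1)]] by simp
        qed
        show "\<Phi> x (a \<odot>\<^bsub>F\<lparr>carrier := Fg (Suc n)\<rparr>\<^esub> f) = a \<odot>\<^bsub>E\<^esub> \<Phi> x f" if a: "a \<in> carrier R" for a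
        proof -
          have "\<Phi> x (\<gamma> (a \<odot>\<^bsub>T\<^esub> t)) = a \<odot>\<^bsub>E\<^esub> (?D +>\<^bsub>T\<^esub> act x t)"
            using \<Phi>_gamma[OF x submodule_smult_closed[OF submodule_Tg a t(1)]]
              linear_map_smult[OF linact[OF x] a tc] by simp
          then show ?thesis
            using \<Phi>_gamma[OF x t(1)] t(2) linear_map_smult[OF linear_map_gamma a tc] by simp
        qed
      qed
    qed
    fix x y g assume x: "x \<in> Ug 1" and y: "y \<in> Ug 1" and "g \<in> Fg n"
    then obtain u where u: "u \<in> Tg n" "\<gamma> u = g" using gamma_Tg_surj by blast
    note uc = Tg_carrier[OF u(1)]
    \<comment> \<open>With \<open>u\<close> a lift of \<open>g\<close>, both sides are the class of
      \<open>x y u\<close>.\<close>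
    show "\<Phi> x (y \<odot>\<^bsub>F\<^esub> g) = \<Phi> y (x \<odot>\<^bsub>F\<^esub> g)"
      using \<Phi>_gamma[OF x act_Tg[OF y u(1)]] \<Phi>_gamma[OF y act_Tg[OF x u(1)]] u(2)
        gamma_act[OF y uc] gamma_act[OF x uc] act_commute[OF x y uc] by simp
  qed
  let ?G = "koszul_graph F E (Ug 1) (Fg (Suc n)) \<Phi>"
  have graph: "Tg (Suc (Suc n)) \<subseteq> {t \<in> carrier T. (\<gamma> t, ?D +>\<^bsub>T\<^esub> t) \<in> ?G}"
  proof (rule Tg_subset)
    show "submodule {t \<in> carrier T. (\<gamma> t, ?D +>\<^bsub>T\<^esub> t) \<in> ?G} R T"
    proof (rule T.submoduleI')
      show "\<zero>\<^bsub>T\<^esub> \<in> {t \<in> carrier T. (\<gamma> t, ?D +>\<^bsub>T\<^esub> t) \<in> ?G}"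
        using linear_map_zero[OF T.module_axioms FR.module_axioms linear_map_gamma]
          linear_map_zero[OF T.module_axioms E.module_axioms lin] koszul_graph.zero[of F E] by simp
      fix s t assume s: "s \<in> {t \<in> carrier T. (\<gamma> t, ?D +>\<^bsub>T\<^esub> t) \<in> ?G}"
        and t: "t \<in> {t \<in> carrier T. (\<gamma> t, ?D +>\<^bsub>T\<^esub> t) \<in> ?G}"
      show "s \<oplus>\<^bsub>T\<^esub> t \<in> {t \<in> carrier T. (\<gamma> t, ?D +>\<^bsub>T\<^esub> t) \<in> ?G}"
        using s t by (auto simp: linear_map_add[OF linear_map_gamma] linear_map_add[OF lin] intro: koszul_graph.add)
    next
      fix a t assume a: "a \<in> carrier R" and t: "t \<in> {t \<in> carrier T. (\<gamma> t, ?D +>\<^bsub>T\<^esub> t) \<in> ?G}"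
      then show "a \<odot>\<^bsub>T\<^esub> t \<in> {t \<in> carrier T. (\<gamma> t, ?D +>\<^bsub>T\<^esub> t) \<in> ?G}"
        using koszul_graph_smult[OF E.module_axioms form a]
        by (simp add: linear_map_smult[OF linear_map_gamma] linear_map_smult[OF lin])
    qed blast
    fix m f assume m: "set_mset m \<subseteq> Ug 1" "size m = Suc (Suc n)" and f: "f \<in> Fg 0"
    \<comment> \<open>The degree is positive, so a variable splits off and leaves a monomial of
      degree \<open>n + 1\<close>, on which the form is defined through
      \<open>\<gamma>\<close>.\<close>
    from m(2) obtain x m' where "m = add_mset x m'" by (auto dest!: size_eq_Suc_imp_eq_union)
    with m(2) have m': "m = add_mset x m'" "size m' = Suc n" by simp_all
    let ?t = "pure (sym.cls (free_gen R m')) f"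
    have x: "x \<in> Ug 1" "set_mset m' \<subseteq> Ug 1" using m m' by auto
    have t: "?t \<in> Tg (Suc n)" using Tg_pure[OF cls_mono_Sg[OF x(2)] f] m' by simp
    note tc = Tg_carrier[OF t]
    have "(x \<odot>\<^bsub>F\<^esub> \<gamma> ?t, \<Phi> x (\<gamma> ?t)) \<in> ?G" by (rule koszul_graph.gen[OF x(1) gamma_Tg[OF t]])
    then have "(\<gamma> (act x ?t), ?D +>\<^bsub>T\<^esub> act x ?t) \<in> ?G"
      using gamma_act[OF x(1) tc] \<Phi>_gamma[OF x(1) t] by simp
    with act_closed[OF x(1) tc]
    show "pure (sym.cls (free_gen R m)) f \<in> {t \<in> carrier T. (\<gamma> t, ?D +>\<^bsub>T\<^esub> t) \<in> ?G}"
      using act_pure_mono[OF x f] m'(1) by simp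
  qed
  show ?thesis
  proof
    fix t assume t: "t \<in> K (Suc (Suc n))"
    then have tc: "t \<in> carrier T" and "(\<zero>\<^bsub>F\<^esub>, ?D +>\<^bsub>T\<^esub> t) \<in> ?G"
      using graph by (auto simp: gamma_kernel_def)
    from exact[OF form this(2)] have "?D +>\<^bsub>T\<^esub> t = ?D" by (simp add: E_def q.zero_quot)
    then show "t \<in> ?D" using q.coset_eq_zero_iff[OF tc] by blast
  qed
qed

section \<open>Extension of a given Koszul form to a linear map on the tensor product\<close>

context
  fixes n :: nat and Q :: "('u, 'q, 'd) module_scheme" and \<Phi> :: "'u \<Rightarrow> 'f \<Rightarrow> 'q"
  assumes Q: "module R Q" and form: "koszul_form n Q \<Phi>"
begin

interpretation Q: module R Q by (rule Q)

private lemma lin1: "f \<in> Fg (Suc n) \<Longrightarrow> linear_map R U1 Q (\<lambda>x. \<Phi> x f)"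
  using form unfolding koszul_form_def by (auto intro: bilinear_map_left)

private lemma lin2: "x \<in> Ug 1 \<Longrightarrow> linear_map R (F\<lparr>carrier := Fg (Suc n)\<rparr>) Q (\<Phi> x)"
  using form bilinear_map_right unfolding koszul_form_def by (fastforce simp: part_module_simps)

private lemma symm: "x \<in> Ug 1 \<Longrightarrow> y \<in> Ug 1 \<Longrightarrow> g \<in> Fg n \<Longrightarrow> \<Phi> x (y \<odot>\<^bsub>F\<^esub> g) = \<Phi> y (x \<odot>\<^bsub>F\<^esub> g)"
  using form by (simp add: koszul_form_def)

text \<open>The variable split off the monomial is arbitrary: on monomials of degree \<open>n + 2\<close> the symmetry of
  \<open>\<Phi>\<close> makes the value independent of it.\<close>

private definition \<beta> :: "'f \<Rightarrow> 'u multiset \<Rightarrow> 'q" where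
  "\<beta> f m = (if size m = Suc (Suc n)
     then let x = SOME x. x \<in># m in \<Phi> x (mono (m - {#x#}) \<odot>\<^bsub>F\<^esub> f) else \<zero>\<^bsub>Q\<^esub>)"

private lemma \<beta>_add_mset:
  assumes x: "x \<in> Ug 1" and m: "set_mset m \<subseteq> Ug 1" "size m = Suc n" and f: "f \<in> Fg 0"
  shows "\<beta> f (add_mset x m) = \<Phi> x (mono m \<odot>\<^bsub>F\<^esub> f)"
proof -
  define y where "y = (SOME y. y \<in># add_mset x m)"
  have y: "y \<in># add_mset x m" unfolding y_def by (rule someI[of _ x]) simp
  have \<beta>: "\<beta> f (add_mset x m) = \<Phi> y (mono (add_mset x m - {#y#}) \<odot>\<^bsub>F\<^esub> f)"
    unfolding \<beta>_def Let_def y_def[symmetric] using m by simp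
  show ?thesis
  proof (cases "y = x")
    case True
    then show ?thesis using \<beta> by simp
  next
    case False
    \<comment> \<open>As \<open>y\<close> differs from \<open>x\<close>, it occurs in
      \<open>m\<close>. The monomial is then \<open>x y k\<close>, and the symmetry of
      \<open>\<Phi>\<close> is applied with \<open>g = mono k f\<close>, of degree
      \<open>n\<close>.\<close>
    with y obtain k where k: "m = add_mset y k" by (auto dest: multi_member_split)
    have k': "set_mset k \<subseteq> Ug 1" "size k = n" "y \<in> Ug 1" using k m by auto
    have kU: "set_mset k \<subseteq> carrier U" using k' U1_subset by blast
    have g: "mono k \<odot>\<^bsub>F\<^esub> f \<in> Fg n" using mono_smult_Fg[OF k'(1) f] k' by simp
    have mk: "mono (add_mset z k) \<odot>\<^bsub>F\<^esub> f = z \<odot>\<^bsub>F\<^esub> (mono k \<odot>\<^bsub>F\<^esub> f)" if "z \<in> Ug 1" for z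
      using that kU U1_carrier Fg_carrier[OF f] by (simp add: mono_add_mset mono_closed UF.smult_assoc1)
    have "add_mset x m - {#y#} = add_mset x k" using k by simp
    then show ?thesis using \<beta> symm[OF x k'(3) g] k by (simp add: mk x k'(3))
  qed
qed

text \<open>The default value makes \<open>\<beta> f\<close> a function on all monomials, as
  required for an extension to the whole symmetric algebra and not just to one degree.\<close>

private lemma \<beta>_other: "size m \<noteq> Suc (Suc n) \<Longrightarrow> \<beta> f m = \<zero>\<^bsub>Q\<^esub>"
  by (simp add: \<beta>_def)

private lemma \<beta>_cases:
  assumes "set_mset m \<subseteq> Ug 1"
  obtains "size m \<noteq> Suc (Suc n)"
  | x k where "m = add_mset x k" "x \<in> Ug 1" "set_mset k \<subseteq> Ug 1" "size k = Suc n"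
proof (cases "size m = Suc (Suc n)")
  case True
  then obtain x k where "m = add_mset x k" by (auto dest!: size_eq_Suc_imp_eq_union)
  with True assms show ?thesis using that(2) by simp
qed (rule that(1))

private lemma mono_smult_Suc: "set_mset k \<subseteq> Ug 1 \<Longrightarrow> size k = Suc n \<Longrightarrow> f \<in> Fg 0 \<Longrightarrow> mono k \<odot>\<^bsub>F\<^esub> f \<in> Fg (Suc n)"
  using mono_smult_Fg[of k f 0] by simp

private lemma \<beta>_linear:
  assumes "set_mset m \<subseteq> Ug 1" shows "linear_map R F0 Q (\<lambda>f. \<beta> f m)"
  using assms
proof (cases rule: \<beta>_cases)
  case 1
  then show ?thesis using linear_map_pointwise_zero[OF Q] by (simp add: \<beta>_other)
next
  case (2 x k)
  have k: "mono k \<in> carrier U" using 2 U1_subset by (intro mono_closed) auto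
  have "linear_map R F0 (F\<lparr>carrier := Fg (Suc n)\<rparr>) (\<lambda>f. mono k \<odot>\<^bsub>F\<^esub> f)"
  proof (rule linear_mapI)
    show "mono k \<odot>\<^bsub>F\<^esub> f \<in> carrier (F\<lparr>carrier := Fg (Suc n)\<rparr>)" if "f \<in> carrier F0" for f
      using mono_smult_Suc 2 that by simp
  qed (use k Fg_carrier U0_carrier in \<open>auto simp: UF.smult_r_distr R_simps UF.R.m_comm simp flip: UF.smult_assoc1\<close>)
  from linear_map_compose[OF this lin2[OF 2(2)]]
  show ?thesis by (rule linear_map_fun_cong[OF F0.module_axioms]) (use 2 in \<open>simp add: \<beta>_add_mset\<close>)
qed

private lemma \<beta>_closed: "f \<in> Fg 0 \<Longrightarrow> \<beta> f \<in> monomials (carrier U1) \<rightarrow> carrier Q"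
  using linear_map_closed[OF \<beta>_linear] by (auto simp: part_module_simps)

text \<open>Linear in the polynomial for a fixed \<open>f\<close>. Descending to the symmetric
  algebra gives \<open>\<psi>S\<close>, and descending to the tensor product gives
  \<open>\<Psi>\<close>.\<close>

private definition \<psi> where "\<psi> f = free_ext R Q (\<beta> f)"

private lemma \<psi>_gen: "f \<in> Fg 0 \<Longrightarrow> set_mset m \<subseteq> Ug 1 \<Longrightarrow> \<psi> f (free_gen R m) = \<beta> f m"
  unfolding \<psi>_def by (rule free_ext_free_gen[OF Q \<beta>_closed]) (simp_all add: part_module_simps)

private lemma \<psi>_linear: "f \<in> Fg 0 \<Longrightarrow> linear_map R sym.F Q (\<psi> f)"
  unfolding \<psi>_def by (rule linear_map_free_ext[OF Q \<beta>_closed])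

text \<open>The hypothesis of the lifting criterion. Since the variable split off by
  \<open>\<beta>\<close> is arbitrary, it can be taken to be \<open>x\<close>, and
  \<open>\<Phi>\<close> is linear there; in other degrees the value is constantly zero.\<close>

private lemma \<psi>_var_linear:
  assumes f: "f \<in> Fg 0" and m: "set_mset m \<subseteq> carrier U1"
  shows "linear_map R U1 Q (\<lambda>x. \<psi> f (free_gen R (add_mset x m)))"
proof (rule linear_map_fun_cong[OF U1.module_axioms])
  have m': "set_mset m \<subseteq> Ug 1" using m by (simp add: part_module_simps)
  let ?h = "\<lambda>x. if size m = Suc n then \<Phi> x (mono m \<odot>\<^bsub>F\<^esub> f) else \<zero>\<^bsub>Q\<^esub>"
  show "linear_map R U1 Q ?h"
    using lin1[OF mono_smult_Suc[OF m' _ f]] linear_map_pointwise_zero[OF Q]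
    by (cases "size m = Suc n") simp_all
  show "?h x = \<psi> f (free_gen R (add_mset x m))" if "x \<in> carrier U1" for x
    using that m' f by (simp add: \<psi>_gen part_module_simps \<beta>_add_mset \<beta>_other)
qed

private definition \<psi>S where "\<psi>S s f = the_elem (\<psi> f ` s)"

private lemma \<psi>S_cls: "f \<in> Fg 0 \<Longrightarrow> p \<in> carrier sym.F \<Longrightarrow> \<psi>S (sym.cls p) f = \<psi> f p"
  unfolding \<psi>S_def by (rule sym.sym_lift_cls[OF Q \<psi>_linear \<psi>_var_linear])

text \<open>\<open>\<psi> f\<close> is built for one \<open>f\<close> at a time, so linearity in
  \<open>f\<close> has to be recovered from \<open>\<beta>_linear\<close> by induction on the
  polynomial.\<close>

private lemma \<psi>_linear_right: "p \<in> carrier sym.F \<Longrightarrow> linear_map R F0 Q (\<lambda>f. \<psi> f p)"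
proof (induction rule: FR.free_module_induct)
  case zero
  show ?case
    by (rule linear_map_fun_cong[OF F0.module_axioms linear_map_pointwise_zero[OF Q]])
       (use linear_map_zero[OF sym.F.module_axioms Q \<psi>_linear] in simp)
next
  case (add p q)
  show ?case
    by (rule linear_map_fun_cong[OF F0.module_axioms linear_map_pointwise_add[OF Q add(3,4)]])
       (use linear_map_add[OF \<psi>_linear add(1,2)] in simp)
next
  case (gen a m)
  then have m: "set_mset m \<subseteq> Ug 1" by (simp add: part_module_simps)
  show ?case
    by (rule linear_map_fun_cong[OF F0.module_axioms linear_map_pointwise_smult[OF Q \<beta>_linear[OF m] gen(1)]])
       (use linear_map_smult[OF \<psi>_linear gen(1) mono_gen_closed[OF m]] \<psi>_gen[OF _ m] in simp)
qed

private lemma \<psi>S_bilinear: "bilinear_map R S F0 Q \<psi>S"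
proof (rule bilinear_mapI)
  show "linear_map R S Q (\<lambda>s. \<psi>S s f)" if "f \<in> carrier F0" for f
    unfolding \<psi>S_def using that by (intro sym.linear_map_sym_lift[OF Q \<psi>_linear \<psi>_var_linear]) simp_all
  show "linear_map R F0 Q (\<psi>S s)" if "s \<in> carrier S" for s
  proof -
    from that obtain p where p: "p \<in> carrier sym.F" "s = sym.cls p" by (rule sym.S_carrierE)
    show ?thesis
      by (rule linear_map_fun_cong[OF F0.module_axioms \<psi>_linear_right[OF p(1)]]) (use p in \<open>simp add: \<psi>S_cls\<close>)
  qed
qed

private definition \<Psi> where "\<Psi> = tensor_lift R Q \<psi>S"

private lemma \<Psi>_linear: "linear_map R T Q \<Psi>"
  unfolding \<Psi>_def T_eq by (rule ten.linear_map_tensor_lift[OF Q \<psi>S_bilinear])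

private lemma \<Psi>_mono:
  assumes "set_mset m \<subseteq> Ug 1" "f \<in> Fg 0"
  shows "\<Psi> (pure (sym.cls (free_gen R m)) f) = \<beta> f m"
  using assms ten.tensor_lift_pure[OF Q \<psi>S_bilinear cls_mono_closed[OF assms(1)], of f]
  by (simp add: \<Psi>_def \<psi>S_cls mono_gen_closed \<psi>_gen)

text \<open>On monomials this is \<open>\<beta>_add_mset\<close>, and both sides are linear in
  \<open>t\<close>. In particular \<open>\<Psi>\<close> kills \<open>act x t\<close> whenever
  \<open>\<gamma> t\<close> is zero, hence all decomposable elements.\<close>

private lemma \<Psi>_act:
  assumes x: "x \<in> Ug 1" and t: "t \<in> Tg (Suc n)" shows "\<Psi> (act x t) = \<Phi> x (\<gamma> t)"
proof -
  have lin: "linear_map R T Q (\<lambda>t. \<Psi> (act x t))"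
    by (rule linear_map_compose[OF linear_map_act[OF x] \<Psi>_linear])
  \<comment> \<open>Membership of \<open>\<gamma> t\<close> in \<open>Fg (Suc n)\<close> is carried
    along because linearity of \<open>\<Phi> x\<close> is available on that part only.\<close>
  let ?H = "{t \<in> carrier T. \<gamma> t \<in> Fg (Suc n) \<and> \<Psi> (act x t) = \<Phi> x (\<gamma> t)}"
  have "Tg (Suc n) \<subseteq> ?H"
  proof (rule Tg_subset)
    note g = linear_map_gamma
    have z: "\<Phi> x \<zero>\<^bsub>F\<^esub> = \<zero>\<^bsub>Q\<^esub>"
      using linear_map_zero[OF submodule.submodule_is_module[OF submodule_Fg FR.module_axioms] Q lin2[OF x]] by simp
    show "submodule ?H R T"
    proof (rule T.submoduleI')
      show "\<zero>\<^bsub>T\<^esub> \<in> ?H"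
        using linear_map_zero[OF T.module_axioms FR.module_axioms g] z
          linear_map_zero[OF T.module_axioms Q lin] submodule_zero_closed[OF submodule_Fg] by simp
      show "s \<oplus>\<^bsub>T\<^esub> t \<in> ?H" if "s \<in> ?H" "t \<in> ?H" for s t
        using that linear_map_add[OF lin2[OF x], of "\<gamma> s" "\<gamma> t"] submodule_add_closed[OF submodule_Fg]
        by (simp add: linear_map_add[OF g] linear_map_add[OF lin])
      show "a \<odot>\<^bsub>T\<^esub> t \<in> ?H" if "a \<in> carrier R" "t \<in> ?H" for a t
        using that linear_map_smult[OF lin2[OF x], of a "\<gamma> t"] submodule_smult_closed[OF submodule_Fg]
        by (simp add: linear_map_smult[OF g] linear_map_smult[OF lin])
    qed blast
    fix m f assume m: "set_mset m \<subseteq> Ug 1" "size m = Suc n" and f: "f \<in> Fg 0"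
    have t: "pure (sym.cls (free_gen R m)) f \<in> Tg (Suc n)" using Tg_pure[OF cls_mono_Sg[OF m(1)] f] m by simp
    have "set_mset (add_mset x m) \<subseteq> Ug 1" using x m by simp
    from \<Psi>_mono[OF this f]
    show "pure (sym.cls (free_gen R m)) f \<in> ?H"
      using Tg_carrier[OF t] gamma_Tg[OF t] x m f by (simp add: act_pure_mono \<beta>_add_mset gamma_pure_mono)
  qed
  with t show ?thesis by blast
qed

text \<open>Every pair in the graph is \<open>(\<gamma> t, \<Psi> t)\<close> for some
  \<open>t\<close> of degree \<open>n + 2\<close>. If \<open>\<gamma> t\<close> is zero, then
  \<open>t\<close> lies in \<open>K \<subseteq> D\<close>, where \<open>\<Psi>\<close>
  vanishes.\<close>

theorem koszul_graph_functional:
  assumes triv: "K (Suc (Suc n)) \<subseteq> D (Suc (Suc n))"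
    and q: "(\<zero>\<^bsub>F\<^esub>, q) \<in> koszul_graph F Q (Ug 1) (Fg (Suc n)) \<Phi>"
  shows "q = \<zero>\<^bsub>Q\<^esub>"
proof -
  have "D (Suc (Suc n)) \<subseteq> {t \<in> carrier T. \<Psi> t = \<zero>\<^bsub>Q\<^esub>}"
    unfolding decomposable_kernel_def
  proof (rule span_submodule_minimal[OF submodule_if_linear_vanish[OF T.module_axioms Q \<Psi>_linear]], rule subsetI)
    fix s assume "s \<in> {act x t | x t. x \<in> Ug 1 \<and> t \<in> K (Suc (Suc n) - 1)}"
    then obtain x t where s: "s = act x t" and x: "x \<in> Ug 1" and t: "t \<in> Tg (Suc n)" "\<gamma> t = \<zero>\<^bsub>F\<^esub>"
      by (auto simp: gamma_kernel_def)
    have "\<Phi> x \<zero>\<^bsub>F\<^esub> = \<zero>\<^bsub>Q\<^esub>"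
      using linear_map_zero[OF submodule.submodule_is_module[OF submodule_Fg FR.module_axioms] Q lin2[OF x]] by simp
    then show "s \<in> {t \<in> carrier T. \<Psi> t = \<zero>\<^bsub>Q\<^esub>}"
      using s t \<Psi>_act[OF x t(1)] act_closed[OF x Tg_carrier[OF t(1)]] by simp
  qed
  moreover have "\<exists>t\<in>Tg (Suc (Suc n)). \<gamma> t = v \<and> \<Psi> t = r"
    if "(v, r) \<in> koszul_graph F Q (Ug 1) (Fg (Suc n)) \<Phi>" for v r
    using that
  proof induction
    case zero
    then show ?case
      using submodule_zero_closed[OF submodule_Tg] linear_map_zero[OF T.module_axioms Q \<Psi>_linear]
        linear_map_zero[OF T.module_axioms FR.module_axioms linear_map_gamma] by blast
  next
    case (gen x f)
    then obtain t where "t \<in> Tg (Suc n)" "\<gamma> t = f" using gamma_Tg_surj by blast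
    then show ?case using gen act_Tg \<Psi>_act gamma_act Tg_carrier by metis
  next
    case (add v q w r)
    then show ?case
      using submodule_add_closed[OF submodule_Tg] linear_map_add[OF \<Psi>_linear]
        linear_map_add[OF linear_map_gamma] Tg_carrier by metis
  qed
  ultimately show ?thesis using triv q by (fastforce simp: gamma_kernel_def)
qed

end

end

section \<open>Reductions of standard modules\<close>

context standard_module
begin

lemma module_quot_D: "module R (quot_module T (D n))"
  by (rule quotient.module_quot, intro quotient.intro quotient_axioms.intro T.module_axioms submodule_D)

end

text \<open>In the application \<open>\<iota>\<close> embeds \<open>\<R>(J; I\<^sup>r M)\<close> into \<open>\<R>(I; M)\<close>, raising degrees by \<open>r\<close>.\<close>

locale standard_reduction =
  F: standard_module U Ug F Fg + G: standard_module V Vg G Gg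
  for U :: "('u, 'b) ring_scheme" and Ug and F :: "('u, 'f, 'c) module_scheme" and Fg
    and V :: "('u, 'b) ring_scheme" and Vg and G :: "('u, 'g, 'd) module_scheme" and Gg +
  fixes r :: nat and \<iota> :: "'g \<Rightarrow> 'f"
  assumes base_ring_eq: "base_ring V Vg = base_ring U Ug"
    and add_eq: "add V = add U" and mult_eq: "monoid.mult V = monoid.mult U"
    and V1_subset: "Vg 1 \<subseteq> Ug 1"
    and \<iota>_linear: "linear_map (base_ring U Ug) G F \<iota>"
    and \<iota>_inj: "w \<in> carrier G \<Longrightarrow> \<iota> w = \<zero>\<^bsub>F\<^esub> \<Longrightarrow> w = \<zero>\<^bsub>G\<^esub>"
    and \<iota>_image: "\<iota> ` Gg n = Fg (n + r)"
    and \<iota>_smult: "y \<in> Vg 1 \<Longrightarrow> w \<in> carrier G \<Longrightarrow> \<iota> (y \<odot>\<^bsub>G\<^esub> w) = y \<odot>\<^bsub>F\<^esub> \<iota> w"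
    and Fg_reduction: "r \<le> n \<Longrightarrow>
      Fg (Suc n) \<subseteq> span_submodule (base_ring U Ug) F {y \<odot>\<^bsub>F\<^esub> f | y f. y \<in> Vg 1 \<and> f \<in> Fg n}"
begin

text \<open>\<open>\<iota>\<close> raises degrees by \<open>r\<close>, so the pullback lowers the
  index by \<open>r\<close>; its symmetry is inherited because \<open>\<iota>\<close> commutes with
  the action of \<open>Vg 1\<close>. Equality of the base rings lets both forms take values in the
  same \<open>Q\<close>.\<close>

lemma transfer_koszul_form:
  assumes \<Phi>: "F.koszul_form (n + r) Q \<Phi>"
  shows "G.koszul_form n Q (\<lambda>x w. \<Phi> x (\<iota> w))"
  unfolding G.koszul_form_def
proof (intro conjI ballI)
  have b: "bilinear_map F.R F.U1 (F\<lparr>carrier := Fg (Suc (n + r))\<rparr>) Q \<Phi>"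
    using \<Phi> by (simp add: F.koszul_form_def)
  have \<iota>: "\<iota> w \<in> Fg (Suc (n + r))" if "w \<in> Gg (Suc n)" for w
    using \<iota>_image[of "Suc n"] that by auto
  show "bilinear_map G.R G.U1 (G\<lparr>carrier := Gg (Suc n)\<rparr>) Q (\<lambda>x w. \<Phi> x (\<iota> w))"
    unfolding base_ring_eq
  proof (rule bilinear_mapI)
    fix w assume "w \<in> carrier (G\<lparr>carrier := Gg (Suc n)\<rparr>)"
    then have "linear_map F.R F.U1 Q (\<lambda>x. \<Phi> x (\<iota> w))" using bilinear_map_left[OF b] \<iota> by simp
    then show "linear_map F.R G.U1 Q (\<lambda>x. \<Phi> x (\<iota> w))"
      using V1_subset by (auto simp: linear_map_def part_module_def add_eq mult_eq subset_iff)
  next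
    fix x assume "x \<in> carrier G.U1"
    then have x: "x \<in> Ug 1" using V1_subset by (auto simp: part_module_def)
    have "linear_map F.R (G\<lparr>carrier := Gg (Suc n)\<rparr>) (F\<lparr>carrier := Fg (Suc (n + r))\<rparr>) \<iota>"
      using \<iota> G.Fg_carrier linear_map_add[OF \<iota>_linear] linear_map_smult[OF \<iota>_linear]
      by (intro linear_mapI) auto
    then show "linear_map F.R (G\<lparr>carrier := Gg (Suc n)\<rparr>) Q (\<lambda>w. \<Phi> x (\<iota> w))"
      by (rule linear_map_compose) (rule bilinear_map_right[OF b], use x in \<open>simp add: part_module_def\<close>)
  qed
  fix x y w assume x: "x \<in> Vg 1" and y: "y \<in> Vg 1" and w: "w \<in> Gg n"
  then have "\<iota> w \<in> Fg (n + r)" using \<iota>_image by blast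
  moreover have "x \<in> Ug 1" "y \<in> Ug 1" using x y V1_subset by auto
  ultimately show "\<Phi> x (\<iota> (y \<odot>\<^bsub>G\<^esub> w)) = \<Phi> y (\<iota> (x \<odot>\<^bsub>G\<^esub> w))"
    using \<Phi> x y G.Fg_carrier[OF w] by (simp add: F.koszul_form_def \<iota>_smult)
qed

text \<open>The exchange. For \<open>f = y g\<close> with \<open>y \<in> Vg 1\<close>, the
  generators \<open>x \<otimes> y g\<close> and \<open>y \<otimes> x g\<close> have the same image
  \<open>x y g\<close> in \<open>F\<close> and the same value under \<open>\<Phi>\<close>. The
  second comes from \<open>G\<close>: its first factor is in \<open>Vg 1\<close>, and
  \<open>x g\<close> has degree \<open>n + r + 1\<close>, hence is \<open>\<iota> w\<close> for some
  \<open>w\<close> of degree \<open>n + 1\<close>.\<close>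

lemma transfer_koszul_graph:
  assumes Q: "module F.R Q" and \<Phi>: "F.koszul_form (n + r) Q \<Phi>"
    and vq: "(v, q) \<in> koszul_graph F Q (Ug 1) (Fg (Suc (n + r))) \<Phi>"
  shows "\<exists>w. w \<in> carrier G \<and> \<iota> w = v \<and>
    (w, q) \<in> koszul_graph G Q (Vg 1) (Gg (Suc n)) (\<lambda>x w. \<Phi> x (\<iota> w))"
    (is "\<exists>w. ?P w v q")
proof -
  interpret Q: module F.R Q by (rule Q)
  let ?G = "koszul_graph G Q (Vg 1) (Gg (Suc n)) (\<lambda>x w. \<Phi> x (\<iota> w))"
  have GF: "module F.R G" using G.FR.module_axioms unfolding base_ring_eq .
  have P_zero: "?P \<zero>\<^bsub>G\<^esub> \<zero>\<^bsub>F\<^esub> \<zero>\<^bsub>Q\<^esub>"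
    using koszul_graph.zero linear_map_zero[OF GF F.FR.module_axioms \<iota>_linear] by auto
  have P_add: "?P (w \<oplus>\<^bsub>G\<^esub> w') (v \<oplus>\<^bsub>F\<^esub> v') (q \<oplus>\<^bsub>Q\<^esub> q')" if "?P w v q" "?P w' v' q'" for w w' v v' q q'
    using that by (auto simp: linear_map_add[OF \<iota>_linear] intro: koszul_graph.add)
  have b: "bilinear_map F.R F.U1 (F\<lparr>carrier := Fg (Suc (n + r))\<rparr>) Q \<Phi>"
    using \<Phi> by (simp add: F.koszul_form_def)
  from vq show ?thesis
  proof induction
    case zero
    show ?case using P_zero by blast
  next
    case (add v q w r)
    then show ?case using P_add by blast
  next
    case (gen x f)
    then have x: "x \<in> Ug 1" "x \<in> carrier U" using F.U1_carrier by auto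
    have lin: "linear_map F.R (F\<lparr>carrier := Fg (Suc (n + r))\<rparr>) Q (\<Phi> x)"
      by (rule bilinear_map_right[OF b]) (use x in \<open>simp add: part_module_def\<close>)
    let ?S = "{y \<odot>\<^bsub>F\<^esub> g | y g. y \<in> Vg 1 \<and> g \<in> Fg (n + r)}"
    have "f \<in> span_submodule F.R F ?S" using Fg_reduction[of "n + r"] gen(2) by auto
    moreover have "?S \<subseteq> carrier F" using V1_subset F.U1_carrier F.Fg_carrier by auto
    \<comment> \<open>Membership of \<open>f\<close> in \<open>Fg (Suc (n + r))\<close> is part of
      the induction claim, since linearity of \<open>\<Phi> x\<close> is available on that part
      only.\<close>
    ultimately have "f \<in> Fg (Suc (n + r)) \<and> (\<exists>w. ?P w (x \<odot>\<^bsub>F\<^esub> f) (\<Phi> x f))"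
    proof (induction rule: F.FR.span_submodule_induct)
      case (base f)
      then obtain y g where y: "y \<in> Vg 1" and g: "g \<in> Fg (n + r)" and f: "f = y \<odot>\<^bsub>F\<^esub> g" by blast
      have y': "y \<in> Ug 1" "y \<in> carrier U" using y V1_subset F.U1_carrier by auto
      have "x \<odot>\<^bsub>F\<^esub> g \<in> Fg (Suc n + r)" using F.smult_Fg[OF x(1) g] by simp
      then obtain w where w: "w \<in> Gg (Suc n)" "\<iota> w = x \<odot>\<^bsub>F\<^esub> g" unfolding \<iota>_image[symmetric] by auto
      have "\<Phi> x f = \<Phi> y (\<iota> w)" using \<Phi> x y' g by (simp add: f w(2) F.koszul_form_def)
      moreover have "(y \<odot>\<^bsub>G\<^esub> w, \<Phi> y (\<iota> w)) \<in> ?G" by (rule koszul_graph.gen[OF y w(1)])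
      moreover have "\<iota> (y \<odot>\<^bsub>G\<^esub> w) = x \<odot>\<^bsub>F\<^esub> f"
        using \<iota>_smult[OF y G.Fg_carrier[OF w(1)]] w(2) x y' F.Fg_carrier[OF g]
        by (simp add: f F.UF.R.m_comm flip: F.UF.smult_assoc1)
      moreover have "y \<odot>\<^bsub>G\<^esub> w \<in> carrier G" using G.U1_carrier[OF y] G.Fg_carrier[OF w(1)] by simp
      moreover have "f \<in> Fg (Suc (n + r))" using F.smult_Fg[OF y'(1) g] f by simp
      ultimately show ?case by metis
    next
      case zero
      have "\<Phi> x \<zero>\<^bsub>F\<^esub> = \<zero>\<^bsub>Q\<^esub>"
        using linear_map_zero[OF submodule.submodule_is_module[OF F.submodule_Fg F.FR.module_axioms] Q lin] by simp
      then show ?case using P_zero x submodule_zero_closed[OF F.submodule_Fg] by auto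
    next
      case (add f g)
      then obtain w w' where w: "?P w (x \<odot>\<^bsub>F\<^esub> f) (\<Phi> x f)" "?P w' (x \<odot>\<^bsub>F\<^esub> g) (\<Phi> x g)" by blast
      have "?P (w \<oplus>\<^bsub>G\<^esub> w') (x \<odot>\<^bsub>F\<^esub> f \<oplus>\<^bsub>F\<^esub> x \<odot>\<^bsub>F\<^esub> g) (\<Phi> x f \<oplus>\<^bsub>Q\<^esub> \<Phi> x g)"
        by (rule P_add[OF w])
      moreover have "x \<odot>\<^bsub>F\<^esub> (f \<oplus>\<^bsub>F\<^esub> g) = x \<odot>\<^bsub>F\<^esub> f \<oplus>\<^bsub>F\<^esub> x \<odot>\<^bsub>F\<^esub> g"
        using x add(1,2) by (simp add: F.UF.smult_r_distr)
      moreover have "\<Phi> x (f \<oplus>\<^bsub>F\<^esub> g) = \<Phi> x f \<oplus>\<^bsub>Q\<^esub> \<Phi> x g"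
        using linear_map_add[OF lin, of f g] add by simp
      moreover have "f \<oplus>\<^bsub>F\<^esub> g \<in> Fg (Suc (n + r))" using add submodule_add_closed[OF F.submodule_Fg] by blast
      ultimately show ?case by auto
    next
      case (smult a f)
      then obtain w where w: "?P w (x \<odot>\<^bsub>F\<^esub> f) (\<Phi> x f)" by blast
      have a: "a \<in> carrier U" using smult F.U0_carrier by (simp add: F.R_simps)
      have "(a \<odot>\<^bsub>G\<^esub> w, a \<odot>\<^bsub>Q\<^esub> \<Phi> x f) \<in> ?G"
        using G.koszul_graph_smult[unfolded base_ring_eq, OF Q transfer_koszul_form[OF \<Phi>] smult(1)] w by blast
      moreover have "\<iota> (a \<odot>\<^bsub>G\<^esub> w) = x \<odot>\<^bsub>F\<^esub> (a \<odot>\<^bsub>F\<^esub> f)"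
        using linear_map_smult[OF \<iota>_linear smult(1)] w x a smult(2)
        by (simp add: F.UF.R.m_comm flip: F.UF.smult_assoc1)
      moreover have "\<Phi> x (a \<odot>\<^bsub>F\<^esub> f) = a \<odot>\<^bsub>Q\<^esub> \<Phi> x f"
        using linear_map_smult[OF lin smult(1), of f] smult by simp
      moreover have "a \<odot>\<^bsub>F\<^esub> f \<in> Fg (Suc (n + r))"
        using smult submodule_smult_closed[OF F.submodule_Fg] by blast
      moreover have "a \<odot>\<^bsub>G\<^esub> w \<in> carrier G" by (rule module.smult_closed[OF GF]) (use w smult in auto)
      ultimately show ?case by metis
    qed
    then show ?case by blast
  qed
qed

text \<open>Injectivity of \<open>\<iota>\<close> turns a relation in \<open>F\<close> into a
  relation in \<open>G\<close> with the same value \<open>q\<close>. The target is the quotient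
  attached to \<open>F\<close>, although the criterion is applied to \<open>G\<close>; this uses
  that the target is arbitrary there.\<close>

lemma effective_relations_trivial_transfer:
  assumes "G.K (Suc (Suc n)) \<subseteq> G.D (Suc (Suc n))"
  shows "F.K (Suc (Suc (n + r))) \<subseteq> F.D (Suc (Suc (n + r)))"
proof (rule F.effective_relations_trivialI)
  fix \<Phi> q
  let ?E = "quot_module F.T (F.D (Suc (Suc (n + r))))"
  assume \<Phi>: "F.koszul_form (n + r) ?E \<Phi>"
    and "(\<zero>\<^bsub>F\<^esub>, q) \<in> koszul_graph F ?E (Ug 1) (Fg (Suc (n + r))) \<Phi>"
  from transfer_koszul_graph[OF F.module_quot_D \<Phi> this(2)] \<iota>_inj
  have "(\<zero>\<^bsub>G\<^esub>, q) \<in> koszul_graph G ?E (Vg 1) (Gg (Suc n)) (\<lambda>x w. \<Phi> x (\<iota> w))" by blast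
  then show "q = \<zero>\<^bsub>?E\<^esub>"
    using G.koszul_graph_functional[OF _ transfer_koszul_form[OF \<Phi>] assms] F.module_quot_D
    unfolding base_ring_eq by blast
qed

theorem relation_type_le: "relation_type U Ug F Fg \<le> enat r + relation_type V Vg G Gg"
proof (cases "relation_type V Vg G Gg")
  case (enat s)
  let ?S = "{enat s | s. s \<ge> 1 \<and> (\<forall>n\<ge>s + 1. carrier (effective_relations V Vg G Gg n)
                 = {\<zero>\<^bsub>effective_relations V Vg G Gg n\<^esub>})}"
  have S: "Inf ?S = enat s" using enat by (simp add: relation_type_def)
  \<comment> \<open>The infimum of the empty set is \<open>\<infinity>\<close>, so \<open>?S\<close>
    is nonempty, and its infimum is attained because \<open>enat\<close> is well-ordered.\<close>
  then have "?S \<noteq> {}" by (auto simp: top_enat_def simp del: Collect_empty_eq)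
  then have "Inf ?S \<in> ?S" by (metis (no_types, lifting) Inf_enat_def LeastI ex_in_conv)
  then have s: "s \<ge> 1" "\<And>n. n \<ge> s + 1 \<Longrightarrow> G.K n \<subseteq> G.D n"
    unfolding S by (auto simp: G.effective_relations_trivial_iff)
  have "F.K n \<subseteq> F.D n" if "n \<ge> r + s + 1" for n
  proof -
    \<comment> \<open>As \<open>s \<ge> 1\<close>, the subtraction is not truncated:
      \<open>n = m + r + 2\<close>, and \<open>m + 2 = n - r\<close> is at least
      \<open>s + 1\<close>.\<close>
    define m where "m = n - r - 2"
    have m: "n = Suc (Suc (m + r))" "Suc (Suc m) \<ge> s + 1" using that s(1) by (auto simp: m_def)
    show ?thesis unfolding m(1) by (rule effective_relations_trivial_transfer[OF s(2)[OF m(2)]])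
  qed
  then have "relation_type U Ug F Fg \<le> enat (r + s)"
    unfolding relation_type_def F.effective_relations_trivial_iff
    using s(1) by (intro Inf_lower) auto
  then show ?thesis using enat by simp
qed simp

end

section \<open>Powers of ideals acting on a module\<close>

lemma ideals_set_simps: "\<one>\<^bsub>ideals_set A\<^esub> = carrier A" "monoid.mult (ideals_set A) = ideal_prod A"
  by (simp_all add: ideals_set_def)

lemma ideal_pow_0: "ideal_pow A I 0 = carrier A"
  by (simp add: nat_pow_def ideals_set_def)

lemma ideal_pow_Suc: "ideal_pow A I (Suc n) = ideal_prod A (ideal_pow A I n) I"
  by (simp add: nat_pow_def ideals_set_def)

lemma (in cring) ideal_ideal_pow: "ideal I R \<Longrightarrow> ideal (ideal_pow R I n) R"
  by (induction n) (auto simp: ideals_set_simps oneideal intro: ideal_prod_is_ideal)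

lemma (in cring) ideal_pow_mult:
  assumes I: "ideal I R" and a: "a \<in> ideal_pow R I m" and b: "b \<in> ideal_pow R I n"
  shows "a \<otimes> b \<in> ideal_pow R I (m + n)"
  using b
proof (induction n arbitrary: b)
  case 0
  then show ?case using ideal.I_r_closed[OF ideal_ideal_pow[OF I] a] by (simp add: ideals_set_simps)
next
  case (Suc n)
  have ca: "a \<in> carrier R" using a ideal.Icarr[OF ideal_ideal_pow[OF I]] by blast
  have cp: "i \<in> carrier R" if "i \<in> ideal_prod R (ideal_pow R I n) I" for i
    using that ideal_prod_in_carrier[OF ideal_ideal_pow[OF I] I] by blast
  from Suc.prems[unfolded ideal_pow_Suc]
  have "a \<otimes> b \<in> ideal_prod R (ideal_pow R I (m + n)) I"
  proof (induction rule: ideal_prod.induct)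
    case (prod i j)
    then have "a \<otimes> (i \<otimes> j) = (a \<otimes> i) \<otimes> j"
      using ca ideal.Icarr[OF ideal_ideal_pow[OF I]] ideal.Icarr[OF I] by (simp add: m_assoc)
    then show ?case using ideal_prod.prod[OF Suc.IH[OF prod(1)] prod(2), of R] by simp
  next
    case (sum s1 s2)
    then show ?case using ideal_prod.sum by (simp add: r_distr ca cp)
  qed
  then show ?case by (simp add: ideals_set_simps)
qed

context module
begin

lemma ideal_smult_gens_subset:
  assumes "ideal I R" "N \<subseteq> carrier M"
  shows "{a \<odot>\<^bsub>M\<^esub> x | a x. a \<in> I \<and> x \<in> N} \<subseteq> carrier M"
  using assms ideal.Icarr by fastforce

lemma submodule_ideal_smult:
  "ideal I R \<Longrightarrow> N \<subseteq> carrier M \<Longrightarrow> submodule (ideal_smult R M I N) R M"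
  unfolding ideal_smult_def by (rule submodule_span_submodule[OF ideal_smult_gens_subset])

lemma ideal_smult_base: "a \<in> I \<Longrightarrow> x \<in> N \<Longrightarrow> a \<odot>\<^bsub>M\<^esub> x \<in> ideal_smult R M I N"
  unfolding ideal_smult_def by (rule span_submodule_base) blast

lemma ideal_smult_minimal:
  assumes "submodule H R M" "\<And>a x. a \<in> I \<Longrightarrow> x \<in> N \<Longrightarrow> a \<odot>\<^bsub>M\<^esub> x \<in> H"
  shows "ideal_smult R M I N \<subseteq> H"
  unfolding ideal_smult_def by (rule span_submodule_minimal[OF assms(1)]) (use assms(2) in blast)

lemma ideal_smult_carrier:
  assumes N: "submodule N R M" shows "ideal_smult R M (carrier R) N = N"
proof
  show "ideal_smult R M (carrier R) N \<subseteq> N"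
    by (rule ideal_smult_minimal[OF N]) (rule submodule_smult_closed[OF N])
  show "N \<subseteq> ideal_smult R M (carrier R) N"
    using ideal_smult_base[of \<one> "carrier R" _ N] submodule_subset[OF N] by fastforce
qed

text \<open>In the second inclusion the inner element ranges over a span, whence the inner
  induction; \<open>a (c y) = c (a y)\<close> takes care of scalar multiples.\<close>

lemma ideal_smult_prod:
  assumes I: "ideal I R" and J: "ideal J R" and N: "N \<subseteq> carrier M"
  shows "ideal_smult R M (ideal_prod R I J) N = ideal_smult R M I (ideal_smult R M J N)"
proof
  have IJ: "ideal (ideal_prod R I J) R" by (rule ideal_prod_is_ideal[OF I J])
  note cI = ideal.Icarr[OF I] and cJ = ideal.Icarr[OF J] and cN = subsetD[OF N]
  have JN: "submodule (ideal_smult R M J N) R M" by (rule submodule_ideal_smult[OF J N])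
  have IJN: "submodule (ideal_smult R M I (ideal_smult R M J N)) R M"
    by (rule submodule_ideal_smult[OF I submodule_subset[OF JN]])
  have cIJ: "s \<in> carrier R" if "s \<in> ideal_prod R I J" for s
    using that ideal.Icarr[OF IJ] by blast
  show "ideal_smult R M (ideal_prod R I J) N \<subseteq> ideal_smult R M I (ideal_smult R M J N)"
  proof (rule ideal_smult_minimal[OF IJN])
    fix a x assume a: "a \<in> ideal_prod R I J" and x: "x \<in> N"
    from a show "a \<odot>\<^bsub>M\<^esub> x \<in> ideal_smult R M I (ideal_smult R M J N)"
    proof (induction rule: ideal_prod.induct)
      case (prod i j)
      then show ?case
        using ideal_smult_base[OF prod(1) ideal_smult_base[OF prod(2) x]] cI cJ cN x
        by (simp add: smult_assoc1)
    next
      case (sum s t)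
      then show ?case using submodule_add_closed[OF IJN] cIJ cN x by (simp add: smult_l_distr)
    qed
  qed
  let ?H = "ideal_smult R M (ideal_prod R I J) N"
  have H: "submodule ?H R M" by (rule submodule_ideal_smult[OF IJ N])
  show "ideal_smult R M I (ideal_smult R M J N) \<subseteq> ?H"
  proof (rule ideal_smult_minimal[OF H])
    fix a y assume a: "a \<in> I" and "y \<in> ideal_smult R M J N"
    from this(2)[unfolded ideal_smult_def] ideal_smult_gens_subset[OF J N]
    show "a \<odot>\<^bsub>M\<^esub> y \<in> ?H"
    proof (induction rule: span_submodule_induct)
      case (base y)
      then obtain b x where b: "b \<in> J" "x \<in> N" "y = b \<odot>\<^bsub>M\<^esub> x" by blast
      then have "a \<odot>\<^bsub>M\<^esub> y = (a \<otimes> b) \<odot>\<^bsub>M\<^esub> x" using a cI cJ cN by (simp add: smult_assoc1)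
      then show ?case using ideal_smult_base[OF ideal_prod.prod[OF a b(1)] b(2)] by simp
    next
      case zero
      then show ?case using cI[OF a] submodule_zero_closed[OF H] by simp
    next
      case (add x y)
      then show ?case using cI[OF a] submodule_add_closed[OF H] by (simp add: smult_r_distr)
    next
      case (smult c y)
      then have "a \<odot>\<^bsub>M\<^esub> (c \<odot>\<^bsub>M\<^esub> y) = c \<odot>\<^bsub>M\<^esub> (a \<odot>\<^bsub>M\<^esub> y)"
        using cI[OF a] by (simp add: R.m_comm flip: smult_assoc1)
      then show ?case using submodule_smult_closed[OF H smult(1,3)] by simp
    qed
  qed
qed

lemma ideal_smult_commute:
  assumes "ideal I R" "ideal J R" "N \<subseteq> carrier M"
  shows "ideal_smult R M I (ideal_smult R M J N) = ideal_smult R M J (ideal_smult R M I N)"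
  using ideal_smult_prod[OF assms] ideal_smult_prod[OF assms(2,1,3)] ideal_prod_commute[OF assms(1,2)] by simp

lemma submodule_pow_smult: "ideal I R \<Longrightarrow> submodule (pow_smult R M I n) R M"
  unfolding pow_smult_def by (rule submodule_ideal_smult[OF ideal_ideal_pow]) auto

lemma pow_smult_carrier: "ideal I R \<Longrightarrow> x \<in> pow_smult R M I n \<Longrightarrow> x \<in> carrier M"
  using submodule_subset[OF submodule_pow_smult] by blast

lemma pow_smult_Suc:
  "ideal I R \<Longrightarrow> pow_smult R M I (Suc n) = ideal_smult R M I (pow_smult R M I n)"
  unfolding pow_smult_def ideal_pow_Suc
  using ideal_prod_commute[OF ideal_ideal_pow] ideal_smult_prod[OF _ ideal_ideal_pow] by simp

lemma ideal_pow_smult_pow_smult: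
  assumes I: "ideal I R" and a: "a \<in> ideal_pow R I m" and x: "x \<in> pow_smult R M I n"
  shows "a \<odot>\<^bsub>M\<^esub> x \<in> pow_smult R M I (m + n)"
proof -
  have "a \<odot>\<^bsub>M\<^esub> x \<in> ideal_smult R M (ideal_pow R I m) (ideal_smult R M (ideal_pow R I n) (carrier M))"
    by (rule ideal_smult_base[OF a x[unfolded pow_smult_def]])
  also have "\<dots> = ideal_smult R M (ideal_prod R (ideal_pow R I m) (ideal_pow R I n)) (carrier M)"
    by (rule ideal_smult_prod[OF ideal_ideal_pow[OF I] ideal_ideal_pow[OF I], symmetric]) simp
  also have "\<dots> \<subseteq> pow_smult R M I (m + n)"
  proof (rule ideal_smult_minimal[OF submodule_pow_smult[OF I]])
    fix b x assume b: "b \<in> ideal_prod R (ideal_pow R I m) (ideal_pow R I n)" and x: "x \<in> carrier M"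
    have "b \<in> ideal_pow R I (m + n)"
      using b by induction (auto intro: ideal_pow_mult[OF I]
          additive_subgroup.a_closed[OF ideal.axioms(1)[OF ideal_ideal_pow[OF I]]])
    then show "b \<odot>\<^bsub>M\<^esub> x \<in> pow_smult R M I (m + n)"
      unfolding pow_smult_def using x by (rule ideal_smult_base)
  qed
  finally show ?thesis .
qed

text \<open>Once the equality holds at \<open>r\<close> it persists, because
  \<open>I (J I\<^sup>n M) = J (I I\<^sup>n M)\<close>.\<close>

lemma pow_smult_Suc_reduction:
  assumes I: "ideal I R" and J: "ideal J R" and red: "reduction_at R M J I r" and n: "r \<le> n"
  shows "pow_smult R M I (Suc n) = ideal_smult R M J (pow_smult R M I n)"
  using n
proof (induction rule: dec_induct)
  case base
  then show ?case using red by (simp add: reduction_at_def)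
next
  case (step n)
  then show ?case
    using pow_smult_Suc[OF I] ideal_smult_commute[OF I J submodule_subset[OF submodule_pow_smult[OF I]]]
    by metis
qed

text \<open>The degree \<open>k\<close> part of \<open>\<R>(J; I\<^sup>r M)\<close> is a span formed
  inside the module \<open>I\<^sup>r M\<close>; this allows it to be computed in
  \<open>M\<close>.\<close>

lemma span_submodule_restrict:
  assumes N: "submodule N R M" and S: "S \<subseteq> N"
  shows "span_submodule R (M\<lparr>carrier := N\<rparr>) S = span_submodule R M S"
proof
  interpret N: module R "M\<lparr>carrier := N\<rparr>" by (rule submodule.submodule_is_module[OF N module_axioms])
  have "submodule (span_submodule R M S) R M"
    using S submodule_subset[OF N] by (intro submodule_span_submodule) blast
  then have "submodule (span_submodule R M S) R (M\<lparr>carrier := N\<rparr>)"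
    using span_submodule_minimal[OF N S]
    by (intro N.submoduleI')
      (simp_all add: submodule_zero_closed submodule_add_closed submodule_smult_closed)
  then show "span_submodule R (M\<lparr>carrier := N\<rparr>) S \<subseteq> span_submodule R M S"
    by (rule span_submodule_minimal) (auto intro: span_submodule_base)
  have *: "submodule (span_submodule R (M\<lparr>carrier := N\<rparr>) S) R (M\<lparr>carrier := N\<rparr>)"
    using S by (intro N.submodule_span_submodule) simp
  have "submodule (span_submodule R (M\<lparr>carrier := N\<rparr>) S) R M"
    using submodule_subset[OF *] submodule_subset[OF N] submodule_zero_closed[OF *]
      submodule_add_closed[OF *] submodule_smult_closed[OF *]
    by (intro submoduleI') auto
  then show "span_submodule R M S \<subseteq> span_submodule R (M\<lparr>carrier := N\<rparr>) S"
    by (rule span_submodule_minimal) (auto intro: span_submodule_base)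
qed

text \<open>Identifies degree \<open>k\<close> of \<open>\<R>(J; I\<^sup>r M)\<close> with degree
  \<open>k + r\<close> of \<open>\<R>(I; M)\<close>, each factor \<open>J\<close> raising the power
  of \<open>I\<close> by one.\<close>

lemma pow_smult_reduction:
  assumes I: "ideal I R" and J: "ideal J R" and red: "reduction_at R M J I r"
  shows "pow_smult R (M\<lparr>carrier := pow_smult R M I r\<rparr>) J k = pow_smult R M I (k + r)"
proof -
  let ?N = "pow_smult R M I r"
  have N: "submodule ?N R M" by (rule submodule_pow_smult[OF I])
  have Jk: "ideal (ideal_pow R J k) R" for k by (rule ideal_ideal_pow[OF J])
  have "{a \<odot>\<^bsub>M\<^esub> x | a x. a \<in> ideal_pow R J k \<and> x \<in> ?N} \<subseteq> ?N"
    using submodule_smult_closed[OF N] ideal.Icarr[OF Jk] by blast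
  from span_submodule_restrict[OF N this]
  have "pow_smult R (M\<lparr>carrier := ?N\<rparr>) J k = ideal_smult R M (ideal_pow R J k) ?N"
    by (simp add: pow_smult_def ideal_smult_def)
  also have "\<dots> = pow_smult R M I (k + r)"
  proof (induction k)
    case 0
    then show ?case by (simp add: ideals_set_simps ideal_smult_carrier[OF N])
  next
    case (Suc k)
    have "ideal_smult R M (ideal_pow R J (Suc k)) ?N = ideal_smult R M J (ideal_smult R M (ideal_pow R J k) ?N)"
      unfolding ideal_pow_Suc ideal_prod_commute[OF Jk J]
      by (rule ideal_smult_prod[OF J Jk submodule_subset[OF N]])
    then show ?case using Suc pow_smult_Suc_reduction[OF I J red, of "k + r"] by simp
  qed
  finally show ?thesis .
qed

end

section \<open>Rees algebras and Rees modules\<close>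

text \<open>For infinite \<open>A\<close> the sum is zero by convention, and zero lies in
  \<open>H\<close>.\<close>

lemma (in abelian_monoid) finsum_mem:
  assumes "f \<in> A \<rightarrow> H" "H \<subseteq> carrier G" "\<zero> \<in> H" "\<And>x y. x \<in> H \<Longrightarrow> y \<in> H \<Longrightarrow> x \<oplus> y \<in> H"
  shows "finsum G f A \<in> H"
proof (cases "finite A")
  case True
  then show ?thesis using assms(1)
  proof (induction A rule: finite_induct)
    case (insert a A)
    then have "f \<in> A \<rightarrow> carrier G" "f a \<in> carrier G" using assms(2) by auto
    with insert assms(4) show ?case by simp
  qed (simp add: assms(3))
qed (simp add: assms(3))

lemma UP_carrier: "carrier (UP R) = up R"
  by (simp add: UP_def)

lemma UP_zero: "\<zero>\<^bsub>UP R\<^esub> = (\<lambda>_. \<zero>\<^bsub>R\<^esub>)"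
  by (simp add: UP_def)

lemma UP_one: "\<one>\<^bsub>UP R\<^esub> = (\<lambda>i. if i = 0 then \<one>\<^bsub>R\<^esub> else \<zero>\<^bsub>R\<^esub>)"
  by (simp add: UP_def)

lemma UP_add: "p \<in> up R \<Longrightarrow> q \<in> up R \<Longrightarrow> p \<oplus>\<^bsub>UP R\<^esub> q = (\<lambda>n. p n \<oplus>\<^bsub>R\<^esub> q n)"
  by (simp add: UP_def)

lemma UP_mult:
  "p \<in> up R \<Longrightarrow> q \<in> up R \<Longrightarrow> p \<otimes>\<^bsub>UP R\<^esub> q = (\<lambda>n. \<Oplus>\<^bsub>R\<^esub>i\<in>{..n}. p i \<otimes>\<^bsub>R\<^esub> q (n - i))"
  by (simp add: UP_def)

lemma (in ring) UP_uminus: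
  assumes p: "p \<in> up R" shows "\<ominus>\<^bsub>UP R\<^esub> p = (\<lambda>n. \<ominus> p n)"
proof
  fix n
  note UP = UP_ring.intro[OF ring_axioms]
  have coeff: "up_ring.coeff (UP R) q n = q n" if "q \<in> up R" for q
    using that by (simp add: UP_def)
  have "\<ominus>\<^bsub>UP R\<^esub> p \<in> up R"
    using abelian_group.a_inv_closed[OF ring.axioms(1)[OF UP_ring.UP_ring[OF UP]], unfolded UP_carrier, OF p] .
  with UP_ring.coeff_a_inv[OF UP, unfolded UP_carrier, OF p, of n]
  show "(\<ominus>\<^bsub>UP R\<^esub> p) n = \<ominus> p n" using p by (simp only: coeff)
qed

locale rees = module R M for R :: "('a, 'b) ring_scheme" (structure) and M :: "('a, 'm, 'c) module_scheme" (structure) +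
  fixes I
  assumes I: "ideal I R"
begin

abbreviation U where "U \<equiv> rees_algebra R I"
abbreviation Ug where "Ug \<equiv> rees_algebra_part R I"
abbreviation F where "F \<equiv> rees_module R I M"
abbreviation Fg where "Fg \<equiv> rees_module_part R I M"
abbreviation Ip where "Ip \<equiv> ideal_pow R I"
abbreviation IM where "IM \<equiv> pow_smult R M I"

lemma UP_cring: "UP_cring R"
  by (rule UP_cring.intro[OF is_cring])

sublocale UPR: cring "UP R"
  by (rule UP_cring.UP_cring[OF UP_cring])

lemma Ip_carrier: "a \<in> Ip n \<Longrightarrow> a \<in> carrier R"
  by (rule ideal.Icarr[OF ideal_ideal_pow[OF I]])

lemma Ip_zero: "\<zero> \<in> Ip n"
  by (rule additive_subgroup.zero_closed[OF ideal.axioms(1)[OF ideal_ideal_pow[OF I]]])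

lemma Ip_add: "a \<in> Ip n \<Longrightarrow> b \<in> Ip n \<Longrightarrow> a \<oplus> b \<in> Ip n"
  by (rule additive_subgroup.a_closed[OF ideal.axioms(1)[OF ideal_ideal_pow[OF I]]])

lemma Ip_1: "Ip (Suc 0) = I"
  using ideal_prod_commute[OF oneideal I] ideal_prod_one[OF I] by (simp add: ideals_set_simps)

lemmas IM_zero = submodule_zero_closed[OF submodule_pow_smult[OF I]]
lemmas IM_add = submodule_add_closed[OF submodule_pow_smult[OF I]]
lemmas IM_carrier = pow_smult_carrier[OF I]

lemma mem_U: "p \<in> carrier U \<longleftrightarrow> p \<in> up R \<and> (\<forall>n. p n \<in> Ip n)"
  by (simp add: rees_algebra_def)

lemma mem_F: "f \<in> carrier F \<longleftrightarrow> (\<forall>n. f n \<in> IM n) \<and> finite {n. f n \<noteq> \<zero>\<^bsub>M\<^esub>}"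
  by (simp add: rees_module_def)

lemma U_simps:
  "\<zero>\<^bsub>U\<^esub> = (\<lambda>_. \<zero>)" "\<one>\<^bsub>U\<^esub> = (\<lambda>i. if i = 0 then \<one> else \<zero>)"
  "add U = add (UP R)" "monoid.mult U = monoid.mult (UP R)"
  by (simp_all add: rees_algebra_def UP_zero UP_one)

lemma U_coeff: "p \<in> carrier U \<Longrightarrow> p i \<in> carrier R"
  using Ip_carrier mem_U by blast

lemma F_coeff: "f \<in> carrier F \<Longrightarrow> f i \<in> carrier M"
  using IM_carrier mem_F by blast

lemma F_simps:
  "\<zero>\<^bsub>F\<^esub> = (\<lambda>_. \<zero>\<^bsub>M\<^esub>)" "f \<oplus>\<^bsub>F\<^esub> g = (\<lambda>n. f n \<oplus>\<^bsub>M\<^esub> g n)"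
  "p \<odot>\<^bsub>F\<^esub> f = (\<lambda>n. \<Oplus>\<^bsub>M\<^esub>i\<in>{..n}. p i \<odot>\<^bsub>M\<^esub> f (n - i))"
  by (simp_all add: rees_module_def)

lemma up_finite_support:
  assumes "p \<in> up R" shows "finite {n. p n \<noteq> \<zero>}"
proof -
  from assms obtain k where "bound \<zero> k p" by (auto simp: up_def)
  then have "{n. p n \<noteq> \<zero>} \<subseteq> {..k}" by (auto simp: bound_def not_less[symmetric])
  then show ?thesis by (rule finite_subset) simp
qed

lemma subcring_U: "subcring (carrier U) (UP R)"
proof (rule UPR.subcringI', rule UPR.subringI)
  show "carrier U \<subseteq> carrier (UP R)" by (auto simp: mem_U UP_carrier)
  show "\<one>\<^bsub>UP R\<^esub> \<in> carrier U"
    using UPR.one_closed Ip_zero by (simp add: mem_U UP_carrier UP_one ideals_set_simps)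
  fix p assume p: "p \<in> carrier U"
  then have pu: "p \<in> up R" by (simp add: mem_U)
  have "\<ominus>\<^bsub>UP R\<^esub> p \<in> up R" using UPR.a_inv_closed[of p] pu by (simp add: UP_carrier)
  moreover have "\<ominus> p n \<in> Ip n" for n
    using p additive_subgroup.a_inv_closed[OF ideal.axioms(1)[OF ideal_ideal_pow[OF I]]] by (simp add: mem_U)
  ultimately show "\<ominus>\<^bsub>UP R\<^esub> p \<in> carrier U" using UP_uminus[OF pu] by (simp add: mem_U)
  fix q assume q: "q \<in> carrier U"
  then have qu: "q \<in> up R" by (simp add: mem_U)
  show "p \<oplus>\<^bsub>UP R\<^esub> q \<in> carrier U"
    using UPR.add.m_closed[of p q] p q pu qu by (simp add: mem_U UP_add UP_carrier Ip_add)
  have "p i \<otimes> q (n - i) \<in> Ip n" if "i \<le> n" for i n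
    using ideal_pow_mult[OF I, of "p i" i "q (n - i)" "n - i"] p q that by (simp add: mem_U)
  then have "(\<Oplus>i\<in>{..n}. p i \<otimes> q (n - i)) \<in> Ip n" for n
    by (intro R.finsum_mem) (auto intro: Ip_carrier Ip_zero Ip_add)
  then show "p \<otimes>\<^bsub>UP R\<^esub> q \<in> carrier U"
    using UPR.m_closed[of p q] pu qu by (simp add: mem_U UP_mult UP_carrier)
qed

sublocale U: cring U
  using UPR.subcring_iff[of "carrier U"] subcring_U subringE(1)[OF subcring.axioms(1)[OF subcring_U]]
  by (simp add: rees_algebra_def)

lemma F_smult_closed:
  assumes p: "p \<in> carrier U" and f: "f \<in> carrier F" shows "p \<odot>\<^bsub>F\<^esub> f \<in> carrier F"
proof -
  have c: "p i \<in> carrier R" "f i \<in> carrier M" for i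
    using U_coeff[OF p] F_coeff[OF f] by blast+
  have "p i \<odot>\<^bsub>M\<^esub> f (n - i) \<in> IM n" if "i \<le> n" for i n
    using ideal_pow_smult_pow_smult[OF I, of "p i" i "f (n - i)" "n - i"] p f that by (simp add: mem_U mem_F)
  then have "(\<Oplus>\<^bsub>M\<^esub>i\<in>{..n}. p i \<odot>\<^bsub>M\<^esub> f (n - i)) \<in> IM n" for n
    by (intro M.finsum_mem) (auto intro: IM_carrier IM_zero IM_add)
  moreover have "{n. (p \<odot>\<^bsub>F\<^esub> f) n \<noteq> \<zero>\<^bsub>M\<^esub>} \<subseteq> (\<lambda>(i, j). i + j) ` ({n. p n \<noteq> \<zero>} \<times> {n. f n \<noteq> \<zero>\<^bsub>M\<^esub>})"
  proof
    fix n assume n: "n \<in> {n. (p \<odot>\<^bsub>F\<^esub> f) n \<noteq> \<zero>\<^bsub>M\<^esub>}"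
    have "\<exists>i\<le>n. p i \<odot>\<^bsub>M\<^esub> f (n - i) \<noteq> \<zero>\<^bsub>M\<^esub>"
    proof (rule ccontr)
      assume "\<not> ?thesis"
      then have "(p \<odot>\<^bsub>F\<^esub> f) n = \<zero>\<^bsub>M\<^esub>" unfolding F_simps by (intro M.add.finprod_one_eqI) auto
      with n show False by simp
    qed
    then obtain i where i: "i \<le> n" "p i \<odot>\<^bsub>M\<^esub> f (n - i) \<noteq> \<zero>\<^bsub>M\<^esub>" by blast
    then have "p i \<noteq> \<zero>" "f (n - i) \<noteq> \<zero>\<^bsub>M\<^esub>" using c by auto
    then show "n \<in> (\<lambda>(i, j). i + j) ` ({n. p n \<noteq> \<zero>} \<times> {n. f n \<noteq> \<zero>\<^bsub>M\<^esub>})"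
      using i(1) by (intro image_eqI[of _ _ "(i, n - i)"]) auto
  qed
  then have "finite {n. (p \<odot>\<^bsub>F\<^esub> f) n \<noteq> \<zero>\<^bsub>M\<^esub>}"
    by (rule finite_subset) (use p f up_finite_support in \<open>simp add: mem_U mem_F\<close>)
  ultimately show ?thesis by (simp add: mem_F F_simps)
qed

lemma abelian_group_F: "abelian_group F"
proof (rule abelian_groupI)
  fix f assume f: "f \<in> carrier F"
  have c: "f n \<in> carrier M" for n by (rule F_coeff[OF f])
  show "\<zero>\<^bsub>F\<^esub> \<oplus>\<^bsub>F\<^esub> f = f" using c by (simp add: F_simps)
  have "{n. \<ominus>\<^bsub>M\<^esub> f n \<noteq> \<zero>\<^bsub>M\<^esub>} \<subseteq> {n. f n \<noteq> \<zero>\<^bsub>M\<^esub>}" by auto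
  then have "(\<lambda>n. \<ominus>\<^bsub>M\<^esub> f n) \<in> carrier F"
    using f submoduleE(3)[OF submodule_pow_smult[OF I]] by (auto simp: mem_F intro: finite_subset)
  moreover have "(\<lambda>n. \<ominus>\<^bsub>M\<^esub> f n) \<oplus>\<^bsub>F\<^esub> f = \<zero>\<^bsub>F\<^esub>" using c by (simp add: F_simps M.l_neg)
  ultimately show "\<exists>g\<in>carrier F. g \<oplus>\<^bsub>F\<^esub> f = \<zero>\<^bsub>F\<^esub>" by blast
  fix g assume g: "g \<in> carrier F"
  have cg: "g n \<in> carrier M" for n by (rule F_coeff[OF g])
  have "{n. f n \<oplus>\<^bsub>M\<^esub> g n \<noteq> \<zero>\<^bsub>M\<^esub>} \<subseteq> {n. f n \<noteq> \<zero>\<^bsub>M\<^esub>} \<union> {n. g n \<noteq> \<zero>\<^bsub>M\<^esub>}" by auto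
  then have "finite {n. f n \<oplus>\<^bsub>M\<^esub> g n \<noteq> \<zero>\<^bsub>M\<^esub>}"
    by (rule finite_subset) (use f g in \<open>simp add: mem_F\<close>)
  then show "f \<oplus>\<^bsub>F\<^esub> g \<in> carrier F" using f g IM_add by (simp add: mem_F F_simps)
  show "f \<oplus>\<^bsub>F\<^esub> g = g \<oplus>\<^bsub>F\<^esub> f" using c cg by (simp add: F_simps M.a_comm)
  fix h assume h: "h \<in> carrier F"
  have "h n \<in> carrier M" for n by (rule F_coeff[OF h])
  then show "(f \<oplus>\<^bsub>F\<^esub> g) \<oplus>\<^bsub>F\<^esub> h = f \<oplus>\<^bsub>F\<^esub> (g \<oplus>\<^bsub>F\<^esub> h)" using c cg by (simp add: F_simps M.a_assoc)
qed (simp add: mem_F F_simps IM_zero)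

text \<open>For \<open>k = n\<close> this is the \<open>n\<close>-th coefficient of the
  associativity law of the action. Separating \<open>k\<close> from \<open>n\<close> allows
  induction on the outer bound while the index of the coefficient stays fixed.\<close>

lemma convolution_smult_assoc:
  fixes a b :: "nat \<Rightarrow> 'a" and c :: "nat \<Rightarrow> 'm"
  assumes "a \<in> UNIV \<rightarrow> carrier R" "b \<in> UNIV \<rightarrow> carrier R" "c \<in> UNIV \<rightarrow> carrier M" "k \<le> n"
  shows "(\<Oplus>\<^bsub>M\<^esub>j\<in>{..k}. (\<Oplus>i\<in>{..j}. a i \<otimes> b (j - i)) \<odot>\<^bsub>M\<^esub> c (n - j)) =
    (\<Oplus>\<^bsub>M\<^esub>j\<in>{..k}. a j \<odot>\<^bsub>M\<^esub> (\<Oplus>\<^bsub>M\<^esub>i\<in>{..k - j}. b i \<odot>\<^bsub>M\<^esub> c (n - j - i)))"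
  using assms(4)
proof (induction k)
  case 0
  then show ?case using assms by (simp add: Pi_def smult_assoc1)
next
  case (Suc k)
  have ca: "a i \<in> carrier R" "b i \<in> carrier R" "c i \<in> carrier M" for i using assms by auto
  have ldistr: "(\<Oplus>i\<in>A. f i) \<odot>\<^bsub>M\<^esub> x = (\<Oplus>\<^bsub>M\<^esub>i\<in>A. f i \<odot>\<^bsub>M\<^esub> x)"
    if "finite A" "f \<in> A \<rightarrow> carrier R" "x \<in> carrier M" for A :: "nat set" and f x
    using that by (induction A rule: finite_induct) (simp_all add: Pi_def smult_l_distr)
  \<comment> \<open>The terms that are new when the bound grows to \<open>k + 1\<close>: those with
    index \<open>n - (k + 1)\<close> in \<open>c\<close>.\<close>
  let ?t = "\<lambda>j. a j \<odot>\<^bsub>M\<^esub> (b (Suc k - j) \<odot>\<^bsub>M\<^esub> c (n - Suc k))"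
  have t: "?t j \<in> carrier M" for j using ca by simp
  have "(\<Oplus>\<^bsub>M\<^esub>j\<in>{..Suc k}. a j \<odot>\<^bsub>M\<^esub> (\<Oplus>\<^bsub>M\<^esub>i\<in>{..Suc k - j}. b i \<odot>\<^bsub>M\<^esub> c (n - j - i)))
      = ?t (Suc k) \<oplus>\<^bsub>M\<^esub> (\<Oplus>\<^bsub>M\<^esub>j\<in>{..k}. a j \<odot>\<^bsub>M\<^esub> (\<Oplus>\<^bsub>M\<^esub>i\<in>{..Suc k - j}. b i \<odot>\<^bsub>M\<^esub> c (n - j - i)))"
    using ca by simp
  also have "(\<Oplus>\<^bsub>M\<^esub>j\<in>{..k}. a j \<odot>\<^bsub>M\<^esub> (\<Oplus>\<^bsub>M\<^esub>i\<in>{..Suc k - j}. b i \<odot>\<^bsub>M\<^esub> c (n - j - i)))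
      = (\<Oplus>\<^bsub>M\<^esub>j\<in>{..k}. ?t j \<oplus>\<^bsub>M\<^esub> a j \<odot>\<^bsub>M\<^esub> (\<Oplus>\<^bsub>M\<^esub>i\<in>{..k - j}. b i \<odot>\<^bsub>M\<^esub> c (n - j - i)))"
    by (rule M.finsum_cong') (use ca in \<open>simp_all add: Suc_diff_le smult_r_distr Pi_def\<close>)
  also have "\<dots> = (\<Oplus>\<^bsub>M\<^esub>j\<in>{..k}. ?t j) \<oplus>\<^bsub>M\<^esub>
      (\<Oplus>\<^bsub>M\<^esub>j\<in>{..k}. a j \<odot>\<^bsub>M\<^esub> (\<Oplus>\<^bsub>M\<^esub>i\<in>{..k - j}. b i \<odot>\<^bsub>M\<^esub> c (n - j - i)))"
    by (rule M.finsum_addf) (use ca in \<open>auto intro!: M.finsum_closed\<close>)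
  also have "(\<Oplus>\<^bsub>M\<^esub>j\<in>{..k}. a j \<odot>\<^bsub>M\<^esub> (\<Oplus>\<^bsub>M\<^esub>i\<in>{..k - j}. b i \<odot>\<^bsub>M\<^esub> c (n - j - i)))
      = (\<Oplus>\<^bsub>M\<^esub>j\<in>{..k}. (\<Oplus>i\<in>{..j}. a i \<otimes> b (j - i)) \<odot>\<^bsub>M\<^esub> c (n - j))" (is "_ = ?L")
    using Suc by simp
  also have "?t (Suc k) \<oplus>\<^bsub>M\<^esub> ((\<Oplus>\<^bsub>M\<^esub>j\<in>{..k}. ?t j) \<oplus>\<^bsub>M\<^esub> ?L) = (\<Oplus>\<^bsub>M\<^esub>j\<in>{..Suc k}. ?t j) \<oplus>\<^bsub>M\<^esub> ?L"
    using t ca by (subst M.finsum_Suc) (auto simp: M.a_assoc intro!: M.finsum_closed smult_closed R.finsum_closed)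
  also have "(\<Oplus>\<^bsub>M\<^esub>j\<in>{..Suc k}. ?t j) = (\<Oplus>i\<in>{..Suc k}. a i \<otimes> b (Suc k - i)) \<odot>\<^bsub>M\<^esub> c (n - Suc k)"
    by (subst ldistr) (use ca in \<open>auto simp: smult_assoc1 intro!: M.finsum_cong'\<close>)
  also have "\<dots> \<oplus>\<^bsub>M\<^esub> ?L = (\<Oplus>\<^bsub>M\<^esub>j\<in>{..Suc k}. (\<Oplus>i\<in>{..j}. a i \<otimes> b (j - i)) \<odot>\<^bsub>M\<^esub> c (n - j))"
    by (rule M.finsum_Suc[symmetric]) (use ca in \<open>auto intro!: smult_closed R.finsum_closed\<close>)
  finally show ?case by simp
qed

lemma module_F: "module U F"
proof (rule moduleI)
  show "cring U" by (rule U.is_cring)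
  show "abelian_group F" by (rule abelian_group_F)
  fix p q f g assume p: "p \<in> carrier U" and f: "f \<in> carrier F"
  then have c: "p \<in> up R" "\<And>i. p i \<in> carrier R" "\<And>i. f i \<in> carrier M"
    using U_coeff F_coeff by (auto simp: mem_U)
  show "p \<odot>\<^bsub>F\<^esub> f \<in> carrier F" by (rule F_smult_closed[OF p f])
  have q: "q \<in> up R" "\<And>i. q i \<in> carrier R" if "q \<in> carrier U"
    using that U_coeff by (auto simp: mem_U)
  show "(p \<oplus>\<^bsub>U\<^esub> q) \<odot>\<^bsub>F\<^esub> f = p \<odot>\<^bsub>F\<^esub> f \<oplus>\<^bsub>F\<^esub> q \<odot>\<^bsub>F\<^esub> f" if "q \<in> carrier U"
    using c q[OF that] by (simp add: F_simps U_simps UP_add smult_l_distr Pi_def)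
  show "(p \<otimes>\<^bsub>U\<^esub> q) \<odot>\<^bsub>F\<^esub> f = p \<odot>\<^bsub>F\<^esub> (q \<odot>\<^bsub>F\<^esub> f)" if "q \<in> carrier U"
    using c q[OF that] convolution_smult_assoc[of p q f] by (simp add: F_simps U_simps UP_mult Pi_def)
  show "p \<odot>\<^bsub>F\<^esub> (f \<oplus>\<^bsub>F\<^esub> g) = p \<odot>\<^bsub>F\<^esub> f \<oplus>\<^bsub>F\<^esub> p \<odot>\<^bsub>F\<^esub> g" if "g \<in> carrier F"
    using c F_coeff[OF that] by (simp add: F_simps smult_r_distr Pi_def)
next
  fix f assume "f \<in> carrier F"
  then have c: "f i \<in> carrier M" for i by (rule F_coeff)
  show "\<one>\<^bsub>U\<^esub> \<odot>\<^bsub>F\<^esub> f = f"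
  proof
    fix n
    have "(\<one>\<^bsub>U\<^esub> \<odot>\<^bsub>F\<^esub> f) n = (\<Oplus>\<^bsub>M\<^esub>i\<in>{..n}. if 0 = i then f (n - i) else \<zero>\<^bsub>M\<^esub>)"
      unfolding F_simps U_simps using c by (intro M.finsum_cong') auto
    also have "\<dots> = f (n - 0)" by (rule M.add.finprod_singleton) (use c in auto)
    finally show "(\<one>\<^bsub>U\<^esub> \<odot>\<^bsub>F\<^esub> f) n = f n" by simp
  qed
qed

end

section \<open>Homogeneous elements of the Rees algebra and the Rees module\<close>

context rees
begin

text \<open>The polynomial \<open>a t\<^sup>k\<close>. It depends on the ring alone, so the Rees
  algebras of \<open>I\<close> and of \<open>J\<close> share it.\<close>

definition hcoeff :: "nat \<Rightarrow> 'a \<Rightarrow> nat \<Rightarrow> 'a" where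
  "hcoeff k a = (\<lambda>i. if i = k then a else \<zero>)"

definition helem :: "nat \<Rightarrow> 'm \<Rightarrow> nat \<Rightarrow> 'm" where
  "helem k v = (\<lambda>i. if i = k then v else \<zero>\<^bsub>M\<^esub>)"

lemma hcoeff_up: "a \<in> carrier R \<Longrightarrow> hcoeff k a \<in> up R"
  by (rule mem_upI) (auto simp: hcoeff_def intro!: exI[of _ k])

lemma hcoeff_U: "a \<in> Ip k \<Longrightarrow> hcoeff k a \<in> carrier U"
  unfolding mem_U using hcoeff_up[OF Ip_carrier] by (auto simp: hcoeff_def Ip_zero)

lemma Ug_eq: "Ug k = hcoeff k ` Ip k"
proof
  show "Ug k \<subseteq> hcoeff k ` Ip k"
  proof
    fix p assume "p \<in> Ug k"
    then have "p \<in> carrier U" "\<forall>i. i \<noteq> k \<longrightarrow> p i = \<zero>" by (auto simp: rees_algebra_part_def)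
    then have "p = hcoeff k (p k)" "p k \<in> Ip k" by (auto simp: hcoeff_def mem_U)
    then show "p \<in> hcoeff k ` Ip k" by blast
  qed
  show "hcoeff k ` Ip k \<subseteq> Ug k"
    using hcoeff_U by (auto simp: rees_algebra_part_def hcoeff_def)
qed

lemma helem_F: "v \<in> IM k \<Longrightarrow> helem k v \<in> carrier F"
  by (auto simp: mem_F helem_def IM_zero intro: finite_subset[of _ "{k}"])

lemma Fg_eq: "Fg k = helem k ` IM k"
proof
  show "Fg k \<subseteq> helem k ` IM k"
  proof
    fix f assume "f \<in> Fg k"
    then have "f \<in> carrier F" "\<forall>i. i \<noteq> k \<longrightarrow> f i = \<zero>\<^bsub>M\<^esub>" by (auto simp: rees_module_part_def)
    then have "f = helem k (f k)" "f k \<in> IM k" by (auto simp: helem_def mem_F)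
    then show "f \<in> helem k ` IM k" by blast
  qed
  show "helem k ` IM k \<subseteq> Fg k"
    using helem_F by (auto simp: rees_module_part_def helem_def)
qed

lemma hcoeff_add:
  "a \<in> carrier R \<Longrightarrow> b \<in> carrier R \<Longrightarrow> hcoeff k a \<oplus>\<^bsub>UP R\<^esub> hcoeff k b = hcoeff k (a \<oplus> b)"
  by (simp add: UP_add hcoeff_up) (auto simp: hcoeff_def)

lemma helem_add:
  "v \<in> carrier M \<Longrightarrow> w \<in> carrier M \<Longrightarrow> helem k v \<oplus>\<^bsub>F\<^esub> helem k w = helem k (v \<oplus>\<^bsub>M\<^esub> w)"
  by (auto simp: F_simps helem_def)

lemma hcoeff_zero: "hcoeff k \<zero> = \<zero>\<^bsub>U\<^esub>"
  by (auto simp: hcoeff_def U_simps)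

lemma helem_zero: "helem k \<zero>\<^bsub>M\<^esub> = \<zero>\<^bsub>F\<^esub>"
  by (auto simp: helem_def F_simps)

lemma hcoeff_mult:
  assumes a: "a \<in> carrier R" and b: "b \<in> carrier R"
  shows "hcoeff k a \<otimes>\<^bsub>UP R\<^esub> hcoeff l b = hcoeff (k + l) (a \<otimes> b)"
proof
  fix n
  have "(hcoeff k a \<otimes>\<^bsub>UP R\<^esub> hcoeff l b) n = (\<Oplus>i\<in>{..n}. hcoeff k a i \<otimes> hcoeff l b (n - i))"
    using a b by (simp add: UP_mult hcoeff_up)
  also have "\<dots> = (\<Oplus>i\<in>{..n}. if k = i then a \<otimes> hcoeff l b (n - i) else \<zero>)"
    using a b by (intro R.finsum_cong') (auto simp: hcoeff_def)
  also have "\<dots> = hcoeff (k + l) (a \<otimes> b) n"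
  proof (cases "k \<le> n")
    case True
    have "(\<Oplus>i\<in>{..n}. if k = i then a \<otimes> hcoeff l b (n - i) else \<zero>) = a \<otimes> hcoeff l b (n - k)"
      by (rule R.add.finprod_singleton) (use True a b in \<open>auto simp: hcoeff_def\<close>)
    then show ?thesis using True a by (auto simp: hcoeff_def)
  next
    case False
    have "(\<Oplus>i\<in>{..n}. if k = i then a \<otimes> hcoeff l b (n - i) else \<zero>) = \<zero>"
      by (rule R.add.finprod_one_eqI) (use False in auto)
    then show ?thesis using False by (auto simp: hcoeff_def)
  qed
  finally show "(hcoeff k a \<otimes>\<^bsub>UP R\<^esub> hcoeff l b) n = hcoeff (k + l) (a \<otimes> b) n" .
qed

text \<open>Stated for any sequence \<open>f\<close> in \<open>M\<close>, so that it can be applied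
  to a shifted sequence before this is known to lie in the Rees module.\<close>

lemma hcoeff_smult:
  assumes a: "a \<in> carrier R" and f: "\<And>i. f i \<in> carrier M"
  shows "hcoeff k a \<odot>\<^bsub>F\<^esub> f = (\<lambda>n. if k \<le> n then a \<odot>\<^bsub>M\<^esub> f (n - k) else \<zero>\<^bsub>M\<^esub>)"
proof
  fix n
  have "(hcoeff k a \<odot>\<^bsub>F\<^esub> f) n = (\<Oplus>\<^bsub>M\<^esub>i\<in>{..n}. if k = i then a \<odot>\<^bsub>M\<^esub> f (n - i) else \<zero>\<^bsub>M\<^esub>)"
    unfolding F_simps using a f by (intro M.finsum_cong') (auto simp: hcoeff_def)
  also have "\<dots> = (if k \<le> n then a \<odot>\<^bsub>M\<^esub> f (n - k) else \<zero>\<^bsub>M\<^esub>)"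
  proof (cases "k \<le> n")
    case True
    have "(\<Oplus>\<^bsub>M\<^esub>i\<in>{..n}. if k = i then a \<odot>\<^bsub>M\<^esub> f (n - i) else \<zero>\<^bsub>M\<^esub>) = a \<odot>\<^bsub>M\<^esub> f (n - k)"
      by (rule M.add.finprod_singleton) (use True a f in auto)
    with True show ?thesis by simp
  next
    case False
    have "(\<Oplus>\<^bsub>M\<^esub>i\<in>{..n}. if k = i then a \<odot>\<^bsub>M\<^esub> f (n - i) else \<zero>\<^bsub>M\<^esub>) = \<zero>\<^bsub>M\<^esub>"
      by (rule M.add.finprod_one_eqI) (use False in auto)
    with False show ?thesis by simp
  qed
  finally show "(hcoeff k a \<odot>\<^bsub>F\<^esub> f) n = (if k \<le> n then a \<odot>\<^bsub>M\<^esub> f (n - k) else \<zero>\<^bsub>M\<^esub>)" .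
qed

lemma hcoeff_smult_helem:
  assumes "a \<in> carrier R" "v \<in> carrier M"
  shows "hcoeff k a \<odot>\<^bsub>F\<^esub> helem l v = helem (k + l) (a \<odot>\<^bsub>M\<^esub> v)"
  using assms by (subst hcoeff_smult) (auto simp: helem_def fun_eq_iff)

lemma subcring_Ug0: "subcring (Ug 0) U"
proof (rule U.subcringI', rule U.subringI)
  show "Ug 0 \<subseteq> carrier U" by (auto simp: rees_algebra_part_def)
  show "\<one>\<^bsub>U\<^esub> \<in> Ug 0"
    using U.one_closed by (auto simp: rees_algebra_part_def U_simps)
  have c: "Ip 0 = carrier R" by (rule ideal_pow_0)
  fix p assume "p \<in> Ug 0"
  then obtain a where a: "a \<in> carrier R" "p = hcoeff 0 a" unfolding Ug_eq c by blast
  have "\<ominus>\<^bsub>U\<^esub> p = hcoeff 0 (\<ominus> a)"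
  proof (rule U.minus_equality)
    show "hcoeff 0 (\<ominus> a) \<oplus>\<^bsub>U\<^esub> p = \<zero>\<^bsub>U\<^esub>"
      using a hcoeff_add[of "\<ominus> a" a 0] hcoeff_zero by (simp add: U_simps R.l_neg)
    show "p \<in> carrier U" "hcoeff 0 (\<ominus> a) \<in> carrier U" using a hcoeff_U[of _ 0] c by auto
  qed
  then show "\<ominus>\<^bsub>U\<^esub> p \<in> Ug 0" unfolding Ug_eq c using a by blast
  fix q assume "q \<in> Ug 0"
  then obtain b where b: "b \<in> carrier R" "q = hcoeff 0 b" unfolding Ug_eq c by blast
  show "p \<oplus>\<^bsub>U\<^esub> q \<in> Ug 0" "p \<otimes>\<^bsub>U\<^esub> q \<in> Ug 0"
    unfolding Ug_eq c using a b by (simp_all add: U_simps hcoeff_add hcoeff_mult)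
qed

abbreviation B where "B \<equiv> base_ring U Ug"

lemma carrier_B: "carrier B = hcoeff 0 ` carrier R"
  using Ug_eq[of 0] by (simp add: base_ring_def ideals_set_simps)

lemma module_B_F: "module B F"
  unfolding base_ring_def by (rule module_restrict_scalars[OF module_F subcring_Ug0])

lemma submodule_Ug: "submodule (Ug k) B (part_module U (carrier U))"
proof -
  interpret U': module B "part_module U (carrier U)"
    unfolding base_ring_def by (rule module_restrict_scalars[OF U.module_part_module_carrier subcring_Ug0])
  show ?thesis
  proof (rule U'.submoduleI')
    show "Ug k \<subseteq> carrier (part_module U (carrier U))" using hcoeff_U by (auto simp: Ug_eq part_module_def)
    show "\<zero>\<^bsub>part_module U (carrier U)\<^esub> \<in> Ug k"
      using imageI[OF Ip_zero, of "hcoeff k" k] by (simp add: Ug_eq hcoeff_zero part_module_def)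
    fix p assume "p \<in> Ug k"
    then obtain a where a: "a \<in> Ip k" "p = hcoeff k a" unfolding Ug_eq by blast
    show "p \<oplus>\<^bsub>part_module U (carrier U)\<^esub> q \<in> Ug k" if "q \<in> Ug k" for q
    proof -
      from that obtain b where b: "b \<in> Ip k" "q = hcoeff k b" unfolding Ug_eq by blast
      show ?thesis
        unfolding Ug_eq using a b Ip_carrier Ip_add
        by (simp add: part_module_def U_simps hcoeff_add)
    qed
    show "c \<odot>\<^bsub>part_module U (carrier U)\<^esub> p \<in> Ug k" if "c \<in> carrier B" for c
    proof -
      from that obtain b where b: "b \<in> carrier R" "c = hcoeff 0 b" unfolding carrier_B by blast
      then show ?thesis
        unfolding Ug_eq using a Ip_carrier ideal.I_l_closed[OF ideal_ideal_pow[OF I]]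
        by (simp add: part_module_def U_simps hcoeff_mult)
    qed
  qed
qed

lemma submodule_Fg: "submodule (Fg k) B F"
proof (rule module.submoduleI'[OF module_B_F])
  show "Fg k \<subseteq> carrier F" using helem_F by (auto simp: Fg_eq)
  show "\<zero>\<^bsub>F\<^esub> \<in> Fg k" using imageI[OF IM_zero, of "helem k" k] by (simp add: Fg_eq helem_zero)
  fix f assume "f \<in> Fg k"
  then obtain v where v: "v \<in> IM k" "f = helem k v" unfolding Fg_eq by blast
  show "f \<oplus>\<^bsub>F\<^esub> g \<in> Fg k" if "g \<in> Fg k" for g
  proof -
    from that obtain w where w: "w \<in> IM k" "g = helem k w" unfolding Fg_eq by blast
    show ?thesis unfolding Fg_eq using v w IM_carrier IM_add by (simp add: helem_add)
  qed
  show "c \<odot>\<^bsub>F\<^esub> f \<in> Fg k" if "c \<in> carrier B" for c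
  proof -
    from that obtain b where b: "b \<in> carrier R" "c = hcoeff 0 b" unfolding carrier_B by blast
    then show ?thesis
      unfolding Fg_eq using v IM_carrier submodule_smult_closed[OF submodule_pow_smult[OF I]]
      by (simp add: hcoeff_smult_helem)
  qed
qed

text \<open>Applied twice: with \<open>K = I\<close> it gives that the Rees module is standard, and
  with \<open>K = J\<close>, in degrees from \<open>r\<close> on, the reduction condition.\<close>

lemma Fg_Suc_subset_span:
  assumes K: "ideal K R" and Suc: "IM (Suc n) = ideal_smult R M K (IM n)"
  shows "Fg (Suc n) \<subseteq> span_submodule B F {p \<odot>\<^bsub>F\<^esub> f | p f. p \<in> hcoeff 1 ` K \<and> f \<in> Fg n}"
    (is "_ \<subseteq> span_submodule B F ?S")
proof
  interpret BF: module B F by (rule module_B_F)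
  have cK: "a \<in> carrier R" if "a \<in> K" for a using ideal.Icarr[OF K that] .
  have S: "?S \<subseteq> carrier F"
  proof
    fix s assume "s \<in> ?S"
    then obtain a v where a: "a \<in> K" and v: "v \<in> IM n" and s: "s = hcoeff 1 a \<odot>\<^bsub>F\<^esub> helem n v"
      unfolding Fg_eq by blast
    have "a \<odot>\<^bsub>M\<^esub> v \<in> IM (Suc n)" unfolding Suc by (rule ideal_smult_base[OF a v])
    then show "s \<in> carrier F"
      using hcoeff_smult_helem[OF cK[OF a] IM_carrier[OF v], of 1 n] helem_F[of _ "Suc n"] s by simp
  qed
  note sub = BF.submodule_span_submodule[OF S]
  fix f assume "f \<in> Fg (Suc n)"
  then obtain v where v: "v \<in> ideal_smult R M K (IM n)" and f: "f = helem (Suc n) v"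
    unfolding Fg_eq Suc by blast
  have N: "IM n \<subseteq> carrier M" using IM_carrier by blast
  from v[unfolded ideal_smult_def] ideal_smult_gens_subset[OF K N]
  have "helem (Suc n) v \<in> span_submodule B F ?S"
  proof (induction rule: span_submodule_induct)
    case (base v)
    then obtain a w where a: "a \<in> K" and w: "w \<in> IM n" and v: "v = a \<odot>\<^bsub>M\<^esub> w" by blast
    have "hcoeff 1 a \<odot>\<^bsub>F\<^esub> helem n w \<in> span_submodule B F ?S"
      by (rule span_submodule_base) (use a w in \<open>auto simp: Fg_eq\<close>)
    then show ?case using hcoeff_smult_helem[OF cK[OF a] IM_carrier[OF w], of 1 n] v by simp
  next
    case zero
    show ?case using submodule_zero_closed[OF sub] unfolding helem_zero .
  next
    case (add v w)
    show ?case using submodule_add_closed[OF sub add(3,4)] unfolding helem_add[OF add(1,2)] .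
  next
    case (smult a v)
    have "hcoeff 0 a \<in> carrier B" using smult(1) by (simp add: carrier_B)
    from submodule_smult_closed[OF sub this smult(3)] show ?case
      unfolding hcoeff_smult_helem[OF smult(1,2)] by simp
  qed
  with f show "f \<in> span_submodule B F ?S" by simp
qed

lemma Ug_1: "Ug 1 = hcoeff 1 ` I"
  using Ug_eq[of 1] Ip_1 by simp

lemma standard_module: "standard_module U Ug F Fg"
proof (rule standard_module.intro)
  show "module U F" by (rule module_F)
  show "subcring (Ug 0) U" by (rule subcring_Ug0)
  show "submodule (Ug 1) B (part_module U (carrier U))" by (rule submodule_Ug)
  show "submodule (Fg n) B F" for n by (rule submodule_Fg)
  show "x \<odot>\<^bsub>F\<^esub> f \<in> Fg (Suc n)" if x: "x \<in> Ug 1" and f: "f \<in> Fg n" for x f n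
  proof -
    from x obtain a where a: "a \<in> I" "x = hcoeff 1 a" unfolding Ug_1 by blast
    from f obtain v where v: "v \<in> IM n" "f = helem n v" unfolding Fg_eq by blast
    have "a \<odot>\<^bsub>M\<^esub> v \<in> IM (Suc n)" using ideal_smult_base[OF a(1) v(1)] pow_smult_Suc[OF I] by simp
    then show ?thesis
      using a v hcoeff_smult_helem[of a v 1 n] ideal.Icarr[OF I a(1)] IM_carrier[OF v(1)]
      unfolding Fg_eq by simp
  qed
  show "Fg (Suc n) \<subseteq> span_submodule B F {x \<odot>\<^bsub>F\<^esub> f |x f. x \<in> Ug 1 \<and> f \<in> Fg n}" for n
    unfolding Ug_1 by (rule Fg_Suc_subset_span[OF I pow_smult_Suc[OF I]])
qed

end

section \<open>Application to the Rees modules of \<open>I\<close> and \<open>J\<close>\<close>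

theorem proposition5p1:
  fixes A :: "('a, 'b) ring_scheme" and M :: "('a, 'm, 'c) module_scheme"
    and I J :: "'a set" and r :: nat
  assumes "cring A"
    and "module A M"
    and "ideal I A"
    and "is_reduction A M J I"
    and "reduction_number A M J I = r"
  shows "rt A I M \<le> enat (reduction_number A M J I) + rt A J (M\<lparr>carrier := pow_smult A M I r\<rparr>)"
proof -
  have J: "ideal J A" "J \<subseteq> I" and "\<exists>n. reduction_at A M J I n"
    using assms(4) by (auto simp: is_reduction_def)
  then have red: "reduction_at A M J I r"
    using LeastI_ex assms(5) unfolding reduction_number_def by metis
  define N where "N = M\<lparr>carrier := pow_smult A M I r\<rparr>"
  interpret M: module A M by fact
  interpret F: rees A M I by (intro rees.intro rees_axioms.intro assms)
  have "module A N"
    unfolding N_def by (rule submodule.submodule_is_module[OF M.submodule_pow_smult[OF assms(3)] assms(2)])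
  then interpret G: rees A N J by (intro rees.intro rees_axioms.intro J(1))
  have N_simps: "\<zero>\<^bsub>N\<^esub> = \<zero>\<^bsub>M\<^esub>" "add N = add M" "smult N = smult M" by (simp_all add: N_def)
  have GI: "G.IM k = F.IM (k + r)" for k
    unfolding N_def by (rule M.pow_smult_reduction[OF assms(3) J(1) red])
  \<comment> \<open>In degree 0 every Rees algebra is the copy of \<open>A\<close> formed by the
    constants, so both have the same base ring.\<close>
  have Ug0: "G.Ug 0 = F.Ug 0" unfolding F.Ug_eq G.Ug_eq by (simp add: ideal_pow_0)
  have base: "G.B = F.B" by (simp add: base_ring_def rees_algebra_def Ug0)
  \<comment> \<open>Multiplication by \<open>t\<^sup>r\<close>, which maps degree \<open>k\<close>
    onto degree \<open>k + r\<close> because the two parts have the same coefficients in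
    \<open>M\<close>.\<close>
  define \<iota> :: "(nat \<Rightarrow> 'm) \<Rightarrow> nat \<Rightarrow> 'm" where "\<iota> f = (\<lambda>i. if i < r then \<zero>\<^bsub>M\<^esub> else f (i - r))" for f
  have Gc: "w i \<in> carrier M" if "w \<in> carrier G.F" for w i
    using G.F_coeff[OF that] submodule_subset[OF M.submodule_pow_smult[OF assms(3)]] by (auto simp: N_def)
  have smult: "\<iota> (F.hcoeff k a \<odot>\<^bsub>G.F\<^esub> w) = F.hcoeff k a \<odot>\<^bsub>F.F\<^esub> \<iota> w"
    if a: "a \<in> carrier A" and w: "w \<in> carrier G.F" for k a w
  proof -
    have "\<iota> w i \<in> carrier M" for i using Gc[OF w] by (simp add: \<iota>_def)
    from F.hcoeff_smult[OF a this]
    have 1: "F.hcoeff k a \<odot>\<^bsub>F.F\<^esub> \<iota> w = (\<lambda>n. if k \<le> n then a \<odot>\<^bsub>M\<^esub> \<iota> w (n - k) else \<zero>\<^bsub>M\<^esub>)" .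
    have 2: "F.hcoeff k a \<odot>\<^bsub>G.F\<^esub> w = (\<lambda>n. if k \<le> n then a \<odot>\<^bsub>M\<^esub> w (n - k) else \<zero>\<^bsub>M\<^esub>)"
      using G.hcoeff_smult[OF a G.F_coeff, OF w] unfolding N_simps .
    show ?thesis unfolding 1 2 using a by (auto simp: \<iota>_def fun_eq_iff add.commute)
  qed
  have closed: "\<iota> w \<in> carrier F.F" if w: "w \<in> carrier G.F" for w
  proof -
    have "\<iota> w i \<in> F.IM i" for i
    proof (cases "i < r")
      case True
      then show ?thesis using F.IM_zero by (simp add: \<iota>_def)
    next
      case False
      have "w (i - r) \<in> F.IM (i - r + r)" using w unfolding G.mem_F GI by blast
      with False show ?thesis by (simp add: \<iota>_def)
    qed
    moreover have "{i. \<iota> w i \<noteq> \<zero>\<^bsub>M\<^esub>} \<subseteq> (\<lambda>i. i + r) ` {i. w i \<noteq> \<zero>\<^bsub>M\<^esub>}"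
      by (force simp: \<iota>_def image_iff intro: exI[of _ "_ - r"] split: if_splits)
    then have "finite {i. \<iota> w i \<noteq> \<zero>\<^bsub>M\<^esub>}"
      by (rule finite_subset) (use w in \<open>simp add: G.mem_F N_simps\<close>)
    ultimately show ?thesis by (simp add: F.mem_F)
  qed
  interpret standard_reduction F.U F.Ug F.F F.Fg G.U G.Ug G.F G.Fg r \<iota>
  proof (intro standard_reduction.intro F.standard_module G.standard_module standard_reduction_axioms.intro)
    show "G.B = F.B" by (rule base)
    show "add G.U = add F.U" "monoid.mult G.U = monoid.mult F.U" by (simp_all add: F.U_simps G.U_simps)
    show "G.Ug 1 \<subseteq> F.Ug 1" unfolding F.Ug_1 G.Ug_1 using J(2) by blast
    show "linear_map F.B G.F F.F \<iota>"
    proof (rule linear_mapI)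
      show "\<iota> w \<in> carrier F.F" if "w \<in> carrier G.F" for w by (rule closed[OF that])
      show "\<iota> (w \<oplus>\<^bsub>G.F\<^esub> w') = \<iota> w \<oplus>\<^bsub>F.F\<^esub> \<iota> w'" for w w'
        by (auto simp: F.F_simps G.F_simps N_simps \<iota>_def)
      show "\<iota> (a \<odot>\<^bsub>G.F\<^esub> w) = a \<odot>\<^bsub>F.F\<^esub> \<iota> w" if "a \<in> carrier F.B" "w \<in> carrier G.F" for a w
        using that smult unfolding F.carrier_B by blast
    qed
    show "w = \<zero>\<^bsub>G.F\<^esub>" if "\<iota> w = \<zero>\<^bsub>F.F\<^esub>" for w
    proof
      fix i
      from fun_cong[OF that, of "i + r"] show "w i = \<zero>\<^bsub>G.F\<^esub> i"
        by (simp add: \<iota>_def F.F_simps G.F_simps N_simps)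
    qed
    show "\<iota> ` G.Fg n = F.Fg (n + r)" for n
    proof -
      have "\<iota> (G.helem n v) = F.helem (n + r) v" for v
        by (auto simp: \<iota>_def G.helem_def F.helem_def N_simps fun_eq_iff)
      then show ?thesis unfolding F.Fg_eq G.Fg_eq GI image_image by simp
    qed
    show "\<iota> (y \<odot>\<^bsub>G.F\<^esub> w) = y \<odot>\<^bsub>F.F\<^esub> \<iota> w" if "y \<in> G.Ug 1" "w \<in> carrier G.F" for y w
      using that smult ideal.Icarr[OF J(1)] unfolding G.Ug_1 by blast
    show "F.Fg (Suc n) \<subseteq> span_submodule F.B F.F {y \<odot>\<^bsub>F.F\<^esub> f | y f. y \<in> G.Ug 1 \<and> f \<in> F.Fg n}"
      if "r \<le> n" for n
      unfolding G.Ug_1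
      by (rule F.Fg_Suc_subset_span[OF J(1) M.pow_smult_Suc_reduction[OF assms(3) J(1) red that]])
  qed
  show ?thesis
    using relation_type_le unfolding rt_def assms(5) N_def .
qed

end
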